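(* Let $-A$ be the generator of a bounded $C_0$-semigroup $(e^{-tA})_{t\ge0}$ on a Banach space $X$, let $M:=\sup_{t\ge0}\|e^{-tA}\|$, and let $\varphi\in\Phi$. If $\alpha\in(0,2]$, then for all $x\in\operatorname{dom}(A^\alpha)$, $t>0$ and $n\in\mathbb N$, $$\|e^{-nt\varphi(A/n)}x-e^{-tA}x\|\le 8M\left(\frac{t|\varphi''(0+)|}{n}\right)^{\alpha/2}\|A^\alpha x\|$$ and $$\|e^{-n\varphi(tA/n)}x-e^{-tA}x\|\le 8M\left(\frac{t^2|\varphi''(0+)|}{n}\right)^{\alpha/2}\|A^\alpha x\|.$$
   Context: A function $f\in C^\infty(0,\infty)$ is completely monotone if $f\ge0$ and $(-1)^nf^{(n)}\ge0$ on $(0,\infty)$ for all $n\in\mathbb N$. A nonnegative $\varphi\in C^\infty(0,\infty)$ is a Bernstein function if $\varphi'$ is completely monotone; it extends analytically to $\mathbb C_+=\{\operatorname{Re}z>0\}$ and continuously to $\overline{\mathbb C_+}$, and is identified with this extension. $\Phi$ is the set of Bernstein functions $\varphi$ with $\varphi(0)=0$, $\varphi'(0+)=1$, $|\varphi''(0+)|<\infty$. Subordination: for a Bernstein function $\varphi$ and $t\ge0$ there is a unique positive Radon measure $\nu_t$ on $[0,\infty)$ of total mass at most $1$ with $\int_0^\infty e^{-zs}\nu_t(ds)=e^{-t\varphi(z)}$ for $z\in\mathbb C_+$. For any generator $-B$ of a bounded $C_0$-semigroup, $e^{-t\varphi(B)}:=\int_0^\infty e^{-sB}\,\nu_t(ds)$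 (strong integral); this is a bounded $C_0$-semigroup, whose generator is denoted $-\varphi(B)$. This is used with $B=A/n$ and $B=tA/n$. $A^\alpha$ is the usual fractional power of the (sectorial) operator $A$. *)

theory Defs
  imports "HOL-Analysis.Analysis"
begin

section \<open>Bernstein functions\<close>

text \<open>Functions on the open half-line are represented by total functions on the reals; only
  their values at positive arguments matter.\<close>

definition smooth_on_pos :: "(real \<Rightarrow> real) \<Rightarrow> bool" where
  "smooth_on_pos f \<longleftrightarrow> (\<forall>k. \<forall>x>0. (deriv ^^ k) f differentiable (at x))"

definition completely_monotone :: "(real \<Rightarrow> real) \<Rightarrow> bool" where
  "completely_monotone f \<longleftrightarrow>
     smooth_on_pos f \<and> (\<forall>x>0. f x \<ge> 0) \<and> (\<forall>k. \<forall>x>0. (-1) ^ k * (deriv ^^ k) f x \<ge> 0)"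

definition bernstein_function :: "(real \<Rightarrow> real) \<Rightarrow> bool" where
  "bernstein_function \<phi> \<longleftrightarrow>
     smooth_on_pos \<phi> \<and> (\<forall>x>0. \<phi> x \<ge> 0) \<and> completely_monotone (deriv \<phi>)"

text \<open>The value at \<open>0\<close> of a Bernstein function is that of its continuous extension, i.e. its
  limit from the right.  The second derivative is monotone and nonpositive, so it always has
  a limit at \<open>0+\<close> in the extended reals; the last condition says that this limit is finite.\<close>

definition bernstein_Phi :: "(real \<Rightarrow> real) set" where
  "bernstein_Phi = {\<phi>. bernstein_function \<phi> \<and> (\<phi> \<longlongrightarrow> 0) (at_right 0) \<and>
     (deriv \<phi> \<longlongrightarrow> 1) (at_right 0) \<and> (\<exists>l. (deriv (deriv \<phi>) \<longlongrightarrow> l) (at_right 0))}"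

text \<open>The analytic extension to the open right half-plane, unique by the identity theorem.\<close>

definition halfplane_ext :: "(real \<Rightarrow> real) \<Rightarrow> complex \<Rightarrow> complex" where
  "halfplane_ext f z = (THE w. \<exists>F. F holomorphic_on {z. Re z > 0} \<and>
     (\<forall>x>0. F (complex_of_real x) = complex_of_real (f x)) \<and> w = F z)"

text \<open>The measure \<open>\<nu>\<^sub>t\<close> lives on the space \<open>{0..}\<close>; a finite Borel measure there is automatically
  Radon.\<close>

definition subordination_measure :: "(real \<Rightarrow> real) \<Rightarrow> real \<Rightarrow> real measure" where
  "subordination_measure \<phi> t = (THE \<nu>. sets \<nu> = sets (restrict_space borel {0..}) \<and>
     emeasure \<nu> {0..} \<le> 1 \<and>
     (\<forall>z. Re z > 0 \<longrightarrow>
       (LINT s|\<nu>. exp (- z * complex_of_real s)) = exp (- complex_of_real t * halfplane_ext \<phi> z)))"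


section \<open>The Bochner integral without separability\<close>

text \<open>The library's Bochner integral is restricted to second countable target spaces.  This is
  the same definition (approximation in mean by simple functions) for arbitrary normed spaces;
  approximability by simple functions forces the integrand to be essentially separably valued.\<close>

definition has_vector_integral ::
  "'s measure \<Rightarrow> ('s \<Rightarrow> 'a) \<Rightarrow> 'a::real_normed_vector \<Rightarrow> bool" where
  "has_vector_integral M f y \<longleftrightarrow> f \<in> borel_measurable M \<and>
     (\<exists>g. (\<forall>i. Bochner_Integration.simple_bochner_integrable M (g i)) \<and>
          (\<lambda>i. \<integral>\<^sup>+s. ennreal (norm (f s - g i s)) \<partial>M) \<longlonglongrightarrow> 0 \<and>
          (\<lambda>i. Bochner_Integration.simple_bochner_integral M (g i)) \<longlonglongrightarrow> y)"

definition vector_integral :: "'s measure \<Rightarrow> ('s \<Rightarrow> 'a) \<Rightarrow> 'a::real_normed_vector" where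
  "vector_integral M f = (THE y. has_vector_integral M f y)"


section \<open>Unbounded operators and semigroups\<close>

text \<open>An unbounded operator is identified with its graph: \<open>(x, y) \<in> A\<close> means that \<open>x\<close> lies in
  the domain of \<open>A\<close> and \<open>A x = y\<close>.  Thus \<open>A ^^ k\<close> (relational power) is the operator power with
  its maximal domain.  Spaces are real Banach spaces; complex ones are included by restricting
  scalars, since none of the notions below depends on the scalar field.\<close>

definition op_scale :: "real \<Rightarrow> ('a::real_vector \<times> 'a) set \<Rightarrow> ('a \<times> 'a) set" where
  "op_scale c A = (\<lambda>(x, y). (x, c *\<^sub>R y)) ` A"

text \<open>A semigroup is indexed by real numbers; only its values at nonnegative times matter.\<close>

definition C0_semigroup :: "(real \<Rightarrow> ('a::banach \<Rightarrow>\<^sub>L 'a)) \<Rightarrow> bool" where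
  "C0_semigroup T \<longleftrightarrow> T 0 = id_blinfun \<and>
     (\<forall>s\<ge>0. \<forall>t\<ge>0. T (s + t) = T s o\<^sub>L T t) \<and>
     (\<forall>x. ((\<lambda>t. blinfun_apply (T t) x) \<longlongrightarrow> x) (at_right 0))"

definition bounded_C0_semigroup :: "(real \<Rightarrow> ('a::banach \<Rightarrow>\<^sub>L 'a)) \<Rightarrow> bool" where
  "bounded_C0_semigroup T \<longleftrightarrow> C0_semigroup T \<and> bdd_above ((\<lambda>t. norm (T t)) ` {0..})"

definition generator :: "(real \<Rightarrow> ('a::banach \<Rightarrow>\<^sub>L 'a)) \<Rightarrow> ('a \<times> 'a) set" where
  "generator T =
     {(x, y). ((\<lambda>h. (1 / h) *\<^sub>R (blinfun_apply (T h) x - x)) \<longlongrightarrow> y) (at_right 0)}"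

definition neg_generates_bounded :: "('a::banach \<times> 'a) set \<Rightarrow> bool" where
  "neg_generates_bounded A \<longleftrightarrow> (\<exists>T. bounded_C0_semigroup T \<and> generator T = op_scale (-1) A)"

text \<open>The operator \<open>e\<^bsup>-tA\<^esup>\<close> for \<open>t \<ge> 0\<close>; a \<open>C\<^sub>0\<close>-semigroup is determined by its generator.\<close>

definition exp_neg :: "('a::banach \<times> 'a) set \<Rightarrow> real \<Rightarrow> ('a \<Rightarrow>\<^sub>L 'a)" where
  "exp_neg A t = (THE S. \<exists>T. C0_semigroup T \<and> generator T = op_scale (-1) A \<and> S = T t)"

text \<open>The subordinate semigroup \<open>e\<^bsup>-t\<phi>(B)\<^esup>\<close>.\<close>

definition exp_neg_bernstein ::
  "(real \<Rightarrow> real) \<Rightarrow> ('a::banach \<times> 'a) set \<Rightarrow> real \<Rightarrow> 'a \<Rightarrow> 'a" where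
  "exp_neg_bernstein \<phi> B t x =
     vector_integral (subordination_measure \<phi> t) (\<lambda>s. blinfun_apply (exp_neg B s) x)"


section \<open>Fractional powers\<close>

definition resolvent_neg :: "('a::real_vector \<times> 'a) set \<Rightarrow> real \<Rightarrow> 'a \<Rightarrow> 'a" where
  "resolvent_neg A l w = (THE u. \<exists>v. (u, v) \<in> A \<and> l *\<^sub>R u + v = w)"

text \<open>Balakrishnan's operator with domain \<open>dom (A\<^bsup>m+1\<^esup>)\<close>, where \<open>\<alpha> = m + \<beta>\<close>, \<open>m\<close> is an integer
  and \<open>0 < \<beta> < 1\<close>:
  \<open>J\<^sup>\<alpha> x = sin (\<pi> \<beta>) / \<pi> \<integral>\<^sub>0\<^sup>\<infinity> l\<^bsup>\<beta>-1\<^esup> (l + A)\<^bsup>-1\<^esup> A (A\<^sup>m x) dl\<close>.\<close>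

definition balakrishnan :: "('a::banach \<times> 'a) set \<Rightarrow> real \<Rightarrow> ('a \<times> 'a) set" where
  "balakrishnan A \<alpha> = {(x, (sin (pi * frac \<alpha>) / pi) *\<^sub>R
       vector_integral (restrict_space lborel {0<..})
         (\<lambda>l. (l powr (frac \<alpha> - 1)) *\<^sub>R resolvent_neg A l w)) | x w.
     (x, w) \<in> A ^^ (nat \<lfloor>\<alpha>\<rfloor> + 1)}"

text \<open>The fractional power \<open>A\<^sup>\<alpha>\<close>, for \<open>\<alpha> > 0\<close> and a densely defined sectorial operator \<open>A\<close> (in
  particular for the negative of the generator of a bounded \<open>C\<^sub>0\<close>-semigroup): the ordinary power
  for integer \<open>\<alpha>\<close>, and the closure of Balakrishnan's operator otherwise.\<close>

definition frac_power :: "('a::banach \<times> 'a) set \<Rightarrow> real \<Rightarrow> ('a \<times> 'a) set" where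
  "frac_power A \<alpha> = (if \<alpha> \<in> \<int> then A ^^ nat \<lfloor>\<alpha>\<rfloor> else closure (balakrishnan A \<alpha>))"

end

theory Submission
  imports
    Defs
    "HOL-Probability.Probability"
    "HOL-Complex_Analysis.Complex_Analysis"
    "HOL-Real_Asymp.Real_Asymp"
begin

text \<open>
  Both differences have the form \<open>\<integral> T (c s) x P(ds) - T t x\<close>, where the subordination measure
  \<open>P\<close> is a probability measure for which \<open>c s\<close> has mean \<open>t\<close> and variance at most
  \<open>\<sigma>\<^sup>2 = t \<bar>\<phi>''(0+)\<bar> / n\<close> respectively \<open>t\<^sup>2 \<bar>\<phi>''(0+)\<bar> / n\<close>; both moments are read off the Laplace
  transform at \<open>0\<close>. For \<open>0 < \<alpha> < 1\<close> the orbit of \<open>x\<close> is \<open>\<alpha>\<close>-Hoelder with constant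
  \<open>4 M \<parallel>A\<^sup>\<alpha> x\<parallel>\<close>, because \<open>T h x - x\<close> is the integral of \<open>T r A\<^sup>\<alpha> x\<close> against the kernel
  \<open>((r - h)\<^sub>+ powr (\<alpha> - 1) - r powr (\<alpha> - 1)) / \<Gamma>(\<alpha>)\<close>, which has norm \<open>2 h powr \<alpha> / \<Gamma>(\<alpha> + 1)\<close>.
  For \<open>1 < \<alpha> < 2\<close> this is applied to \<open>A x\<close> and integrated once; the first-order term vanishes
  under \<open>P\<close> since \<open>c s\<close> has mean \<open>t\<close>. Hence the error is at most \<open>4 M \<parallel>A\<^sup>\<alpha> x\<parallel>\<close> times the mean of
  \<open>\<bar>c s - t\<bar> powr \<alpha>\<close>, which is at most \<open>\<sigma> powr \<alpha>\<close>. Testing against functionals reduces all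
  integrals to scalar ones. The measure itself is a weak limit of lattice distributions whose
  weights are the nonnegative Taylor coefficients of \<open>u \<mapsto> exp (- t \<phi> (N - u))\<close>.
\<close>

section \<open>Norming functionals\<close>

text \<open>The space is not assumed separable, so a vector integral is only ever evaluated through
  bounded functionals; those of norm at most 1 recover norms exactly, so this costs no constant. The
  obstacle in the Hoelder estimate is that orbits are merely bounded: the double integrals that
  recover \<open>T h x - x\<close> from Balakrishnan's integral need not converge absolutely. They
  are carried out for the orbit times \<open>exp (- \<delta> * v)\<close>, with an error of order
  \<open>\<delta> powr \<beta>\<close> that is removed at the end. The factor 4 is
  \<open>2 / Gamma (\<beta> + 1)\<close> bounded through
  \<open>Gamma (\<beta> + 1) \<ge> 1 / 2\<close>; the 8 of the theorem leaves a further factor 2.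
  Since a fractional power is a closure, the bound is proved on Balakrishnan's operator and carried
  over by continuity. Existence of the measure rests on the normalisation at 0: the slope of \<phi>
  is at most 1, which gives tightness, and \<open>\<phi> (0+) = 0\<close> gives mass 1. Both
  inequalities are one estimate for time \<open>c * s\<close> with \<open>c * \<tau> = t\<close>,
  where \<tau> is the subordination time.\<close>

lemma norm_functional_maximal:
  fixes x0 :: "'a::real_normed_vector"
  shows "\<exists>F. subspace F \<and> (\<forall>(x, r)\<in>F. r \<le> norm x) \<and> (x0, norm x0) \<in> F \<and>
    (\<forall>G. subspace G \<longrightarrow> (\<forall>(x, r)\<in>G. r \<le> norm x) \<longrightarrow> F \<subseteq> G \<longrightarrow> G = F)"
proof -
  \<comment> \<open>Partial functionals are encoded by their graphs. Domination by the norm forces a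
    graph to be single-valued, since \<open>(0, r)\<close> and \<open>(0, - r)\<close> together give
    \<open>r = 0\<close>; extension of functionals is then plain inclusion.\<close>
  define P where "P F \<longleftrightarrow> subspace F \<and> (\<forall>(x, r)\<in>F. r \<le> norm x) \<and> (x0, norm x0) \<in> F"
    for F :: "('a \<times> real) set"
  have "P (span {(x0, norm x0)})"
  proof -
    have "r \<le> norm x" if xr: "(x, r) \<in> span {(x0, norm x0)}" for x r
    proof -
      obtain k where "(x, r) = k *\<^sub>R (x0, norm x0)"
        using xr by (auto simp: span_singleton)
      then show ?thesis by (simp add: mult_right_mono)
    qed
    then show ?thesis by (auto simp: P_def intro: span_base)
  qed
  moreover have "P (\<Union>C)" if C: "C \<noteq> {}" "subset.chain {F. P F} C" for C
  proof -
    have PC: "P F" if "F \<in> C" for F using C(2) that by (auto simp: subset.chain_def)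
    have "subspace (\<Union>C)"
    proof (rule subspaceI)
      show "0 \<in> \<Union>C" using C(1) PC by (auto simp: P_def dest: subspace_0)
      show "a + b \<in> \<Union>C" if ab: "a \<in> \<Union>C" "b \<in> \<Union>C" for a b
      proof -
        obtain F G where FG: "F \<in> C" "G \<in> C" "a \<in> F" "b \<in> G" using ab by auto
        then consider "F \<subseteq> G" | "G \<subseteq> F" using C(2) by (auto simp: subset.chain_def)
        then show ?thesis
          using FG PC by cases (auto simp: P_def intro: subspace_add)
      qed
      show "c *\<^sub>R a \<in> \<Union>C" if "a \<in> \<Union>C" for a c
        using that PC by (auto simp: P_def intro: subspace_mul)
    qed
    then show ?thesis using PC C(1) by (auto simp: P_def)
  qed
  ultimately obtain F where "P F" "\<forall>X. P X \<longrightarrow> F \<subseteq> X \<longrightarrow> X = F"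
    using subset_Zorn_nonempty[of "{F. P F}"] by auto
  then show ?thesis unfolding P_def by blast
qed

text \<open>One step of the Hahn-Banach extension: the value \<open>c\<close> at \<open>z\<close>
  has to lie above every \<open>r - norm (x - z)\<close> and below every
  \<open>norm (x + z) - r\<close> with \<open>(x, r) \<in> F\<close>, and the triangle inequality
  leaves room for it.\<close>

lemma norm_functional_extend:
  fixes F :: "('a::real_normed_vector \<times> real) set"
  assumes F: "subspace F" and le: "\<And>x r. (x, r) \<in> F \<Longrightarrow> r \<le> norm x"
  obtains G c where "subspace G" "\<And>x r. (x, r) \<in> G \<Longrightarrow> r \<le> norm x" "F \<subseteq> G" "(z, c) \<in> G"
proof -
  have 0: "(0, 0) \<in> F" using subspace_0[OF F] by (simp add: zero_prod_def)
  have key: "r' - norm (x' - z) \<le> norm (x + z) - r" if "(x, r) \<in> F" "(x', r') \<in> F" for x r x' r'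
  proof -
    have "(x + x', r + r') \<in> F" using subspace_add[OF F that] by simp
    then have "r + r' \<le> norm (x + x')" by (rule le)
    also have "\<dots> \<le> norm (x + z) + norm (x' - z)"
      using norm_triangle_ineq[of "x + z" "x' - z"] by simp
    finally show ?thesis by simp
  qed
  \<comment> \<open>The least admissible value is taken; \<open>(0, 0) \<in> F\<close> makes the
    supremum one over a nonempty set and, through \<open>key\<close>, bounds it.\<close>
  define c where "c = (SUP p\<in>F. snd p - norm (fst p - z))"
  have bdd: "bdd_above ((\<lambda>p. snd p - norm (fst p - z)) ` F)"
    by (rule bdd_aboveI2[where M = "norm (0 + z) - 0"]) (use key[OF 0] in auto)
  have c1: "r - norm (x - z) \<le> c" if "(x, r) \<in> F" for x r
    unfolding c_def using cSUP_upper[OF that bdd] by simp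
  have c2: "c \<le> norm (x + z) - r" if "(x, r) \<in> F" for x r
    unfolding c_def by (rule cSUP_least) (use 0 key[OF that] in auto)
  define G where "G = span (insert (z, c) F)"
  have "r \<le> norm x" if xrG: "(x, r) \<in> G" for x r
  proof -
    obtain k where k: "(x, r) - k *\<^sub>R (z, c) \<in> F"
      using xrG span_eq_iff[THEN iffD2, OF F] unfolding G_def span_breakdown_eq by auto
    \<comment> \<open>Dividing by \<open>\<bar>k\<bar>\<close> reduces an element of
      \<open>G\<close> to coefficient 1 or -1 at \<open>z\<close>, where \<open>c2\<close> and
      \<open>c1\<close> are exactly the bounds required.\<close>
    show ?thesis
    proof (cases k "0::real" rule: linorder_cases)
      case equal
      then show ?thesis using k by (auto intro: le)
    next
      case greater
      have "(1/k) *\<^sub>R ((x, r) - k *\<^sub>R (z, c)) \<in> F" using F k by (rule subspace_mul)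
      then have "((1/k) *\<^sub>R x - z, r / k - c) \<in> F" using greater by (simp add: algebra_simps)
      from c2[OF this] have "r / k \<le> norm ((1/k) *\<^sub>R x)" by simp
      then show ?thesis using greater by (simp add: field_simps)
    next
      case less
      have "(-1/k) *\<^sub>R ((x, r) - k *\<^sub>R (z, c)) \<in> F" using F k by (rule subspace_mul)
      then have "((-1/k) *\<^sub>R x + z, - r / k + c) \<in> F" using less by (simp add: algebra_simps)
      from c1[OF this] have "- r / k \<le> norm ((-1/k) *\<^sub>R x)" by simp
      then show ?thesis using less by (simp add: field_simps)
    qed
  qed
  moreover have "subspace G" "F \<subseteq> G" "(z, c) \<in> G"
    unfolding G_def by (auto intro: span_base subspace_span)
  ultimately show thesis using that by blast
qed

text \<open>A maximal dominated graph has the whole space as its domain, since otherwise it could be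
  extended; domination at \<open>z\<close> and at \<open>- z\<close> bounds
  \<open>\<bar>\<psi> z\<bar>\<close>.\<close>

theorem norming_functional:
  fixes x :: "'a::real_normed_vector"
  obtains \<psi> :: "'a \<Rightarrow> real" where "bounded_linear \<psi>" "\<And>z. \<bar>\<psi> z\<bar> \<le> norm z" "\<psi> x = norm x"
proof -
  obtain F where F: "subspace F" and le': "\<forall>(x, r)\<in>F. r \<le> norm x" and xF: "(x, norm x) \<in> F"
    and max: "\<forall>G. subspace G \<longrightarrow> (\<forall>(x, r)\<in>G. r \<le> norm x) \<longrightarrow> F \<subseteq> G \<longrightarrow> G = F"
    using norm_functional_maximal[of x] by blast
  have le: "r \<le> norm x" if "(x, r) \<in> F" for x r using le' that by auto
  have ex: "\<exists>c. (z, c) \<in> F" for z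
  proof -
    obtain G c where "subspace G" "\<And>x r. (x, r) \<in> G \<Longrightarrow> r \<le> norm x" "F \<subseteq> G" "(z, c) \<in> G"
      using norm_functional_extend[OF F le] by metis
    with max show ?thesis by blast
  qed
  have un: "r = s" if "(z, r) \<in> F" "(z, s) \<in> F" for z r s
  proof -
    have "(0, r - s) \<in> F" "(0, s - r) \<in> F"
      using subspace_diff[OF F that] subspace_diff[OF F that(2) that(1)] by simp_all
    from le[OF this(1)] le[OF this(2)] show ?thesis by simp
  qed
  define \<psi> where "\<psi> z = (THE c. (z, c) \<in> F)" for z
  have \<psi>F: "(z, \<psi> z) \<in> F" for z
    unfolding \<psi>_def using ex un by (metis theI)
  have \<psi>_eq: "\<psi> z = c" if "(z, c) \<in> F" for z c using un \<psi>F that by blast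
  have add: "\<psi> (a + b) = \<psi> a + \<psi> b" for a b
    using subspace_add[OF F \<psi>F \<psi>F] by (intro \<psi>_eq) simp
  have scale: "\<psi> (c *\<^sub>R a) = c * \<psi> a" for a c
    using subspace_mul[OF F \<psi>F] by (intro \<psi>_eq) simp
  have bound: "\<bar>\<psi> z\<bar> \<le> norm z" for z
    using le[OF \<psi>F[of z]] le[OF \<psi>F[of "- z"]] scale[of "-1" z] by simp
  show thesis
  proof
    show "bounded_linear \<psi>"
      by (rule bounded_linear_intro[where K = 1]) (use add scale bound in auto)
  qed (use bound \<psi>_eq[OF xF] in auto)
qed

lemma norm_le_by_functionals:
  fixes x :: "'a::real_normed_vector"
  assumes "\<And>\<psi>. bounded_linear \<psi> \<Longrightarrow> (\<And>z. \<bar>\<psi> z\<bar> \<le> norm z) \<Longrightarrow> \<psi> x \<le> B"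
  shows "norm x \<le> B"
proof -
  obtain \<psi> where "bounded_linear \<psi>" "\<And>z. \<bar>\<psi> z\<bar> \<le> norm z" "\<psi> x = norm x"
    by (rule norming_functional[of x]) blast
  with assms[of \<psi>] show ?thesis by simp
qed

lemma eq_by_functionals:
  fixes x y :: "'a::real_normed_vector"
  assumes "\<And>\<psi>::'a \<Rightarrow> real. bounded_linear \<psi> \<Longrightarrow> \<psi> x = \<psi> y"
  shows "x = y"
proof -
  have "norm (x - y) \<le> 0"
  proof (rule norm_le_by_functionals)
    fix \<psi> :: "'a \<Rightarrow> real"
    assume \<psi>: "bounded_linear \<psi>"
    show "\<psi> (x - y) \<le> 0"
      using assms[OF \<psi>] by (simp add: linear_diff[OF bounded_linear.linear[OF \<psi>]])
  qed
  then show ?thesis by simp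
qed

section \<open>The vector-valued integral\<close>

text \<open>On a non-separable space the difference of two measurable functions need not be
  measurable. Here \<open>s\<close> has finitely many values, and on each of its level sets
  \<open>f\<close> is compared with a constant.\<close>

lemma norm_diff_simple_measurable:
  fixes f s :: "'s \<Rightarrow> 'a::real_normed_vector"
  assumes f: "f \<in> borel_measurable M" and s: "simple_function M s"
  shows "(\<lambda>x. norm (f x - s x)) \<in> borel_measurable M"
proof -
  have "(\<lambda>x. norm (f x - d)) \<in> borel_measurable M" for d
    by (rule measurable_compose[OF f borel_measurable_continuous_onI])
       (intro continuous_intros)
  moreover have "s \<in> M \<rightarrow>\<^sub>M count_space (s ` space M)"
    using s by (auto simp: simple_function_def measurable_count_space_eq2)
  ultimately show ?thesis
    using measurable_compose_countable'[of "s ` space M" "\<lambda>d x. norm (f x - d)" M borel s] s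
    by (auto simp: simple_function_def intro: countable_finite)
qed

text \<open>\<open>f\<close> only mediates: two simple functions close to it in mean have close
  integrals, which makes the integrals of approximants a Cauchy sequence.\<close>

lemma simple_bochner_integral_diff_le:
  fixes f s t :: "'s \<Rightarrow> 'a::real_normed_vector"
  assumes f: "f \<in> borel_measurable M"
    and s: "Bochner_Integration.simple_bochner_integrable M s" and t: "Bochner_Integration.simple_bochner_integrable M t"
  shows "ennreal (norm (Bochner_Integration.simple_bochner_integral M s - Bochner_Integration.simple_bochner_integral M t)) \<le>
    (\<integral>\<^sup>+x. ennreal (norm (f x - s x)) \<partial>M) + (\<integral>\<^sup>+x. ennreal (norm (f x - t x)) \<partial>M)"
proof -
  have "ennreal (norm (Bochner_Integration.simple_bochner_integral M s - Bochner_Integration.simple_bochner_integral M t)) =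
      norm (Bochner_Integration.simple_bochner_integral M (\<lambda>x. s x - t x))"
    using s t by (simp add: simple_bochner_integral_diff)
  also have "\<dots> \<le> Bochner_Integration.simple_bochner_integral M (\<lambda>x. norm (s x - t x))"
    using simple_bochner_integrable_compose2[of "(-)" M s t] s t
    by (auto intro!: simple_bochner_integral_norm_bound)
  also have "\<dots> = (\<integral>\<^sup>+x. norm (s x - t x) \<partial>M)"
    using simple_bochner_integrable_compose2[of "\<lambda>x y. norm (x - y)" M s t] s t
    by (auto intro!: simple_bochner_integral_eq_nn_integral)
  also have "\<dots> \<le> (\<integral>\<^sup>+x. ennreal (norm (f x - s x)) + ennreal (norm (f x - t x)) \<partial>M)"
  proof (rule nn_integral_mono)
    fix x
    have "norm (s x - t x) \<le> norm (f x - s x) + norm (f x - t x)"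
      by (metis dual_order.refl norm_diff_triangle_le norm_minus_commute)
    then show "ennreal (norm (s x - t x)) \<le> ennreal (norm (f x - s x)) + ennreal (norm (f x - t x))"
      by (metis ennreal_leI ennreal_plus norm_ge_zero)
  qed
  also have "\<dots> = (\<integral>\<^sup>+x. ennreal (norm (f x - s x)) \<partial>M) + (\<integral>\<^sup>+x. ennreal (norm (f x - t x)) \<partial>M)"
    using norm_diff_simple_measurable[OF f] s t
    by (intro nn_integral_add) (auto elim!: simple_bochner_integrable.cases)
  finally show ?thesis .
qed

text \<open>\<open>g i x\<close> is the point nearest to \<open>f x\<close> among the first
  \<open>i + 1\<close> terms of a sequence through \<open>D\<close>. The errors tend to 0 pointwise
  and are dominated by \<open>norm (f x)\<close>.\<close>

lemma has_vector_integral_exists: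
  fixes f :: "'s \<Rightarrow> 'a::banach"
  assumes f: "f \<in> borel_measurable M" and D: "countable D" "f ` space M \<subseteq> closure D"
    and fin: "(\<integral>\<^sup>+x. ennreal (norm (f x)) \<partial>M) < \<infinity>"
  shows "\<exists>y. has_vector_integral M f y"
proof -
  \<comment> \<open>The sequence starts with 0, so that the nearest point is never farther from
    \<open>f x\<close> than 0 is; this supplies the integrable majorant.\<close>
  define d where "d i = (case i of 0 \<Rightarrow> 0 | Suc j \<Rightarrow> from_nat_into (insert 0 D) j)" for i
  have d0: "d 0 = 0" and D_d: "D \<subseteq> range d"
  proof -
    show "d 0 = 0" by (simp add: d_def)
    show "D \<subseteq> range d"
    proof
      fix y assume "y \<in> D"
      then obtain j where "y = from_nat_into (insert 0 D) j"
        using D(1) by (metis countable_insert from_nat_into_surj insertCI)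
      then have "y = d (Suc j)" by (simp add: d_def)
      then show "y \<in> range d" by blast
    qed
  qed
  define Q where "Q i x j \<longleftrightarrow> j \<le> i \<and> (\<forall>l\<in>{..i}. norm (f x - d j) \<le> norm (f x - d l))" for i x j
  \<comment> \<open>\<open>LEAST\<close> resolves ties measurably, because \<open>Q\<close> is a
    finite conjunction of comparisons between measurable norms.\<close>
  define k where "k i x = (LEAST j. Q i x j)" for i x
  define g where "g i x = d (k i x)" for i x
  have exQ: "\<exists>j. Q i x j" for i x
    using arg_min_if_finite(1)[of "{..i}" "\<lambda>j. norm (f x - d j)"]
      arg_min_least[of "{..i}" _ "\<lambda>j. norm (f x - d j)"] by (auto simp: Q_def)
  have Qk: "Q i x (k i x)" for i x
    unfolding k_def using exQ by (rule LeastI_ex)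
  have k_le: "k i x \<le> i" for i x using Qk[of i x] by (simp add: Q_def)
  have g_min: "norm (f x - g i x) \<le> norm (f x - d l)" if "l \<le> i" for x i l
    using Qk[of i x] that by (auto simp: Q_def g_def)
  have g_le: "norm (f x - g i x) \<le> norm (f x)" for x i
    using g_min[of 0 i x] by (simp add: d0)
  have [measurable]: "(\<lambda>x. norm (f x - c)) \<in> borel_measurable M" for c
    by (rule measurable_compose[OF f borel_measurable_continuous_onI])
       (intro continuous_intros)
  have [measurable]: "k i \<in> M \<rightarrow>\<^sub>M count_space UNIV" for i
    unfolding k_def Q_def by measurable
  have sk: "simple_function M (k i)" for i
    unfolding simple_function_def
  proof (intro conjI ballI)
    show "finite (k i ` space M)" by (rule finite_subset[of _ "{..i}"]) (auto simp: k_le)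
  qed measurable
  have sg: "simple_function M (g i)" for i
    unfolding g_def by (rule simple_function_compose1[OF sk])
  have nf: "(\<lambda>x. ennreal (norm (f x))) \<in> borel_measurable M"
    by (rule measurable_compose[OF f borel_measurable_continuous_onI])
       (intro continuous_intros continuous_on_ennreal)
  have sbg: "Bochner_Integration.simple_bochner_integrable M (g i)" for i
  proof (rule simple_bochner_integrableI_bounded[OF sg])
    have "(\<integral>\<^sup>+x. ennreal (norm (g i x)) \<partial>M) \<le> (\<integral>\<^sup>+x. 2 * ennreal (norm (f x)) \<partial>M)"
    proof (rule nn_integral_mono)
      fix x
      have "norm (g i x) \<le> 2 * norm (f x)"
        using g_le[of x i] norm_triangle_ineq2[of "g i x" "f x"] norm_minus_commute[of "f x" "g i x"] by linarith
      then show "ennreal (norm (g i x)) \<le> 2 * ennreal (norm (f x))"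
        using ennreal_mult'[of 2 "norm (f x)"] by (metis ennreal_leI ennreal_numeral zero_le_numeral)
    qed
    also have "\<dots> = 2 * (\<integral>\<^sup>+x. ennreal (norm (f x)) \<partial>M)" by (rule nn_integral_cmult[OF nf])
    also have "\<dots> < \<infinity>" using fin by (simp add: ennreal_mult_less_top)
    finally show "(\<integral>\<^sup>+x. ennreal (norm (g i x)) \<partial>M) < \<infinity>" .
  qed
  have lim: "(\<lambda>i. norm (f x - g i x)) \<longlonglongrightarrow> 0" if x: "x \<in> space M" for x
  proof (rule LIMSEQ_I)
    fix e :: real assume e: "e > 0"
    obtain y where y: "y \<in> D" "norm (f x - y) < e"
      using x D(2) e by (force simp: closure_approachable dist_norm norm_minus_commute)
    then obtain l where l: "y = d l" using D_d by auto
    show "\<exists>n0. \<forall>n\<ge>n0. norm (norm (f x - g n x) - 0) < e"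
      using g_min[of l _ x] y(2) l by (intro exI[of _ l]) (auto intro: le_less_trans)
  qed
  have int0: "(\<lambda>i. \<integral>\<^sup>+x. ennreal (norm (f x - g i x)) \<partial>M) \<longlonglongrightarrow> 0"
  proof -
    have "(\<lambda>i. \<integral>\<^sup>+x. ennreal (norm (f x - g i x)) \<partial>M) \<longlonglongrightarrow> (\<integral>\<^sup>+x. 0 \<partial>M)"
    proof (rule nn_integral_dominated_convergence[where w="\<lambda>x. ennreal (norm (f x))"])
      show "(\<lambda>x. ennreal (norm (f x - g i x))) \<in> borel_measurable M" for i
        using norm_diff_simple_measurable[OF f sg, of i] by measurable
      show "AE x in M. ennreal (norm (f x - g i x)) \<le> ennreal (norm (f x))" for i
        using g_le by (auto intro: ennreal_leI)
      show "AE x in M. (\<lambda>i. ennreal (norm (f x - g i x))) \<longlonglongrightarrow> 0"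
        using lim by (auto intro!: AE_I2 simp: tendsto_ennreal_iff simp flip: ennreal_0)
    qed (use nf fin in auto)
    then show ?thesis by simp
  qed
  have "Cauchy (\<lambda>i. Bochner_Integration.simple_bochner_integral M (g i))"
  proof (rule CauchyI)
    fix e :: real assume e: "e > 0"
    then have "eventually (\<lambda>i. (\<integral>\<^sup>+x. ennreal (norm (f x - g i x)) \<partial>M) < ennreal (e / 2)) sequentially"
      using int0 by (intro order_tendstoD(2)) auto
    then obtain n where n: "\<And>i. i \<ge> n \<Longrightarrow> (\<integral>\<^sup>+x. ennreal (norm (f x - g i x)) \<partial>M) < ennreal (e / 2)"
      by (auto simp: eventually_sequentially)
    have "norm (Bochner_Integration.simple_bochner_integral M (g i) - Bochner_Integration.simple_bochner_integral M (g j)) < e"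
      if "i \<ge> n" "j \<ge> n" for i j
    proof -
      have "ennreal (norm (Bochner_Integration.simple_bochner_integral M (g i) - Bochner_Integration.simple_bochner_integral M (g j)))
          < ennreal (e / 2) + ennreal (e / 2)"
        using simple_bochner_integral_diff_le[OF f sbg sbg, of i j] n[OF that(1)] n[OF that(2)]
        by (meson add_strict_mono le_less_trans)
      also have "\<dots> = ennreal e" using e by (simp flip: ennreal_plus)
      finally show ?thesis using e by (simp add: ennreal_less_iff)
    qed
    then show "\<exists>n. \<forall>i\<ge>n. \<forall>j\<ge>n. norm (Bochner_Integration.simple_bochner_integral M (g i) - Bochner_Integration.simple_bochner_integral M (g j)) < e"
      by blast
  qed
  then obtain y where "(\<lambda>i. Bochner_Integration.simple_bochner_integral M (g i)) \<longlonglongrightarrow> y"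
    by (auto simp: Cauchy_convergent_iff convergent_def)
  then show ?thesis
    unfolding has_vector_integral_def using f sbg int0 by blast
qed

text \<open>A bounded functional carries approximating simple functions to approximating simple
  functions and enlarges the error in mean by at most the factor \<open>K\<close>.\<close>

lemma has_bochner_integral_functional:
  fixes \<psi> :: "'a::real_normed_vector \<Rightarrow> real"
  assumes hv: "has_vector_integral M f y" and \<psi>: "bounded_linear \<psi>"
  shows "has_bochner_integral M (\<lambda>x. \<psi> (f x)) (\<psi> y)"
proof -
  interpret \<psi>: bounded_linear \<psi> by fact
  obtain g where f: "f \<in> borel_measurable M" and g: "\<And>i. Bochner_Integration.simple_bochner_integrable M (g i)"
    and lim: "(\<lambda>i. \<integral>\<^sup>+s. ennreal (norm (f s - g i s)) \<partial>M) \<longlonglongrightarrow> 0"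
    and conv: "(\<lambda>i. Bochner_Integration.simple_bochner_integral M (g i)) \<longlonglongrightarrow> y"
    using hv unfolding has_vector_integral_def by blast
  obtain K where K: "K > 0" "\<And>x. norm (\<psi> x) \<le> norm x * K" using \<psi>.pos_bounded by blast
  show ?thesis
  proof (rule has_bochner_integral.intros)
    show "(\<lambda>x. \<psi> (f x)) \<in> borel_measurable M"
      by (rule measurable_compose[OF f borel_measurable_continuous_onI])
         (intro continuous_intros \<psi>.continuous_on)
    show "Bochner_Integration.simple_bochner_integrable M (\<lambda>x. \<psi> (g i x))" for i
      using simple_bochner_integrable_compose2[of "\<lambda>x y. \<psi> x", OF _ g g] by (simp add: \<psi>.zero)
    show "(\<lambda>i. \<integral>\<^sup>+x. ennreal (norm (\<psi> (f x) - \<psi> (g i x))) \<partial>M) \<longlonglongrightarrow> 0"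
    proof (rule tendsto_sandwich[OF _ _ tendsto_const])
      show "\<forall>\<^sub>F i in sequentially. (\<integral>\<^sup>+x. ennreal (norm (\<psi> (f x) - \<psi> (g i x))) \<partial>M)
          \<le> ennreal K * (\<integral>\<^sup>+x. ennreal (norm (f x - g i x)) \<partial>M)"
      proof (rule always_eventually, rule allI)
        fix i
        have "(\<lambda>x. ennreal (norm (f x - g i x))) \<in> borel_measurable M"
          using norm_diff_simple_measurable[OF f, of "g i"] g[of i]
          by (auto elim: simple_bochner_integrable.cases)
        then have "ennreal K * (\<integral>\<^sup>+x. ennreal (norm (f x - g i x)) \<partial>M)
            = (\<integral>\<^sup>+x. ennreal K * ennreal (norm (f x - g i x)) \<partial>M)"
          by (simp add: nn_integral_cmult)
        also have "(\<integral>\<^sup>+x. ennreal (norm (\<psi> (f x) - \<psi> (g i x))) \<partial>M) \<le> \<dots>"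
        proof (rule nn_integral_mono)
          fix x
          have "norm (\<psi> (f x) - \<psi> (g i x)) \<le> K * norm (f x - g i x)"
            using K(2)[of "f x - g i x"] by (simp only: \<psi>.diff mult.commute)
          then have "ennreal (norm (\<psi> (f x) - \<psi> (g i x))) \<le> ennreal (K * norm (f x - g i x))"
            by (rule ennreal_leI)
          also have "\<dots> = ennreal K * ennreal (norm (f x - g i x))"
            using K(1) by (intro ennreal_mult) auto
          finally show "ennreal (norm (\<psi> (f x) - \<psi> (g i x))) \<le> ennreal K * ennreal (norm (f x - g i x))" .
        qed
        finally show "(\<integral>\<^sup>+x. ennreal (norm (\<psi> (f x) - \<psi> (g i x))) \<partial>M)
          \<le> ennreal K * (\<integral>\<^sup>+x. ennreal (norm (f x - g i x)) \<partial>M)" .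
      qed
      show "(\<lambda>i. ennreal K * (\<integral>\<^sup>+x. ennreal (norm (f x - g i x)) \<partial>M)) \<longlonglongrightarrow> 0"
        using ennreal_tendsto_cmult[OF _ lim, of "ennreal K"] by simp
    qed simp
    show "(\<lambda>i. Bochner_Integration.simple_bochner_integral M (\<lambda>x. \<psi> (g i x))) \<longlonglongrightarrow> \<psi> y"
      using \<psi>.tendsto[OF conv] by (simp add: simple_bochner_integral_linear[OF \<psi>.linear_axioms g])
  qed
qed

lemma vector_integral_eqI:
  fixes y :: "'a::real_normed_vector"
  assumes "has_vector_integral M f y"
  shows "vector_integral M f = y"
  unfolding vector_integral_def
proof (rule the_equality)
  fix z assume z: "has_vector_integral M f z"
  show "z = y"
  proof (rule eq_by_functionals)
    fix \<psi> :: "'a \<Rightarrow> real" assume \<psi>: "bounded_linear \<psi>"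
    show "\<psi> z = \<psi> y"
      by (rule has_bochner_integral_eq[OF has_bochner_integral_functional[OF z \<psi>]
            has_bochner_integral_functional[OF assms \<psi>]])
  qed
qed fact

text \<open>Continuity on \<open>S\<close> puts the range into the closure of the image of a
  countable dense subset of \<open>S\<close>, so the integral exists. All later vector integrals are
  evaluated through this lemma.\<close>

lemma functional_vector_integral:
  fixes f :: "real \<Rightarrow> 'a::banach" and \<psi> :: "'a \<Rightarrow> real"
  assumes M: "sets M = sets (restrict_space borel S)" and f: "continuous_on S f"
    and fin: "(\<integral>\<^sup>+x. ennreal (norm (f x)) \<partial>M) < \<infinity>"
    and \<psi>: "bounded_linear \<psi>"
  shows "integrable M (\<lambda>s. \<psi> (f s))" "\<psi> (vector_integral M f) = (LINT s|M. \<psi> (f s))"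
proof -
  have S: "space M = S" using sets_eq_imp_space_eq[OF M] by (simp add: space_restrict_space)
  have meas: "f \<in> borel_measurable M"
    using borel_measurable_continuous_on_restrict[OF f] measurable_cong_sets[OF M refl] by blast
  obtain T where T: "countable T" "T \<subseteq> S" "S \<subseteq> closure T" by (rule separable)
  have "f ` S \<subseteq> closure (f ` T)"
  proof safe
    fix x assume x: "x \<in> S"
    show "f x \<in> closure (f ` T)"
      unfolding closure_approachable
    proof safe
      fix e :: real assume "e > 0"
      then obtain r where r: "r > 0" "\<And>y. y \<in> S \<Longrightarrow> dist y x < r \<Longrightarrow> dist (f y) (f x) < e"
        using f x unfolding continuous_on_iff by metis
      obtain y where "y \<in> T" "dist y x < r"
        using x T(3) r(1) by (force simp: closure_approachable)
      then show "\<exists>y\<in>f ` T. dist y (f x) < e" using r(2) T(2) by auto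
    qed
  qed
  then obtain y where y: "has_vector_integral M f y"
    using has_vector_integral_exists[OF meas, of "f ` T"] T(1) fin S by auto
  have "has_bochner_integral M (\<lambda>s. \<psi> (f s)) (\<psi> y)"
    by (rule has_bochner_integral_functional[OF y \<psi>])
  with vector_integral_eqI[OF y] show "integrable M (\<lambda>s. \<psi> (f s))"
      "\<psi> (vector_integral M f) = (LINT s|M. \<psi> (f s))"
    by (auto simp: has_bochner_integral_iff)
qed

section \<open>Scalar fractional integrals\<close>

lemma set_integral_exp:
  assumes "(l::real) > 0"
  shows "set_integrable lborel {0<..} (\<lambda>s. exp (- l * s))" "(LBINT s:{0<..}. exp (- l * s)) = 1 / l"
  using integrable_I0i_exp_mscale[OF assms] LBINT_I0i_exp_mscale[OF assms]
  by (simp_all add: mult.commute interval_integral_to_infinity_eq zero_ereal_def)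

lemma set_integrable_exp_mult:
  fixes f :: "real \<Rightarrow> real"
  assumes l: "l > 0" and f: "continuous_on {0<..} f" and C: "\<And>s. s > 0 \<Longrightarrow> \<bar>f s\<bar> \<le> C"
  shows "set_integrable lborel {0<..} (\<lambda>s. exp (- l * s) * f s)"
    "\<bar>LBINT s:{0<..}. exp (- l * s) * f s\<bar> \<le> C / l"
proof -
  have int: "set_integrable lborel {0<..} (\<lambda>s. C * exp (- l * s))"
    using set_integral_exp(1)[OF l] by (rule set_integrable_mult_right)
  have le: "\<bar>exp (- l * s) * f s\<bar> \<le> C * exp (- l * s)" if "s > 0" for s
    using C[OF that] by (simp add: abs_mult mult.commute)
  show int': "set_integrable lborel {0<..} (\<lambda>s. exp (- l * s) * f s)"
  proof (rule set_integrable_bound[OF int])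
    show "set_borel_measurable lborel {0<..} (\<lambda>s. exp (- l * s) * f s)"
      unfolding set_borel_measurable_def
      by (simp only: measurable_lborel2, intro borel_measurable_continuous_on_indicator continuous_intros f) auto
  qed (use le in \<open>auto intro!: AE_I2 order_trans[OF _ abs_ge_self]\<close>)
  have "\<bar>LBINT s:{0<..}. exp (- l * s) * f s\<bar> \<le> (LBINT s:{0<..}. \<bar>exp (- l * s) * f s\<bar>)"
    using set_integral_norm_bound[OF int'] by simp
  also have "\<dots> \<le> (LBINT s:{0<..}. C * exp (- l * s))"
    by (rule set_integral_mono) (use int' int le in \<open>auto intro: set_integrable_abs\<close>)
  also have "\<dots> = C / l" using set_integral_exp(2)[OF l] by simp
  finally show "\<bar>LBINT s:{0<..}. exp (- l * s) * f s\<bar> \<le> C / l" .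
qed

text \<open>The integrand is the derivative of \<open>- exp (- l * s) * u (r + s)\<close>, which
  vanishes at infinity because \<open>u\<close> is bounded. With \<open>u\<close> and
  \<open>g\<close> the scalar orbits of \<open>x\<close> and \<open>A x\<close>, this is the
  resolvent equation under a functional.\<close>

lemma laplace_integral_by_parts:
  fixes u g :: "real \<Rightarrow> real"
  assumes l: "l > 0" and r: "r \<ge> 0"
    and u': "\<And>s. s \<ge> 0 \<Longrightarrow> (u has_real_derivative - g s) (at s within {0..})"
    and g: "continuous_on {0..} g"
    and U: "\<And>s. s \<ge> 0 \<Longrightarrow> \<bar>u s\<bar> \<le> U" and G: "\<And>s. s \<ge> 0 \<Longrightarrow> \<bar>g s\<bar> \<le> G"
  shows "(LBINT s:{0<..}. exp (- l * s) * (g (r + s) + l * u (r + s))) = u r"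
proof -
  have u: "continuous_on {0..} u" using u' by (intro DERIV_continuous_on) auto
  have cu: "continuous_on {0..} (\<lambda>s. u (r + s))" and cg: "continuous_on {0..} (\<lambda>s. g (r + s))"
    using r by (auto intro!: continuous_on_compose2[OF u] continuous_on_compose2[OF g] continuous_intros)
  define f where "f s = exp (- l * s) * (g (r + s) + l * u (r + s))" for s
  have cf: "continuous_on {0..} f" unfolding f_def by (intro continuous_intros cu cg)
  have int: "set_integrable lborel {0<..} f"
    unfolding f_def
  proof (rule set_integrable_exp_mult(1)[OF l])
    show "continuous_on {0<..} (\<lambda>s. g (r + s) + l * u (r + s))"
      by (rule continuous_on_subset[of "{0..}"]) (auto intro!: continuous_intros cu cg)
    show "\<bar>g (r + s) + l * u (r + s)\<bar> \<le> G + l * U" if "s > 0" for s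
      using U[of "r + s"] G[of "r + s"] l r that
      by (intro order_trans[OF abs_triangle_ineq] add_mono) (auto simp: abs_mult)
  qed
  define F where "F s = - exp (- l * s) * u (r + s)" for s
  have F': "(F has_vector_derivative f s) (at s)" if s: "s > 0" for s
  proof -
    have "(u has_real_derivative - g (r + s)) (at (r + s) within {0<..})"
      by (rule has_field_derivative_subset[OF u']) (use r s in auto)
    then have "(u has_real_derivative - g (r + s)) (at (r + s))"
      using r s by (simp add: at_within_open[of _ "{0<..}"])
    then have "((\<lambda>s. u (r + s)) has_real_derivative - g (r + s)) (at s)"
      using DERIV_shift[of u _ s r] by (simp add: add.commute)
    then show ?thesis
      unfolding F_def f_def has_real_derivative_iff_has_vector_derivative[symmetric]
      by (auto intro!: derivative_eq_intros simp: algebra_simps)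
  qed
  have "(LBINT s=0..\<infinity>. f s) = 0 - (- u r)"
  proof (rule interval_integral_FTC_integrable)
    show "(F has_vector_derivative f s) (at s)" if "0 < ereal s" for s
      using that by (intro F') auto
    show "isCont f s" if "0 < ereal s" for s
    proof -
      have "continuous_on {0<..} f" by (rule continuous_on_subset[OF cf]) auto
      then show ?thesis using that by (simp add: continuous_on_eq_continuous_at)
    qed
    show "set_integrable lborel (einterval 0 \<infinity>) f"
      using int by (simp add: zero_ereal_def)
    have "continuous_on {0..} F" unfolding F_def by (intro continuous_intros cu)
    then have "(F \<longlongrightarrow> F 0) (at_right 0)"
      by (auto simp: continuous_on_def at_within_Ici_at_right dest: bspec[of _ _ 0])
    then show "((F \<circ> real_of_ereal) \<longlongrightarrow> - u r) (at_right 0)"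
      by (simp add: zero_ereal_def ereal_tendsto_simps F_def)
    have "(F \<longlongrightarrow> 0) at_top"
    proof (rule Lim_null_comparison)
      show "\<forall>\<^sub>F s in at_top. norm (F s) \<le> exp (- l * s) * U"
        using eventually_ge_at_top[of 0]
        by eventually_elim (use r U in \<open>auto simp: F_def abs_mult\<close>)
      show "((\<lambda>s. exp (- l * s) * U) \<longlongrightarrow> 0) at_top"
        using l by real_asymp
    qed
    then show "((F \<circ> real_of_ereal) \<longlongrightarrow> 0) (at_left \<infinity>)"
      by (simp add: ereal_tendsto_simps)
  qed simp
  then show ?thesis by (simp add: interval_integral_to_infinity_eq zero_ereal_def f_def)
qed

section \<open>Gamma and Beta kernels, and Fubini for fractional integrals\<close>

lemma has_bochner_integral_Gamma_kernel:
  fixes \<beta> s :: real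
  assumes \<beta>: "\<beta> > 0" and s: "s > 0"
  shows "has_bochner_integral lborel (\<lambda>m. indicator {0<..} m * (m powr (\<beta> - 1) * exp (- (m * s))))
    (Gamma \<beta> * s powr - \<beta>)"
proof -
  have "has_bochner_integral lborel (\<lambda>m. indicator {0<..} m * (m powr (\<beta> - 1) * exp (- m))) (Gamma \<beta>)"
  proof (rule has_bochner_integral_nn_integral, goal_cases)
    case 4
    have "(\<integral>\<^sup>+m. ennreal (indicator {0<..} m * (m powr (\<beta> - 1) * exp (- m))) \<partial>lborel)
        = (\<integral>\<^sup>+m. ennreal (m powr (\<beta> - 1) / exp m) * indicator {0..} m \<partial>lborel)"
      by (intro nn_integral_cong) (auto simp: indicator_def exp_minus divide_inverse)
    also have "\<dots> = ennreal (Gamma \<beta>)"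
      by (rule nn_integral_has_integral_lebesgue'[OF _ Gamma_integral_real[OF \<beta>]]) auto
    finally show ?case .
  qed (use \<beta> in \<open>auto intro: less_imp_le[OF Gamma_real_pos]\<close>)
  then have "has_bochner_integral lborel (\<lambda>m. indicator {0<..} (0 + s * m) *
      ((0 + s * m) powr (\<beta> - 1) * exp (- (0 + s * m)))) (Gamma \<beta> /\<^sub>R \<bar>s\<bar>)"
    using s by (subst (asm) lborel_has_bochner_integral_real_affine_iff[of s _ _ 0]) auto
  then have "has_bochner_integral lborel (\<lambda>m. s powr (1 - \<beta>) * (indicator {0<..} (0 + s * m) *
      ((0 + s * m) powr (\<beta> - 1) * exp (- (0 + s * m))))) (s powr (1 - \<beta>) * (Gamma \<beta> /\<^sub>R \<bar>s\<bar>))"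
    by (rule has_bochner_integral_mult_right)
  moreover have "s powr (1 - \<beta>) * (indicator {0<..} (0 + s * m) * ((0 + s * m) powr (\<beta> - 1) * exp (- (0 + s * m))))
      = indicator {0<..} m * (m powr (\<beta> - 1) * exp (- (m * s)))" for m
    using s by (auto simp: indicator_def powr_mult zero_less_mult_iff mult.commute powr_diff powr_minus field_simps)
  moreover have "s powr (1 - \<beta>) * (Gamma \<beta> /\<^sub>R \<bar>s\<bar>) = Gamma \<beta> * s powr - \<beta>"
    using s by (simp add: powr_diff powr_minus field_simps)
  ultimately show ?thesis by (simp only:)
qed

text \<open>The exponents \<open>\<beta> - 1\<close> and \<open>- \<beta>\<close> add up to -1, so
  scaling the interval to unit length leaves a value independent of \<open>v\<close>, the Beta
  function at \<open>(\<beta>, 1 - \<beta>)\<close>.\<close>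

lemma has_bochner_integral_Beta_kernel:
  fixes \<beta> v :: real
  assumes \<beta>: "0 < \<beta>" "\<beta> < 1" and v: "v > 0"
  shows "has_bochner_integral lborel
    (\<lambda>r. if 0 < r \<and> r < v then r powr (\<beta> - 1) * (v - r) powr - \<beta> else 0) (Gamma \<beta> * Gamma (1 - \<beta>))"
proof -
  have Beta: "Beta \<beta> (1 - \<beta>) = Gamma \<beta> * Gamma (1 - \<beta>)" by (simp add: Beta_def)
  have "has_bochner_integral lborel
    (\<lambda>r. if 0 < r \<and> r < 1 then r powr (\<beta> - 1) * (1 - r) powr - \<beta> else 0) (Gamma \<beta> * Gamma (1 - \<beta>))"
  proof (rule has_bochner_integral_nn_integral, goal_cases)
    case 4
    have "(\<integral>\<^sup>+r. ennreal (if 0 < r \<and> r < 1 then r powr (\<beta> - 1) * (1 - r) powr - \<beta> else 0) \<partial>lborel)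
        = (\<integral>\<^sup>+r. ennreal (r powr (\<beta> - 1) * (1 - r) powr ((1 - \<beta>) - 1)) * indicator {0..1} r \<partial>lborel)"
      by (intro nn_integral_cong) (auto simp: indicator_def)
    also have "\<dots> = ennreal (Beta \<beta> (1 - \<beta>))"
      using \<beta> by (intro nn_integral_has_integral_lebesgue'[OF _ has_integral_Beta_real]) auto
    finally show ?case by (simp only: Beta)
  qed (use \<beta> in \<open>auto intro!: mult_nonneg_nonneg less_imp_le[OF Gamma_real_pos]\<close>)
  then have "has_bochner_integral lborel
    (\<lambda>r. if 0 < 0 + (1 / v) * r \<and> 0 + (1 / v) * r < 1 then (0 + (1 / v) * r) powr (\<beta> - 1) * (1 - (0 + (1 / v) * r)) powr - \<beta> else 0)
      (Gamma \<beta> * Gamma (1 - \<beta>) /\<^sub>R \<bar>1 / v\<bar>)"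
    using v by (subst (asm) lborel_has_bochner_integral_real_affine_iff[of "1 / v" _ _ 0]) auto
  then have "has_bochner_integral lborel
    (\<lambda>r. (1 / v) * (if 0 < 0 + (1 / v) * r \<and> 0 + (1 / v) * r < 1 then (0 + (1 / v) * r) powr (\<beta> - 1) * (1 - (0 + (1 / v) * r)) powr - \<beta> else 0))
      ((1 / v) * (Gamma \<beta> * Gamma (1 - \<beta>) /\<^sub>R \<bar>1 / v\<bar>))"
    by (rule has_bochner_integral_mult_right)
  moreover have "(1 / v) * (if 0 < 0 + (1 / v) * r \<and> 0 + (1 / v) * r < 1 then (0 + (1 / v) * r) powr (\<beta> - 1) * (1 - (0 + (1 / v) * r)) powr - \<beta> else 0)
      = (if 0 < r \<and> r < v then r powr (\<beta> - 1) * (v - r) powr - \<beta> else 0)" for r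
  proof (cases "0 < r \<and> r < v")
    case True
    have "1 - r / v = (v - r) / v" using v by (simp add: field_simps)
    then have "(1 / v) * ((r / v) powr (\<beta> - 1) * (1 - r / v) powr - \<beta>) = r powr (\<beta> - 1) * (v - r) powr - \<beta>"
      using True v by (simp add: powr_divide powr_diff powr_minus field_simps)
    then show ?thesis using True v by (simp add: field_simps)
  next
    case False
    then show ?thesis using v by (auto simp: zero_less_divide_iff)
  qed
  moreover have "(1 / v) * (Gamma \<beta> * Gamma (1 - \<beta>) /\<^sub>R \<bar>1 / v\<bar>) = Gamma \<beta> * Gamma (1 - \<beta>)"
    using v by simp
  ultimately show ?thesis by (simp only:)
qed

lemma nn_integral_eq_has_bochner_integral:
  assumes "has_bochner_integral M f x" "\<And>y. 0 \<le> f y"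
  shows "(\<integral>\<^sup>+y. ennreal (f y) \<partial>M) = ennreal x"
  using assms nn_integral_eq_integral[of M f] by (auto simp: has_bochner_integral_iff)

text \<open>Nonnegativity of \<open>k\<close> lets Tonelli reduce joint integrability of
  \<open>k m s * q s\<close> to integrability of \<open>w s * q s\<close>; an application then only
  has to integrate the kernel in its first variable.\<close>

lemma kernel_Fubini:
  fixes k :: "real \<Rightarrow> real \<Rightarrow> real" and q w :: "real \<Rightarrow> real"
  assumes k[measurable]: "case_prod k \<in> borel_measurable (lborel \<Otimes>\<^sub>M lborel)"
    and q[measurable]: "q \<in> borel_measurable borel"
    and nonneg: "\<And>m s. k m s \<ge> 0" and zero: "\<And>m s. s \<le> 0 \<Longrightarrow> k m s = 0"
    and w: "\<And>s. s > 0 \<Longrightarrow> has_bochner_integral lborel (\<lambda>m. k m s) (w s)"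
    and fin: "integrable lborel (\<lambda>s. indicator {0<..} s * (w s * q s))"
  shows "integrable lborel (\<lambda>m. LBINT s. k m s * q s)"
    "(LBINT m. LBINT s. k m s * q s) = (LBINT s. indicator {0<..} s * (w s * q s))"
proof -
  have inner: "(\<integral>\<^sup>+m. ennreal (norm (k m s * q s)) \<partial>lborel) = ennreal (norm (indicator {0<..} s * (w s * q s)))"
    "(LBINT m. k m s * q s) = indicator {0<..} s * (w s * q s)" for s
  proof -
    have mult: "has_bochner_integral lborel (\<lambda>m. k m s * c) (w s * c)" if "s > 0" for c
      by (intro has_bochner_integral_mult_left w that)
    have "w s \<ge> 0" if "s > 0"
      unfolding has_bochner_integral_integral_eq[OF w[OF that], symmetric]
      by (intro Bochner_Integration.integral_nonneg nonneg)
    then show "(\<integral>\<^sup>+m. ennreal (norm (k m s * q s)) \<partial>lborel) = ennreal (norm (indicator {0<..} s * (w s * q s)))"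
      using nn_integral_eq_has_bochner_integral[OF mult[of "\<bar>q s\<bar>"]] nonneg
      by (cases "s > 0") (simp_all add: abs_mult zero)
    show "(LBINT m. k m s * q s) = indicator {0<..} s * (w s * q s)"
      using has_bochner_integral_integral_eq[OF mult[of "q s"]]
      by (cases "s > 0") (simp_all add: zero)
  qed
  have int: "integrable (lborel \<Otimes>\<^sub>M lborel) (\<lambda>(m, s). k m s * q s)"
  proof (rule integrableI_bounded)
    have "(\<integral>\<^sup>+x. ennreal (norm (case x of (m, s) \<Rightarrow> k m s * q s)) \<partial>(lborel \<Otimes>\<^sub>M lborel))
        = (\<integral>\<^sup>+s. \<integral>\<^sup>+m. ennreal (norm (k m s * q s)) \<partial>lborel \<partial>lborel)"
      by (subst lborel_pair.nn_integral_snd[symmetric]) auto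
    then show "(\<integral>\<^sup>+x. ennreal (norm (case x of (m, s) \<Rightarrow> k m s * q s)) \<partial>(lborel \<Otimes>\<^sub>M lborel)) < \<infinity>"
      unfolding inner using fin by (simp only: integrable_iff_bounded)
  qed simp
  show "integrable lborel (\<lambda>m. LBINT s. k m s * q s)" by (rule lborel_pair.integrable_fst[OF int])
  show "(LBINT m. LBINT s. k m s * q s) = (LBINT s. indicator {0<..} s * (w s * q s))"
    unfolding lborel_pair.Fubini_integral[OF int, symmetric] inner ..
qed

lemma integrable_powr_exp_bound:
  fixes q :: "real \<Rightarrow> real"
  assumes b: "b > 0" and \<delta>: "\<delta> > 0" and q: "q \<in> borel_measurable borel"
    and C: "\<And>s. s > 0 \<Longrightarrow> \<bar>q s\<bar> \<le> C * exp (- \<delta> * s)"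
  shows "integrable lborel (\<lambda>s. indicator {0<..} s * (c * s powr (b - 1) * q s))"
proof (rule Bochner_Integration.integrable_bound)
  show "integrable lborel (\<lambda>s. \<bar>c\<bar> * C * (indicator {0<..} s * (s powr (b - 1) * exp (- (s * \<delta>)))))"
    using has_bochner_integral_Gamma_kernel[OF b \<delta>]
    by (intro integrable_mult_right) (auto simp: has_bochner_integral_iff)
  show "AE s in lborel. norm (indicator {0<..} s * (c * s powr (b - 1) * q s))
      \<le> norm (\<bar>c\<bar> * C * (indicator {0<..} s * (s powr (b - 1) * exp (- (s * \<delta>)))))"
  proof (rule AE_I2)
    fix s :: real
    show "norm (indicator {0<..} s * (c * s powr (b - 1) * q s))
        \<le> norm (\<bar>c\<bar> * C * (indicator {0<..} s * (s powr (b - 1) * exp (- (s * \<delta>)))))"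
      using mult_left_mono[OF order_trans[OF C abs_ge_self], of s "\<bar>c\<bar> * s powr (b - 1)"]
      by (auto simp: indicator_def abs_mult mult_ac)
  qed
qed (use q in measurable)

text \<open>Integrating \<open>exp (- m * s)\<close> against \<open>m powr (\<beta> - 1)\<close>
  first yields \<open>Gamma \<beta> * s powr - \<beta>\<close>. Thus a Balakrishnan integral of
  Laplace transforms becomes, up to Gamma factors, a fractional integral of order
  \<open>1 - \<beta>\<close>.\<close>

lemma stieltjes_laplace_Fubini:
  fixes q :: "real \<Rightarrow> real"
  assumes \<beta>: "0 < \<beta>" "\<beta> < 1" and \<delta>: "\<delta> > 0" and q: "q \<in> borel_measurable borel"
    and C: "\<And>s. s > 0 \<Longrightarrow> \<bar>q s\<bar> \<le> C * exp (- \<delta> * s)"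
  shows "integrable lborel (\<lambda>m. indicator {0<..} m * (m powr (\<beta> - 1) * (LBINT s:{0<..}. exp (- m * s) * q s)))"
    "(LBINT m. indicator {0<..} m * (m powr (\<beta> - 1) * (LBINT s:{0<..}. exp (- m * s) * q s)))
      = Gamma \<beta> * (LBINT s:{0<..}. s powr - \<beta> * q s)"
proof -
  define k where "k m s = indicator {0<..} s * (indicator {0<..} m * (m powr (\<beta> - 1) * exp (- (m * s))))" for m s :: real
  have "case_prod k \<in> borel_measurable (lborel \<Otimes>\<^sub>M lborel)" unfolding k_def by measurable
  note Fubini = kernel_Fubini[OF this q, where w = "\<lambda>s. Gamma \<beta> * s powr - \<beta>"]
  have fin: "integrable lborel (\<lambda>s. indicator {0<..} s * (Gamma \<beta> * s powr - \<beta> * q s))"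
    using integrable_powr_exp_bound[of "1 - \<beta>" \<delta> q C "Gamma \<beta>"] \<beta> \<delta> q C by simp
  have w: "has_bochner_integral lborel (\<lambda>m. k m s) (Gamma \<beta> * s powr - \<beta>)" if "s > 0" for s
    using has_bochner_integral_Gamma_kernel[OF \<beta>(1) that] that by (simp add: k_def)
  have outer: "(LBINT s. k m s * q s) = indicator {0<..} m * (m powr (\<beta> - 1) * (LBINT s:{0<..}. exp (- m * s) * q s))" for m
  proof -
    have "(LBINT s. k m s * q s) = (LBINT s. indicator {0<..} m * (m powr (\<beta> - 1) * (indicator {0<..} s *\<^sub>R (exp (- m * s) * q s))))"
      by (intro Bochner_Integration.integral_cong) (auto simp: k_def)
    then show ?thesis by (simp add: set_lebesgue_integral_def)
  qed
  have k: "k m s \<ge> 0" "s \<le> 0 \<Longrightarrow> k m s = 0" for m s by (auto simp: k_def)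
  show "integrable lborel (\<lambda>m. indicator {0<..} m * (m powr (\<beta> - 1) * (LBINT s:{0<..}. exp (- m * s) * q s)))"
    using Fubini(1)[OF k w fin] by (simp only: outer)
  show "(LBINT m. indicator {0<..} m * (m powr (\<beta> - 1) * (LBINT s:{0<..}. exp (- m * s) * q s)))
      = Gamma \<beta> * (LBINT s:{0<..}. s powr - \<beta> * q s)"
    using Fubini(2)[OF k w fin] by (simp add: outer set_lebesgue_integral_def mult.assoc mult.left_commute[of _ "Gamma \<beta>"])
qed

text \<open>The composition law of fractional integrals: orders \<open>1 - \<beta>\<close> and
  \<open>\<beta>\<close> combine to a plain integration, by the Beta kernel after the substitution
  \<open>v = r + s\<close>.\<close>

lemma fractional_integral_Fubini:
  fixes q :: "real \<Rightarrow> real"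
  assumes \<beta>: "0 < \<beta>" "\<beta> < 1" and \<delta>: "\<delta> > 0" and q: "q \<in> borel_measurable borel"
    and C: "\<And>s. s > 0 \<Longrightarrow> \<bar>q s\<bar> \<le> C * exp (- \<delta> * s)"
  shows "integrable lborel (\<lambda>r. indicator {0<..} r * (r powr (\<beta> - 1) * (LBINT s:{0<..}. s powr - \<beta> * q (r + s))))"
    "(LBINT r. indicator {0<..} r * (r powr (\<beta> - 1) * (LBINT s:{0<..}. s powr - \<beta> * q (r + s))))
      = Gamma \<beta> * Gamma (1 - \<beta>) * (LBINT v:{0<..}. q v)"
proof -
  define k where "k r v = (if 0 < r \<and> r < v then r powr (\<beta> - 1) * (v - r) powr - \<beta> else 0)" for r v :: real
  define b where "b = Gamma \<beta> * Gamma (1 - \<beta>)"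
  have "case_prod k \<in> borel_measurable (lborel \<Otimes>\<^sub>M lborel)" unfolding k_def by measurable
  note Fubini = kernel_Fubini[OF this q, where w = "\<lambda>v. b"]
  have fin: "integrable lborel (\<lambda>v. indicator {0<..} v * (b * q v))"
  proof -
    have "indicator {0<..} v * (b * v powr (1 - 1) * q v) = indicator {0<..} v * (b * q v)" for v :: real
      by (simp add: indicator_def)
    with integrable_powr_exp_bound[OF zero_less_one \<delta> q C, of b] show ?thesis by (simp only:)
  qed
  have w: "has_bochner_integral lborel (\<lambda>r. k r v) b" if "v > 0" for v
    using has_bochner_integral_Beta_kernel[OF \<beta> that] by (simp add: k_def b_def)
  have outer: "(LBINT v. k r v * q v) = indicator {0<..} r * (r powr (\<beta> - 1) * (LBINT s:{0<..}. s powr - \<beta> * q (r + s)))" for r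
  proof -
    have "(LBINT v. k r v * q v) = (LBINT s. k r (r + s) * q (r + s))"
      using lborel_integral_real_affine[of 1 "\<lambda>v. k r v * q v" r] by simp
    also have "\<dots> = (LBINT s. indicator {0<..} r * (r powr (\<beta> - 1) * (indicator {0<..} s *\<^sub>R (s powr - \<beta> * q (r + s)))))"
      by (intro Bochner_Integration.integral_cong) (auto simp: k_def indicator_def)
    finally show ?thesis by (simp add: set_lebesgue_integral_def)
  qed
  have k: "k r v \<ge> 0" "v \<le> 0 \<Longrightarrow> k r v = 0" for r v by (auto simp: k_def)
  show "integrable lborel (\<lambda>r. indicator {0<..} r * (r powr (\<beta> - 1) * (LBINT s:{0<..}. s powr - \<beta> * q (r + s))))"
    using Fubini(1)[OF k w fin] by (simp only: outer)
  show "(LBINT r. indicator {0<..} r * (r powr (\<beta> - 1) * (LBINT s:{0<..}. s powr - \<beta> * q (r + s))))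
      = Gamma \<beta> * Gamma (1 - \<beta>) * (LBINT v:{0<..}. q v)"
    unfolding b_def[symmetric] using Fubini(2)[OF k w fin]
    by (simp add: outer set_lebesgue_integral_def mult.left_commute[of _ b])
qed

lemma set_integral_eq_LBINT: "(LBINT x:A. f x) = (LBINT x. indicator A x * (f x :: real))"
  by (simp add: set_lebesgue_integral_def)

text \<open>The case \<open>q s = exp (- \<delta> * s)\<close> of the Fubini identity, with Laplace
  transform \<open>1 / (m + \<delta>)\<close>. It is the integrable majorant both for the damping
  error and for the resolvents in Balakrishnan's integral.\<close>

lemma stieltjes_integral:
  fixes \<beta> \<delta> :: real
  assumes \<beta>: "0 < \<beta>" "\<beta> < 1" and \<delta>: "\<delta> > 0"
  shows "integrable lborel (\<lambda>m. indicator {0<..} m * (m powr (\<beta> - 1) * (1 / (m + \<delta>))))"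
    "(LBINT m. indicator {0<..} m * (m powr (\<beta> - 1) * (1 / (m + \<delta>))))
      = Gamma \<beta> * Gamma (1 - \<beta>) * \<delta> powr (\<beta> - 1)"
proof -
  have inner: "indicator {0<..} m * (m powr (\<beta> - 1) * (LBINT s:{0<..}. exp (- m * s) * exp (- \<delta> * s)))
      = indicator {0<..} m * (m powr (\<beta> - 1) * (1 / (m + \<delta>)))" for m
  proof (cases "m > 0")
    case True
    then show ?thesis
      using set_integral_exp(2)[of "m + \<delta>"] \<delta> by (simp add: algebra_simps flip: exp_add)
  qed simp
  have "(LBINT s:{0<..}. s powr - \<beta> * exp (- \<delta> * s)) = (LBINT s. indicator {0<..} s * (s powr ((1 - \<beta>) - 1) * exp (- (s * \<delta>))))"
    by (simp add: set_integral_eq_LBINT mult.commute)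
  also have "\<dots> = Gamma (1 - \<beta>) * \<delta> powr - (1 - \<beta>)"
    using \<beta> \<delta> by (intro has_bochner_integral_integral_eq has_bochner_integral_Gamma_kernel) auto
  finally have "(LBINT s:{0<..}. s powr - \<beta> * exp (- \<delta> * s)) = Gamma (1 - \<beta>) * \<delta> powr (\<beta> - 1)" by simp
  then show "integrable lborel (\<lambda>m. indicator {0<..} m * (m powr (\<beta> - 1) * (1 / (m + \<delta>))))"
    "(LBINT m. indicator {0<..} m * (m powr (\<beta> - 1) * (1 / (m + \<delta>))))
      = Gamma \<beta> * Gamma (1 - \<beta>) * \<delta> powr (\<beta> - 1)"
    using stieltjes_laplace_Fubini[OF \<beta> \<delta>, of "\<lambda>s. exp (- \<delta> * s)" 1] unfolding inner by simp_all
qed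

text \<open>The difference of the two exponentials has constant sign, so its absolute integral is
  computed exactly. The bound measures how far damping by \<delta> moves a Laplace
  transform.\<close>

lemma laplace_diff_bound:
  fixes f :: "real \<Rightarrow> real"
  assumes m: "m > 0" and \<delta>: "\<delta> > 0" and f: "continuous_on {0<..} f" and U: "\<And>s. s > 0 \<Longrightarrow> \<bar>f s\<bar> \<le> U"
  shows "\<bar>(LBINT s:{0<..}. exp (- m * s) * f s) - (LBINT s:{0<..}. exp (- (m + \<delta>) * s) * f s)\<bar>
    \<le> U * (1 / m - 1 / (m + \<delta>))"
proof -
  have m\<delta>: "m + \<delta> > 0" using m \<delta> by simp
  note int1 = set_integrable_exp_mult(1)[OF m f U]
  note int2 = set_integrable_exp_mult(1)[OF m\<delta> f U]
  have int: "set_integrable lborel {0<..} (\<lambda>s. exp (- m * s) * f s - exp (- (m + \<delta>) * s) * f s)"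
    by (rule set_integral_diff(1)[OF int1 int2])
  have "(LBINT s:{0<..}. exp (- m * s) * f s) - (LBINT s:{0<..}. exp (- (m + \<delta>) * s) * f s)
      = (LBINT s:{0<..}. exp (- m * s) * f s - exp (- (m + \<delta>) * s) * f s)"
    by (rule set_integral_diff(2)[OF int1 int2, symmetric])
  also have "\<bar>\<dots>\<bar> \<le> (LBINT s:{0<..}. \<bar>exp (- m * s) * f s - exp (- (m + \<delta>) * s) * f s\<bar>)"
    using set_integral_norm_bound[OF int] by simp
  also have "\<dots> \<le> (LBINT s:{0<..}. U * (exp (- m * s) - exp (- (m + \<delta>) * s)))"
  proof (rule set_integral_mono)
    show "set_integrable lborel {0<..} (\<lambda>s. \<bar>exp (- m * s) * f s - exp (- (m + \<delta>) * s) * f s\<bar>)"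
      using int by (rule set_integrable_abs)
    show "set_integrable lborel {0<..} (\<lambda>s. U * (exp (- m * s) - exp (- (m + \<delta>) * s)))"
      by (intro set_integrable_mult_right set_integral_diff(1) set_integral_exp(1) m m\<delta>)
    fix s :: real assume s: "s \<in> {0<..}"
    have "exp (- (m + \<delta>) * s) \<le> exp (- m * s)" using s \<delta> by (simp add: algebra_simps)
    then have "\<bar>(exp (- m * s) - exp (- (m + \<delta>) * s)) * f s\<bar> \<le> (exp (- m * s) - exp (- (m + \<delta>) * s)) * U"
      unfolding abs_mult using s U[of s] by (intro mult_mono) auto
    then show "\<bar>exp (- m * s) * f s - exp (- (m + \<delta>) * s) * f s\<bar> \<le> U * (exp (- m * s) - exp (- (m + \<delta>) * s))"
      by (simp only: left_diff_distrib mult.commute[of U])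
  qed
  also have "\<dots> = U * (1 / m - 1 / (m + \<delta>))"
    using set_integral_diff(2)[OF set_integral_exp(1)[OF m] set_integral_exp(1)[OF m\<delta>]]
      set_integral_exp(2)[OF m] set_integral_exp(2)[OF m\<delta>] by simp
  finally show ?thesis .
qed

lemma interval_integral_FTC_nonneg':
  fixes f F :: "real \<Rightarrow> real" and a b :: ereal
  assumes "a < b" "\<forall>x. a < ereal x \<longrightarrow> ereal x < b \<longrightarrow> DERIV F x :> f x \<and> isCont f x \<and> 0 \<le> f x"
    and "((F \<circ> real_of_ereal) \<longlongrightarrow> A) (at_right a)" "((F \<circ> real_of_ereal) \<longlongrightarrow> B) (at_left b)"
  shows "set_integrable lborel (einterval a b) f \<and> (LBINT x=a..b. f x) = B - A"
  using interval_integral_FTC_nonneg[of a b F f A B] assms by auto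

text \<open>The kernel is negative on \<open>(0, h)\<close> and nonnegative beyond \<open>h\<close>,
  and either part has mass \<open>h powr \<beta> / \<beta>\<close>. Beyond \<open>h\<close> the
  primitive \<open>((r - h) powr \<beta> - r powr \<beta>) / \<beta>\<close> vanishes at infinity
  because \<open>\<beta> < 1\<close>.\<close>

lemma powr_difference_kernel:
  fixes \<beta> h :: real
  assumes \<beta>: "0 < \<beta>" "\<beta> < 1" and h: "h > 0"
  defines "k \<equiv> \<lambda>r. indicator {0<..} (r - h) * (r - h) powr (\<beta> - 1) - indicator {0<..} r * r powr (\<beta> - 1)"
  shows "integrable lborel (\<lambda>r. \<bar>k r\<bar>)" "(LBINT r. \<bar>k r\<bar>) = 2 * h powr \<beta> / \<beta>"
proof -
  have 1: "set_integrable lborel (einterval 0 h) (\<lambda>r. r powr (\<beta> - 1)) \<and>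
    (LBINT r=0..h. r powr (\<beta> - 1)) = h powr \<beta> / \<beta> - 0"
  proof (rule interval_integral_FTC_nonneg'[where F = "\<lambda>r. r powr \<beta> / \<beta>"])
    show "\<forall>r. 0 < ereal r \<longrightarrow> ereal r < ereal h \<longrightarrow> DERIV (\<lambda>r. r powr \<beta> / \<beta>) r :> r powr (\<beta> - 1)
        \<and> isCont (\<lambda>r. r powr (\<beta> - 1)) r \<and> 0 \<le> r powr (\<beta> - 1)"
      using \<beta> by (auto intro!: derivative_eq_intros continuous_intros simp: zero_ereal_def)
    have "((\<lambda>r. r powr \<beta> / \<beta>) \<longlongrightarrow> 0) (at_right 0)" using \<beta> by real_asymp
    then show "(((\<lambda>r. r powr \<beta> / \<beta>) \<circ> real_of_ereal) \<longlongrightarrow> 0) (at_right 0)"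
      by (simp add: zero_ereal_def ereal_tendsto_simps)
    have "((\<lambda>r. r powr \<beta> / \<beta>) \<longlongrightarrow> h powr \<beta> / \<beta>) (at_left h)" using h \<beta> by (intro tendsto_intros) auto
    then show "(((\<lambda>r. r powr \<beta> / \<beta>) \<circ> real_of_ereal) \<longlongrightarrow> h powr \<beta> / \<beta>) (at_left (ereal h))"
      by (simp add: ereal_tendsto_simps)
  qed (use h in auto)
  have 2: "set_integrable lborel (einterval h \<infinity>) (\<lambda>r. (r - h) powr (\<beta> - 1) - r powr (\<beta> - 1)) \<and>
    (LBINT r=h..\<infinity>. (r - h) powr (\<beta> - 1) - r powr (\<beta> - 1)) = 0 - (0 - h powr \<beta>) / \<beta>"
  proof (rule interval_integral_FTC_nonneg'[where F = "\<lambda>r. ((r - h) powr \<beta> - r powr \<beta>) / \<beta>"])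
    show "\<forall>r. ereal h < ereal r \<longrightarrow> ereal r < \<infinity> \<longrightarrow>
        DERIV (\<lambda>r. ((r - h) powr \<beta> - r powr \<beta>) / \<beta>) r :> (r - h) powr (\<beta> - 1) - r powr (\<beta> - 1)
        \<and> isCont (\<lambda>r. (r - h) powr (\<beta> - 1) - r powr (\<beta> - 1)) r \<and> 0 \<le> (r - h) powr (\<beta> - 1) - r powr (\<beta> - 1)"
    proof (intro allI impI conjI)
      fix r assume "ereal h < ereal r"
      then have r: "h < r" by simp
      show "DERIV (\<lambda>r. ((r - h) powr \<beta> - r powr \<beta>) / \<beta>) r :> (r - h) powr (\<beta> - 1) - r powr (\<beta> - 1)"
        using r h \<beta> by (auto intro!: derivative_eq_intros simp: diff_divide_distrib right_diff_distrib[symmetric])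
      show "isCont (\<lambda>r. (r - h) powr (\<beta> - 1) - r powr (\<beta> - 1)) r"
        using r h by (intro continuous_intros) auto
      show "0 \<le> (r - h) powr (\<beta> - 1) - r powr (\<beta> - 1)"
        using r h \<beta> powr_mono2'[of "\<beta> - 1" "r - h" r] by simp
    qed
    have "((\<lambda>r. ((r - h) powr \<beta> - r powr \<beta>) / \<beta>) \<longlongrightarrow> (0 - h powr \<beta>) / \<beta>) (at_right h)"
    proof (intro tendsto_divide tendsto_diff tendsto_const)
      have "((\<lambda>r. r powr \<beta>) \<longlongrightarrow> 0) (at_right 0)" using \<beta> by real_asymp
      then show "((\<lambda>r. (r - h) powr \<beta>) \<longlongrightarrow> 0) (at_right h)"
        by (subst filterlim_at_right_to_0) simp
      show "((\<lambda>r. r powr \<beta>) \<longlongrightarrow> h powr \<beta>) (at_right h)" using h by (intro tendsto_intros) auto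
    qed (use \<beta> in auto)
    then show "(((\<lambda>r. ((r - h) powr \<beta> - r powr \<beta>) / \<beta>) \<circ> real_of_ereal) \<longlongrightarrow> (0 - h powr \<beta>) / \<beta>) (at_right (ereal h))"
      by (simp add: ereal_tendsto_simps)
    have "((\<lambda>r. ((r - h) powr \<beta> - r powr \<beta>) / \<beta>) \<longlongrightarrow> 0) at_top" using \<beta> h by real_asymp
    then show "(((\<lambda>r. ((r - h) powr \<beta> - r powr \<beta>) / \<beta>) \<circ> real_of_ereal) \<longlongrightarrow> 0) (at_left \<infinity>)"
      by (simp add: ereal_tendsto_simps)
  qed simp
  \<comment> \<open>The point \<open>r = h\<close> is excluded: there both indicators on the right
    vanish but \<open>k\<close> does not. It is a null set.\<close>
  have k: "\<bar>k r\<bar> = indicator {0<..<h} r *\<^sub>R r powr (\<beta> - 1) + indicator {h<..} r *\<^sub>R ((r - h) powr (\<beta> - 1) - r powr (\<beta> - 1))"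
    if "r \<noteq> h" for r
    using that h \<beta> powr_mono2'[of "\<beta> - 1" "r - h" r] by (auto simp: k_def indicator_def)
  have ae: "AE r in lborel. \<bar>k r\<bar> = indicator {0<..<h} r *\<^sub>R r powr (\<beta> - 1) + indicator {h<..} r *\<^sub>R ((r - h) powr (\<beta> - 1) - r powr (\<beta> - 1))"
    using AE_lborel_singleton[of h] by eventually_elim (rule k)
  have i1: "integrable lborel (\<lambda>r. indicator {0<..<h} r *\<^sub>R r powr (\<beta> - 1))"
    using 1 by (simp add: set_integrable_def zero_ereal_def)
  have i2: "integrable lborel (\<lambda>r. indicator {h<..} r *\<^sub>R ((r - h) powr (\<beta> - 1) - r powr (\<beta> - 1)))"
    using 2 by (simp add: set_integrable_def)
  have [measurable]: "(\<lambda>r. \<bar>k r\<bar>) \<in> borel_measurable lborel" unfolding k_def by measurable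
  show "integrable lborel (\<lambda>r. \<bar>k r\<bar>)"
    by (rule integrable_cong_AE_imp[OF Bochner_Integration.integrable_add[OF i1 i2]]) (use ae in auto)
  have "(LBINT r. \<bar>k r\<bar>) = (LBINT r. indicator {0<..<h} r *\<^sub>R r powr (\<beta> - 1)) + (LBINT r. indicator {h<..} r *\<^sub>R ((r - h) powr (\<beta> - 1) - r powr (\<beta> - 1)))"
    by (subst Bochner_Integration.integral_add[OF i1 i2, symmetric], rule integral_cong_AE) (use ae i1 i2 in auto)
  also have "\<dots> = h powr \<beta> / \<beta> + h powr \<beta> / \<beta>"
    using 1 2 h
    by (simp add: interval_lebesgue_integral_def set_lebesgue_integral_def zero_ereal_def)
  finally show "(LBINT r. \<bar>k r\<bar>) = 2 * h powr \<beta> / \<beta>" by simp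
qed

text \<open>The function \<open>\<lambda>v. exp (- \<delta> v) u v\<close> is the fractional integral of its own fractional
  derivative; the factor \<open>exp (- \<delta> v)\<close> makes all double integrals absolutely convergent.\<close>

lemma fractional_difference_bound:
  fixes u g :: "real \<Rightarrow> real"
  assumes \<beta>: "0 < \<beta>" "\<beta> < 1"
    and u': "\<And>s. s \<ge> 0 \<Longrightarrow> (u has_real_derivative - g s) (at s within {0..})"
    and g: "continuous_on {0..} g"
    and U: "\<And>s. s \<ge> 0 \<Longrightarrow> \<bar>u s\<bar> \<le> U" and G: "\<And>s. s \<ge> 0 \<Longrightarrow> \<bar>g s\<bar> \<le> G"
    and int: "\<And>r. r \<ge> 0 \<Longrightarrow> set_integrable lborel {0<..}
      (\<lambda>m. m powr (\<beta> - 1) * (LBINT s:{0<..}. exp (- m * s) * g (r + s)))"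
    and B: "\<And>r. r \<ge> 0 \<Longrightarrow> \<bar>LBINT m:{0<..}. m powr (\<beta> - 1) * (LBINT s:{0<..}. exp (- m * s) * g (r + s))\<bar>
      \<le> Gamma \<beta> * Gamma (1 - \<beta>) * B"
    and h: "h > 0"
  shows "\<bar>u h - u 0\<bar> \<le> 2 * h powr \<beta> / Gamma (\<beta> + 1) * B"
proof -
  define b where "b = Gamma \<beta> * Gamma (1 - \<beta>)"
  have b: "b > 0" unfolding b_def using \<beta> by (intro mult_pos_pos Gamma_real_pos) auto
  have \<Gamma>: "Gamma \<beta> > 0" using \<beta> by (intro Gamma_real_pos)
  have u: "continuous_on {0..} u" using u' by (intro DERIV_continuous_on) auto
  define L where "L f m r = (LBINT s:{0<..}. exp (- m * s) * f (r + s))" for f m and r :: real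
  have main: "\<bar>exp (- \<delta> * h) * u h - u 0\<bar> \<le> (2 * h powr \<beta> / \<beta>) * ((B + U * \<delta> powr \<beta>) / Gamma \<beta>)"
    if \<delta>: "\<delta> > 0" for \<delta>
  proof -
    \<comment> \<open>\<open>q\<close> is minus the derivative of
      \<open>exp (- \<delta> * v) * u v\<close>, so its integral from \<open>a\<close> to infinity
      returns \<open>exp (- \<delta> * a) * u a\<close>.\<close>
    define q where "q v = indicator {0..} v *\<^sub>R (exp (- \<delta> * v) * (g v + \<delta> * u v))" for v
    have q_meas[measurable]: "q \<in> borel_measurable borel"
      unfolding q_def by (intro borel_measurable_continuous_on_indicator continuous_intros g u) auto
    define C where "C = G + \<delta> * U"
    have qC: "\<bar>q (a + s)\<bar> \<le> C * exp (- \<delta> * s)" if "a \<ge> 0" "s > 0" for a s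
    proof -
      have "\<bar>g (a + s) + \<delta> * u (a + s)\<bar> \<le> C"
        unfolding C_def using U[of "a + s"] G[of "a + s"] \<delta> that
        by (intro order_trans[OF abs_triangle_ineq] add_mono) (auto simp: abs_mult)
      moreover have "exp (- \<delta> * (a + s)) \<le> exp (- \<delta> * s)" using \<delta> that by simp
      ultimately have "exp (- \<delta> * (a + s)) * \<bar>g (a + s) + \<delta> * u (a + s)\<bar> \<le> exp (- \<delta> * s) * C"
        by (intro mult_mono) auto
      then show ?thesis using that by (simp add: q_def abs_mult mult.commute)
    qed
    \<comment> \<open>Up to the factor \<open>Gamma (1 - \<beta>)\<close> this is the fractional
      derivative of order \<beta> of the damped function; \<open>frac\<close> below integrates it
      back.\<close>
    define Z where "Z r = (LBINT s:{0<..}. s powr - \<beta> * q (r + s))" for r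
    have q_int: "(LBINT v:{0<..}. q (a + v)) = exp (- \<delta> * a) * u a" if a: "a \<ge> 0" for a
    proof -
      have "(LBINT v:{0<..}. q (a + v)) = (LBINT v:{0<..}. exp (- \<delta> * a) * (exp (- \<delta> * v) * (g (a + v) + \<delta> * u (a + v))))"
        using a by (intro set_lebesgue_integral_cong)
          (auto simp: q_def algebra_simps simp flip: exp_add)
      also have "\<dots> = exp (- \<delta> * a) * u a"
        using laplace_integral_by_parts[OF \<delta> a u' g U G] by simp
      finally show ?thesis .
    qed
    have frac: "integrable lborel (\<lambda>r. indicator {0<..} r * (r powr (\<beta> - 1) * Z (a + r)))"
      "(LBINT r. indicator {0<..} r * (r powr (\<beta> - 1) * Z (a + r))) = b * (exp (- \<delta> * a) * u a)" if a: "a \<ge> 0" for a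
      using fractional_integral_Fubini[OF \<beta> \<delta>, of "\<lambda>v. q (a + v)" C] qC[OF a] q_int[OF a]
      by (simp_all add: Z_def add.assoc b_def)
    \<comment> \<open>Without damping, \<open>Gamma \<beta> * Z r\<close> would be the integral that
      assumption \<open>B\<close> controls; damping adds at most the term with
      \<open>\<delta> powr \<beta>\<close>.\<close>
    have Z_le: "\<bar>Z r\<bar> \<le> b * (B + U * \<delta> powr \<beta>) / Gamma \<beta>" if r: "r \<ge> 0" for r
    proof -
      define J where "J m = (LBINT s:{0<..}. exp (- m * s) * q (r + s))" for m
      have J: "\<bar>J m - exp (- \<delta> * r) * L g m r\<bar> \<le> U * \<delta> * (1 / (m + \<delta>))" if m: "m > 0" for m
      proof -
        have m\<delta>: "m + \<delta> > 0" using m \<delta> by simp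
        have cu: "continuous_on {0<..} (\<lambda>s. u (r + s))" and cg: "continuous_on {0<..} (\<lambda>s. g (r + s))"
          using r by (auto intro!: continuous_on_compose2[OF u] continuous_on_compose2[OF g] continuous_intros)
        have Ur: "\<bar>u (r + s)\<bar> \<le> U" and Gr: "\<bar>g (r + s)\<bar> \<le> G" if "s > 0" for s
          using that r U G by auto
        have parts: "L g l r + l * L u l r = u r" if l: "l > 0" for l
        proof -
          have i1: "set_integrable lborel {0<..} (\<lambda>s. exp (- l * s) * g (r + s))"
            by (rule set_integrable_exp_mult(1)[OF l cg Gr])
          have i2: "set_integrable lborel {0<..} (\<lambda>s. l * (exp (- l * s) * u (r + s)))"
            by (rule set_integrable_mult_right, rule set_integrable_exp_mult(1)[OF l cu Ur])
          have "L g l r + l * L u l r = (LBINT s:{0<..}. exp (- l * s) * g (r + s) + l * (exp (- l * s) * u (r + s)))"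
            unfolding L_def set_integral_add(2)[OF i1 i2] set_integral_mult_right ..
          also have "\<dots> = (LBINT s:{0<..}. exp (- l * s) * (g (r + s) + l * u (r + s)))"
            by (simp add: algebra_simps)
          also have "\<dots> = u r" by (rule laplace_integral_by_parts[OF l r u' g U G])
          finally show ?thesis .
        qed
        have i1: "set_integrable lborel {0<..} (\<lambda>s. exp (- (m + \<delta>) * s) * g (r + s))"
          by (rule set_integrable_exp_mult(1)[OF m\<delta> cg Gr])
        have i2: "set_integrable lborel {0<..} (\<lambda>s. \<delta> * (exp (- (m + \<delta>) * s) * u (r + s)))"
          by (rule set_integrable_mult_right, rule set_integrable_exp_mult(1)[OF m\<delta> cu Ur])
        have "J m = (LBINT s:{0<..}. exp (- \<delta> * r) * (exp (- (m + \<delta>) * s) * g (r + s) + \<delta> * (exp (- (m + \<delta>) * s) * u (r + s))))"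
          unfolding J_def using r by (intro set_lebesgue_integral_cong)
            (auto simp: q_def algebra_simps simp flip: exp_add)
        also have "\<dots> = exp (- \<delta> * r) * (L g (m + \<delta>) r + \<delta> * L u (m + \<delta>) r)"
          unfolding L_def set_integral_add(2)[OF i1 i2] set_integral_mult_right ..
        \<comment> \<open>\<open>parts\<close> expresses \<open>u r\<close> both at \<open>m\<close>
          and at \<open>m + \<delta>\<close>; eliminating it leaves a difference of Laplace
          transforms of \<open>u\<close>, which is small in \<delta>.\<close>
        also have "L g (m + \<delta>) r + \<delta> * L u (m + \<delta>) r = L g m r + m * (L u m r - L u (m + \<delta>) r)"
          using parts[OF m] parts[OF m\<delta>] by (simp add: algebra_simps)
        finally have "J m - exp (- \<delta> * r) * L g m r = exp (- \<delta> * r) * (m * (L u m r - L u (m + \<delta>) r))"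
          by (simp add: algebra_simps)
        also have "\<bar>\<dots>\<bar> \<le> 1 * (m * (U * (1 / m - 1 / (m + \<delta>))))"
          unfolding abs_mult using \<delta> r m laplace_diff_bound[OF m \<delta> cu Ur]
          by (intro mult_mono) (auto simp: L_def)
        also have "\<dots> = U * \<delta> * (1 / (m + \<delta>))" 
        proof -
          have "1 - m / (m + \<delta>) = \<delta> / (m + \<delta>)" using m\<delta> by (simp add: field_simps)
          moreover have "1 * (m * (U * (1 / m - 1 / (m + \<delta>)))) = U * (1 - m / (m + \<delta>))"
            using m by (simp add: right_diff_distrib)
          ultimately show ?thesis by simp
        qed
        finally show ?thesis .
      qed
      have intJ: "integrable lborel (\<lambda>m. indicator {0<..} m * (m powr (\<beta> - 1) * J m))"
        and J_eq: "(LBINT m. indicator {0<..} m * (m powr (\<beta> - 1) * J m)) = Gamma \<beta> * Z r"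
        using stieltjes_laplace_Fubini[OF \<beta> \<delta>, of "\<lambda>s. q (r + s)" C] qC[OF r]
        by (simp_all add: J_def Z_def)
      have intL: "integrable lborel (\<lambda>m. indicator {0<..} m * (m powr (\<beta> - 1) * L g m r))"
        using int[OF r] by (simp add: set_integrable_def L_def)
      \<comment> \<open>The bound \<open>J\<close> integrated against
        \<open>m powr (\<beta> - 1)\<close> is \<open>U * \<delta>\<close> times a Stieltjes
        integral of size \<open>\<delta> powr (\<beta> - 1)\<close>, in total of order
        \<open>\<delta> powr \<beta>\<close>.\<close>
      define E where "E m = indicator {0<..} m * (m powr (\<beta> - 1) * J m)
          - exp (- \<delta> * r) * (indicator {0<..} m * (m powr (\<beta> - 1) * L g m r))" for m
      have intE: "integrable lborel E"
        unfolding E_def by (intro Bochner_Integration.integrable_diff intJ integrable_mult_right intL)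
      have "\<bar>LBINT m. E m\<bar> \<le> (LBINT m. U * \<delta> * (indicator {0<..} m * (m powr (\<beta> - 1) * (1 / (m + \<delta>)))))"
      proof (rule order_trans[OF integral_abs_bound integral_mono])
        show "integrable lborel (\<lambda>m. \<bar>E m\<bar>)" using intE by (rule integrable_abs)
        show "integrable lborel (\<lambda>m. U * \<delta> * (indicator {0<..} m * (m powr (\<beta> - 1) * (1 / (m + \<delta>)))))"
          by (intro integrable_mult_right stieltjes_integral \<beta> \<delta>)
        fix m :: real
        show "\<bar>E m\<bar> \<le> U * \<delta> * (indicator {0<..} m * (m powr (\<beta> - 1) * (1 / (m + \<delta>))))"
        proof (cases "m > 0")
          case True
          then have "E m = m powr (\<beta> - 1) * (J m - exp (- \<delta> * r) * L g m r)"
            by (simp add: E_def algebra_simps)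
          then have "\<bar>E m\<bar> = m powr (\<beta> - 1) * \<bar>J m - exp (- \<delta> * r) * L g m r\<bar>" by (simp add: abs_mult)
          also have "\<dots> \<le> m powr (\<beta> - 1) * (U * \<delta> * (1 / (m + \<delta>)))"
            by (intro mult_left_mono J True) auto
          finally show ?thesis using True by (simp add: mult_ac)
        qed (simp add: E_def)
      qed
      also have "\<dots> = U * \<delta> * (b * \<delta> powr (\<beta> - 1))"
        unfolding integral_mult_right_zero stieltjes_integral(2)[OF \<beta> \<delta>] b_def ..
      also have "\<dots> = b * (U * \<delta> powr \<beta>)" using \<delta> by (simp add: powr_diff)
      finally have E_le: "\<bar>LBINT m. E m\<bar> \<le> b * (U * \<delta> powr \<beta>)" .
      have "(LBINT m. E m) = Gamma \<beta> * Z r - exp (- \<delta> * r) * (LBINT m. indicator {0<..} m * (m powr (\<beta> - 1) * L g m r))"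
        unfolding E_def using intJ intL by (simp add: J_eq)
      then have "\<bar>Gamma \<beta> * Z r\<bar> \<le> \<bar>LBINT m. E m\<bar> + \<bar>exp (- \<delta> * r) * (LBINT m. indicator {0<..} m * (m powr (\<beta> - 1) * L g m r))\<bar>"
        by linarith
      also have "\<bar>exp (- \<delta> * r) * (LBINT m. indicator {0<..} m * (m powr (\<beta> - 1) * L g m r))\<bar> \<le> 1 * (b * B)"
        unfolding abs_mult using B[OF r] \<delta> r
        by (intro mult_mono) (auto simp: b_def set_integral_eq_LBINT L_def)
      finally have "\<bar>Gamma \<beta> * Z r\<bar> \<le> b * (B + U * \<delta> powr \<beta>)" using E_le by (simp add: algebra_simps)
      then show ?thesis using \<Gamma> by (simp add: abs_mult field_simps)
    qed
    \<comment> \<open>The damped function at \<open>h\<close> and at 0 is an integral of the same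
      \<open>Z\<close>, shifted by \<open>h\<close> in the first case, so its increment is an
      integral of \<open>Z\<close> against the difference kernel.\<close>
    define k where "k r = indicator {0<..} (r - h) * (r - h) powr (\<beta> - 1) - indicator {0<..} r * r powr (\<beta> - 1)" for r
    note k = powr_difference_kernel[OF \<beta> h, folded k_def]
    have sh: "integrable lborel (\<lambda>r. indicator {0<..} (r - h) * ((r - h) powr (\<beta> - 1) * Z r))"
      "(LBINT r. indicator {0<..} (r - h) * ((r - h) powr (\<beta> - 1) * Z r)) = b * (exp (- \<delta> * h) * u h)"
      using lborel_integrable_real_affine[OF frac(1)[of h], of 1 "- h"] frac(2)[of h]
        lborel_integral_real_affine[of 1 "\<lambda>r. indicator {0<..} r * (r powr (\<beta> - 1) * Z (h + r))" "- h"] h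
      by simp_all
    have "b * (exp (- \<delta> * h) * u h) - b * u 0 = (LBINT r. indicator {0<..} (r - h) * ((r - h) powr (\<beta> - 1) * Z r)
        - indicator {0<..} r * (r powr (\<beta> - 1) * Z r))"
      using Bochner_Integration.integral_diff[OF sh(1) frac(1)[of 0, simplified]] sh(2) frac(2)[of 0] by simp
    also have "\<dots> = (LBINT r. k r * Z r)" by (simp add: k_def algebra_simps)
    finally have eq: "b * (exp (- \<delta> * h) * u h) - b * u 0 = (LBINT r. k r * Z r)" .
    have intk: "integrable lborel (\<lambda>r. k r * Z r)"
      using Bochner_Integration.integrable_diff[OF sh(1) frac(1)[of 0, simplified]]
      by (simp add: k_def algebra_simps)
    have "\<bar>LBINT r. k r * Z r\<bar> \<le> (LBINT r. (b * (B + U * \<delta> powr \<beta>) / Gamma \<beta>) * \<bar>k r\<bar>)"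
    proof (rule order_trans[OF integral_abs_bound integral_mono])
      show "integrable lborel (\<lambda>r. \<bar>k r * Z r\<bar>)" using intk by (rule integrable_abs)
      show "integrable lborel (\<lambda>r. (b * (B + U * \<delta> powr \<beta>) / Gamma \<beta>) * \<bar>k r\<bar>)"
        by (rule integrable_mult_right[OF k(1)])
      fix r
      show "\<bar>k r * Z r\<bar> \<le> (b * (B + U * \<delta> powr \<beta>) / Gamma \<beta>) * \<bar>k r\<bar>"
      proof (cases "r \<ge> 0")
        case True
        then show ?thesis using mult_right_mono[OF Z_le, of r "\<bar>k r\<bar>"] by (simp add: abs_mult mult.commute)
      next
        case False
        then show ?thesis using h by (simp add: k_def indicator_def)
      qed
    qed
    also have "\<dots> = b * ((2 * h powr \<beta> / \<beta>) * ((B + U * \<delta> powr \<beta>) / Gamma \<beta>))"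
      using k(2) by (simp add: mult_ac)
    finally have "b * \<bar>exp (- \<delta> * h) * u h - u 0\<bar> \<le> b * ((2 * h powr \<beta> / \<beta>) * ((B + U * \<delta> powr \<beta>) / Gamma \<beta>))"
      using b unfolding eq[symmetric] by (simp add: abs_mult flip: right_diff_distrib)
    then show ?thesis using b by (simp only: mult_le_cancel_left_pos)
  qed
  \<comment> \<open>As \<delta> tends to 0 the damping and its error both disappear, and the bound
    through \<open>B\<close> remains.\<close>
  have "((\<lambda>\<delta>. \<bar>exp (- \<delta> * h) * u h - u 0\<bar>) \<longlongrightarrow> \<bar>exp (- 0 * h) * u h - u 0\<bar>) (at_right 0)"
    by (intro tendsto_intros)
  moreover have "((\<lambda>\<delta>. (2 * h powr \<beta> / \<beta>) * ((B + U * \<delta> powr \<beta>) / Gamma \<beta>)) \<longlongrightarrow> (2 * h powr \<beta> / \<beta>) * ((B + U * 0) / Gamma \<beta>)) (at_right 0)"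
  proof (intro tendsto_intros)
    show "((\<lambda>\<delta>. \<delta> powr \<beta>) \<longlongrightarrow> 0) (at_right 0)" using \<beta> by real_asymp
  qed (use \<Gamma> in auto)
  moreover have "\<forall>\<^sub>F \<delta> in at_right 0. \<bar>exp (- \<delta> * h) * u h - u 0\<bar> \<le> (2 * h powr \<beta> / \<beta>) * ((B + U * \<delta> powr \<beta>) / Gamma \<beta>)"
    using eventually_at_right_less by eventually_elim (rule main)
  ultimately have "\<bar>exp (- 0 * h) * u h - u 0\<bar> \<le> (2 * h powr \<beta> / \<beta>) * ((B + U * 0) / Gamma \<beta>)"
    by (intro tendsto_le[OF trivial_limit_at_right_real])
  moreover have "Gamma (\<beta> + 1) = \<beta> * Gamma \<beta>" using \<beta> by (intro Gamma_plus1) auto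
  ultimately show ?thesis using \<beta> \<Gamma> by (simp add: field_simps)
qed

section \<open>Strongly continuous semigroups\<close>

text \<open>Baire's theorem: the sets \<open>E k\<close> are closed and cover the space, so one of
  them contains a ball. A vector of length \<open>r\<close> is the difference of two points of that
  ball, whence the factor 2.\<close>

lemma uniform_boundedness:
  fixes F :: "nat \<Rightarrow> 'a::banach \<Rightarrow>\<^sub>L 'b::real_normed_vector"
  assumes "\<And>x. \<exists>K. \<forall>n. norm (F n x) \<le> K"
  shows "\<exists>K. \<forall>n. norm (F n) \<le> K"
proof -
  define E where "E k = {x. \<forall>n. norm (F n x) \<le> real k}" for k
  have closed: "closed (E k)" for k
  proof -
    have "closed {x. norm (F n x) \<le> real k}" for n
      by (intro closed_Collect_le continuous_intros)
    then show ?thesis unfolding E_def by (rule closed_Collect_all)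
  qed
  have UN: "\<Union>(range E) = UNIV"
  proof -
    have "\<exists>k. x \<in> E k" for x
    proof -
      obtain K where "\<forall>n. norm (F n x) \<le> K" using assms by blast
      then have "x \<in> E (nat \<lceil>K\<rceil>)"
        unfolding E_def by (auto intro: order_trans real_nat_ceiling_ge)
      then show ?thesis ..
    qed
    then show ?thesis by auto
  qed
  have "\<exists>k. interior (E k) \<noteq> {}"
  proof (rule ccontr)
    assume "\<not> ?thesis"
    then have "Met_TC.mtopology interior_of \<Union>(range E) = ({} :: 'a set)"
      using closed by (intro Met_TC.metric_Baire_category_alt) (auto simp: complete_UNIV)
    then show False by (simp add: UN)
  qed
  then obtain k x where "x \<in> interior (E k)" by auto
  then obtain r where r: "r > 0" "cball x r \<subseteq> E k" by (auto simp: mem_interior_cball)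
  have "norm (F n) \<le> 2 * real k / r" for n
  proof (rule norm_blinfun_bound)
    fix y
    show "norm (F n y) \<le> 2 * real k / r * norm y"
    proof (cases "y = 0")
      case False
      define z where "z = (r / norm y) *\<^sub>R y"
      have "x \<in> E k" "x + z \<in> E k"
        using r False by (auto simp: z_def dist_norm)
      then have "norm (F n (x + z)) \<le> real k" "norm (F n x) \<le> real k" by (auto simp: E_def)
      then have "norm (F n z) \<le> 2 * real k"
        using norm_triangle_ineq4[of "F n (x + z)" "F n x"] by (simp add: blinfun.add_right)
      then have "r / norm y * norm (F n y) \<le> 2 * real k"
        using r by (simp add: z_def blinfun.scaleR_right)
      then show ?thesis using r False by (simp add: field_simps)
    qed (use r in simp)
  qed (use r in auto)
  then show ?thesis by blast
qed

lemma C0_semigroupD: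
  assumes "C0_semigroup S"
  shows "S 0 x = x" "s \<ge> 0 \<Longrightarrow> t \<ge> 0 \<Longrightarrow> S (s + t) x = S s (S t x)"
    "((\<lambda>t. S t x) \<longlongrightarrow> x) (at_right 0)"
  using assms by (auto simp: C0_semigroup_def)

text \<open>Otherwise there are times \<open>h n\<close> tending to 0 with
  \<open>norm (S (h n)) > n\<close>. Continuity at 0 bounds each orbit along these times, which
  contradicts uniform boundedness.\<close>

lemma C0_semigroup_bounded_near_0:
  fixes S :: "real \<Rightarrow> 'a::banach \<Rightarrow>\<^sub>L 'a"
  assumes S: "C0_semigroup S"
  obtains d K where "d > 0" "\<And>h. h \<in> {0..d} \<Longrightarrow> norm (S h) \<le> K"
proof -
  have "\<exists>n. \<forall>h\<in>{0..1 / real (Suc n)}. norm (S h) \<le> real n"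
  proof (rule ccontr)
    assume "\<not> ?thesis"
    then have "\<forall>n. \<exists>h. h \<in> {0..1 / real (Suc n)} \<and> norm (S h) > real n" by (meson not_le)
    then obtain h where h: "\<And>n. h n \<in> {0..1 / real (Suc n)}" "\<And>n. norm (S (h n)) > real n"
      by metis
    have h0: "h \<longlonglongrightarrow> 0"
      by (rule tendsto_sandwich[OF _ _ tendsto_const LIMSEQ_Suc[OF lim_1_over_n]]) (use h in auto)
    have "\<exists>K. \<forall>n. norm (S (h n) x) \<le> K" for x
    proof -
      have "continuous (at 0 within {0..}) (\<lambda>t. S t x)"
        using C0_semigroupD(1,3)[OF S, of x] by (simp add: continuous_within at_within_Ici_at_right)
      then have "(\<lambda>n. S (h n) x) \<longlonglongrightarrow> S 0 x"
        using h0 h(1) unfolding continuous_within_sequentially by (auto simp: o_def)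
      then have "Bseq (\<lambda>n. S (h n) x)" by (intro convergent_imp_Bseq convergentI)
      then show ?thesis by (auto simp: Bseq_def)
    qed
    then obtain K where K: "\<And>n. norm (S (h n)) \<le> K"
      using uniform_boundedness[of "\<lambda>n. S (h n)"] by blast
    show False using K[of "nat \<lceil>K\<rceil>"] h(2)[of "nat \<lceil>K\<rceil>"] real_nat_ceiling_ge[of K] by linarith
  qed
  then obtain n where n: "\<And>h. h \<in> {0..1 / real (Suc n)} \<Longrightarrow> norm (S h) \<le> real n" by blast
  show thesis by (rule that[of "1 / real (Suc n)" "real n"]) (use n in auto)
qed

text \<open>The semigroup law extends the bound near 0 by one step of length \<open>d\<close> at a
  time, multiplying the constants.\<close>

lemma C0_semigroup_bounded_on:
  fixes S :: "real \<Rightarrow> 'a::banach \<Rightarrow>\<^sub>L 'a"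
  assumes S: "C0_semigroup S"
  obtains K where "K \<ge> 0" "\<And>h. h \<in> {0..b} \<Longrightarrow> norm (S h) \<le> K"
proof -
  obtain d K0 where d: "d > 0" and K0: "\<And>h. h \<in> {0..d} \<Longrightarrow> norm (S h) \<le> K0"
    by (rule C0_semigroup_bounded_near_0[OF S]) blast
  have "\<exists>K. \<forall>h\<in>{0..real n * d}. norm (S h) \<le> K" for n
  proof (induction n)
    case 0
    then show ?case by auto
  next
    case (Suc n)
    then obtain K where K: "\<And>h. h \<in> {0..real n * d} \<Longrightarrow> norm (S h) \<le> K" by blast
    have "norm (S h) \<le> max K0 (\<bar>K\<bar> * \<bar>K0\<bar>)" if h: "h \<in> {0..real (Suc n) * d}" for h
    proof (cases "h \<le> d")
      case True
      then show ?thesis using K0[of h] h by auto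
    next
      case False
      have "S h = S (h - d) o\<^sub>L S d"
        using S False d unfolding C0_semigroup_def by (metis diff_add_cancel diff_ge_0_iff_ge less_eq_real_def not_le)
      then have "norm (S h) \<le> norm (S (h - d)) * norm (S d)" by (simp add: norm_blinfun_compose)
      also have "\<dots> \<le> \<bar>K\<bar> * \<bar>K0\<bar>"
        using K[of "h - d"] K0[of d] h False d
        by (intro mult_mono) (auto simp: algebra_simps)
      finally show ?thesis by simp
    qed
    then show ?case by blast
  qed
  moreover obtain n where "b \<le> real n * d" using reals_Archimedean3[OF d] less_imp_le by blast
  ultimately obtain K where "\<forall>h\<in>{0..real n * d}. norm (S h) \<le> K" by blast
  then show thesis using \<open>b \<le> real n * d\<close> that[of "\<bar>K\<bar>"] by force
qed

lemma filterlim_abs_diff_at_right: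
  "filterlim (\<lambda>s. \<bar>s - t\<bar>) (at_right 0) (at (t::real) within A)"
proof -
  have "((\<lambda>s. \<bar>s - t\<bar>) \<longlongrightarrow> \<bar>t - t\<bar>) (at t within A)" by (intro tendsto_intros)
  then show ?thesis
    by (auto simp: filterlim_at eventually_at_filter)
qed

text \<open>Only right continuity at 0 is given. Factoring out \<open>S (min s t)\<close> reduces
  both sides of \<open>t\<close> to it: what remains is \<open>S \<bar>s - t\<bar> x - x\<close>,
  and the factor is bounded on compact intervals.\<close>

lemma C0_semigroup_continuous_on:
  fixes S :: "real \<Rightarrow> 'a::banach \<Rightarrow>\<^sub>L 'a"
  assumes S: "C0_semigroup S"
  shows "continuous_on {0..} (\<lambda>t. S t x)"
  unfolding continuous_on_eq_continuous_within continuous_within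
proof
  fix t :: real assume t: "t \<in> {0..}"
  obtain K where K: "K \<ge> 0" "\<And>h. h \<in> {0..t + 1} \<Longrightarrow> norm (S h) \<le> K"
    by (rule C0_semigroup_bounded_on[OF S]) blast
  have le: "norm (S s x - S t x) \<le> K * norm (S \<bar>s - t\<bar> x - x)" if s: "s \<in> {0..t + 1}" for s
  proof -
    have "norm (S s x - S t x) = norm (S (min s t) (S \<bar>s - t\<bar> x - x))"
    proof (cases "s \<le> t")
      case True
      then show ?thesis
        using C0_semigroupD(2)[OF S, of s "t - s" x] s
        by (simp add: blinfun.diff_right norm_minus_commute)
    next
      case False
      then show ?thesis
        using C0_semigroupD(2)[OF S, of t "s - t" x] t by (simp add: blinfun.diff_right)
    qed
    also have "\<dots> \<le> norm (S (min s t)) * norm (S \<bar>s - t\<bar> x - x)" by (rule norm_blinfun)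
    also have "\<dots> \<le> K * norm (S \<bar>s - t\<bar> x - x)"
      using K(2)[of "min s t"] s t by (intro mult_right_mono) auto
    finally show ?thesis .
  qed
  have "((\<lambda>s. K * norm (S \<bar>s - t\<bar> x - x)) \<longlongrightarrow> K * norm (x - x)) (at t within {0..})"
    by (intro tendsto_mult tendsto_const tendsto_norm tendsto_diff
        filterlim_compose[OF C0_semigroupD(3)[OF S] filterlim_abs_diff_at_right])
  then have lim: "((\<lambda>s. K * norm (S \<bar>s - t\<bar> x - x)) \<longlongrightarrow> 0) (at t within {0..})" by simp
  have ev: "eventually (\<lambda>s. norm (S s x - S t x) \<le> K * norm (S \<bar>s - t\<bar> x - x)) (at t within {0..})"
    unfolding eventually_at
    by (intro exI[of _ 1]) (use le t in \<open>auto simp: dist_real_def\<close>)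
  have "((\<lambda>s. S s x - S t x) \<longlongrightarrow> 0) (at t within {0..})"
    by (rule Lim_null_comparison[OF ev lim])
  then show "((\<lambda>t. S t x) \<longlongrightarrow> S t x) (at t within {0..})"
    by (simp add: LIM_zero_iff)
qed

section \<open>The generator, and uniqueness of the semigroup it determines\<close>

lemma generator_diff:
  assumes "(x, z) \<in> generator S" "(x', z') \<in> generator S"
  shows "(x - x', z - z') \<in> generator S"
proof -
  have "((\<lambda>h. (1 / h) *\<^sub>R (S h x - x) - (1 / h) *\<^sub>R (S h x' - x')) \<longlongrightarrow> z - z') (at_right 0)"
    using assms by (intro tendsto_diff) (auto simp: generator_def)
  then show ?thesis
    by (simp add: generator_def blinfun.diff_right algebra_simps flip: scaleR_diff_right)
qed

lemma generator_scaleR: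
  assumes "(x, z) \<in> generator S"
  shows "(c *\<^sub>R x, c *\<^sub>R z) \<in> generator S"
proof -
  have "((\<lambda>h. c *\<^sub>R ((1 / h) *\<^sub>R (S h x - x))) \<longlongrightarrow> c *\<^sub>R z) (at_right 0)"
    using assms by (intro tendsto_intros) (auto simp: generator_def)
  then show ?thesis
    by (simp add: generator_def blinfun.scaleR_right mult.commute flip: scaleR_diff_right)
qed

lemma generator_semigroup_apply:
  assumes S: "C0_semigroup S" and xz: "(x, z) \<in> generator S" and t: "t \<ge> 0"
  shows "(S t x, S t z) \<in> generator S"
proof -
  have "((\<lambda>h. S t ((1 / h) *\<^sub>R (S h x - x))) \<longlongrightarrow> S t z) (at_right 0)"
    using xz by (intro tendsto_intros) (auto simp: generator_def)
  moreover have "\<forall>\<^sub>F h in at_right 0. S t ((1 / h) *\<^sub>R (S h x - x)) = (1 / h) *\<^sub>R (S h (S t x) - S t x)"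
    using eventually_at_right_less
  proof eventually_elim
    case (elim h)
    then show ?case
      using C0_semigroupD(2)[OF S, of t h x] C0_semigroupD(2)[OF S, of h t x] t
      by (simp add: blinfun.scaleR_right blinfun.diff_right add.commute)
  qed
  ultimately show ?thesis
    unfolding generator_def by (simp add: tendsto_cong)
qed

text \<open>The generator only provides a right derivative at 0. For \<open>s\<close> on either side
  of \<open>t\<close> the difference quotient is \<open>S (min s t)\<close> applied to the quotient
  at 0 with step \<open>\<bar>s - t\<bar>\<close>, so the left derivative is obtained as
  well.\<close>

lemma C0_semigroup_has_derivative:
  fixes S :: "real \<Rightarrow> 'a::banach \<Rightarrow>\<^sub>L 'a"
  assumes S: "C0_semigroup S" and xz: "(x, z) \<in> generator S" and t: "t \<ge> 0"
  shows "((\<lambda>t. S t x) has_vector_derivative S t z) (at t within {0..})"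
  unfolding has_vector_derivative_def has_derivative_iff_norm
proof (intro conjI bounded_linear_scaleR_left)
  obtain K where K: "K \<ge> 0" "\<And>h. h \<in> {0..t + 1} \<Longrightarrow> norm (S h) \<le> K"
    by (rule C0_semigroup_bounded_on[OF S]) blast
  define D where "D h = (1 / h) *\<^sub>R (S h x - x)" for h
  have le: "norm (S s x - S t x - (s - t) *\<^sub>R S t z) / norm (s - t)
      \<le> K * norm (D \<bar>s - t\<bar> - z) + norm (S (min s t) z - S t z)"
    if s: "s \<in> {0..t + 1}" "s \<noteq> t" for s
  proof -
    have "S s x - S t x = (s - t) *\<^sub>R S (min s t) (D \<bar>s - t\<bar>)"
    proof (cases "s \<le> t")
      case True
      then have minus: "(s - t) / (t - s) = -1" using s by (simp add: field_simps)
      with True show ?thesis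
        using C0_semigroupD(2)[OF S, of s "t - s" x] s
        by (simp add: D_def blinfun.diff_right blinfun.scaleR_right minus)
    next
      case False
      then show ?thesis
        using C0_semigroupD(2)[OF S, of t "s - t" x] t by (simp add: D_def blinfun.diff_right blinfun.scaleR_right)
    qed
    then have "S s x - S t x - (s - t) *\<^sub>R S t z
        = (s - t) *\<^sub>R (S (min s t) (D \<bar>s - t\<bar> - z) + (S (min s t) z - S t z))"
      by (simp add: blinfun.diff_right algebra_simps)
    then have "norm (S s x - S t x - (s - t) *\<^sub>R S t z) / norm (s - t)
        = norm (S (min s t) (D \<bar>s - t\<bar> - z) + (S (min s t) z - S t z))"
      using s by simp
    also have "\<dots> \<le> norm (S (min s t)) * norm (D \<bar>s - t\<bar> - z) + norm (S (min s t) z - S t z)"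
      using norm_triangle_ineq norm_blinfun by (meson add_mono_thms_linordered_semiring(3) order_trans)
    also have "norm (S (min s t)) * norm (D \<bar>s - t\<bar> - z) \<le> K * norm (D \<bar>s - t\<bar> - z)"
      using K(2)[of "min s t"] s t by (intro mult_right_mono) auto
    finally show ?thesis by simp
  qed
  have "((\<lambda>s. K * norm (D \<bar>s - t\<bar> - z) + norm (S (min s t) z - S t z))
      \<longlongrightarrow> K * norm (z - z) + norm (S t z - S t z)) (at t within {0..})"
  proof (intro tendsto_add tendsto_mult tendsto_const tendsto_norm tendsto_diff)
    show "((\<lambda>s. D \<bar>s - t\<bar>) \<longlongrightarrow> z) (at t within {0..})"
      using xz by (intro filterlim_compose[OF _ filterlim_abs_diff_at_right]) (auto simp: generator_def D_def)
    have "continuous_on {0..} (\<lambda>s. S (min s t) z)"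
      using t by (intro continuous_on_compose2[OF C0_semigroup_continuous_on[OF S]] continuous_intros) auto
    then show "((\<lambda>s. S (min s t) z) \<longlongrightarrow> S t z) (at t within {0..})"
      using bspec[OF iffD1[OF continuous_on_def], of _ _ t] t by fastforce
  qed
  then have lim: "((\<lambda>s. K * norm (D \<bar>s - t\<bar> - z) + norm (S (min s t) z - S t z)) \<longlongrightarrow> 0) (at t within {0..})"
    by simp
  have ev: "eventually (\<lambda>s. norm (norm (S s x - S t x - (s - t) *\<^sub>R S t z) / norm (s - t))
      \<le> K * norm (D \<bar>s - t\<bar> - z) + norm (S (min s t) z - S t z)) (at t within {0..})"
    unfolding eventually_at
    by (intro exI[of _ 1]) (use le t in \<open>auto simp: dist_real_def\<close>)
  show "((\<lambda>s. norm (S s x - S t x - (s - t) *\<^sub>R S t z) / norm (s - t)) \<longlongrightarrow> 0) (at t within {0..})"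
    by (rule Lim_null_comparison[OF ev lim])
qed

lemma C0_semigroup_integral:
  fixes S :: "real \<Rightarrow> 'a::banach \<Rightarrow>\<^sub>L 'a"
  assumes S: "C0_semigroup S" and xz: "(x, z) \<in> generator S" and t: "t \<ge> 0"
  shows "S t x - x = integral {0..t} (\<lambda>s. S s z)"
proof -
  have "((\<lambda>s. S s z) has_integral S t x - S 0 x) {0..t}"
    using t by (intro fundamental_theorem_of_calculus)
      (auto intro: has_vector_derivative_within_subset[OF C0_semigroup_has_derivative[OF S xz]])
  then show ?thesis by (simp add: C0_semigroupD(1)[OF S] integral_unique)
qed

lemma right_derivative_at_0:
  fixes f :: "real \<Rightarrow> 'a::real_normed_vector"
  assumes "(f has_vector_derivative y) (at 0 within {0..b})" "b > 0" "f 0 = 0"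
  shows "((\<lambda>h. (1 / h) *\<^sub>R f h) \<longlongrightarrow> y) (at_right 0)"
proof -
  have "at 0 within {0..b} = at_right (0::real)"
    using assms(2) by (rule at_within_Icc_at_right)
  then have "((\<lambda>h. norm (f h - h *\<^sub>R y) / norm h) \<longlongrightarrow> 0) (at_right 0)"
    using assms(1,3) by (simp add: has_vector_derivative_def has_derivative_iff_norm)
  moreover have "\<forall>\<^sub>F h in at_right 0. norm (f h - h *\<^sub>R y) / norm h = norm ((1 / h) *\<^sub>R f h - y)"
    using eventually_at_right_less
  proof eventually_elim
    case (elim h)
    then have "(1 / h) *\<^sub>R f h - y = (1 / h) *\<^sub>R (f h - h *\<^sub>R y)" by (simp add: algebra_simps)
    then show ?case using elim by simp
  qed
  ultimately have "((\<lambda>h. norm ((1 / h) *\<^sub>R f h - y)) \<longlongrightarrow> 0) (at_right 0)"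
    by (simp add: tendsto_cong)
  then show ?thesis by (simp add: tendsto_norm_zero_iff LIM_zero_iff)
qed

lemma integral_0_right_derivative:
  fixes f :: "real \<Rightarrow> 'a::banach"
  assumes "continuous_on {0..} f"
  shows "((\<lambda>h. (1 / h) *\<^sub>R integral {0..h} f) \<longlongrightarrow> f 0) (at_right 0)"
proof (rule right_derivative_at_0[where b = 1])
  show "((\<lambda>h. integral {0..h} f) has_vector_derivative f 0) (at 0 within {0..1})"
    by (rule integral_has_vector_derivative) (auto intro: continuous_on_subset[OF assms])
qed auto

text \<open>The identity between \<open>S t x - x\<close> and the integral of \<open>S s z\<close>
  passes to limits, since the operators are bounded on \<open>{0..t}\<close>; differentiating it at
  0 recovers the generator relation.\<close>

lemma generator_closed:
  fixes S :: "real \<Rightarrow> 'a::banach \<Rightarrow>\<^sub>L 'a"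
  assumes S: "C0_semigroup S" and xz: "\<And>n. (x n, z n) \<in> generator S"
    and x: "x \<longlonglongrightarrow> x'" and z: "z \<longlonglongrightarrow> z'"
  shows "(x', z') \<in> generator S"
proof -
  have eq: "S t x' - x' = integral {0..t} (\<lambda>s. S s z')" if t: "t \<ge> 0" for t
  proof -
    obtain K where K: "K \<ge> 0" "\<And>h. h \<in> {0..t} \<Longrightarrow> norm (S h) \<le> K"
      by (rule C0_semigroup_bounded_on[OF S]) blast
    have cont: "continuous_on {0..t} (\<lambda>s. S s w)" for w
      by (rule continuous_on_subset[OF C0_semigroup_continuous_on[OF S]]) auto
    have "(\<lambda>n. integral {0..t} (\<lambda>s. S s (z n))) \<longlonglongrightarrow> integral {0..t} (\<lambda>s. S s z')"
    proof (rule LIM_zero_cancel, rule Lim_null_comparison)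
      show "\<forall>\<^sub>F n in sequentially. norm (integral {0..t} (\<lambda>s. S s (z n)) - integral {0..t} (\<lambda>s. S s z'))
          \<le> K * norm (z n - z') * (t - 0)"
      proof (rule always_eventually, rule allI)
        fix n
        have "integral {0..t} (\<lambda>s. S s (z n)) - integral {0..t} (\<lambda>s. S s z')
            = integral {0..t} (\<lambda>s. S s (z n - z'))"
          by (subst Henstock_Kurzweil_Integration.integral_diff[symmetric])
            (auto intro: integrable_continuous_real cont simp: blinfun.diff_right)
        also have "norm \<dots> \<le> K * norm (z n - z') * (t - 0)"
        proof (rule integral_bound[OF t cont])
          fix s assume "s \<in> {0..t}"
          then show "norm (S s (z n - z')) \<le> K * norm (z n - z')"
            using K(2)[of s] norm_blinfun[of "S s" "z n - z'"] by (meson mult_right_mono norm_ge_zero order_trans)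
        qed
        finally show "norm (integral {0..t} (\<lambda>s. S s (z n)) - integral {0..t} (\<lambda>s. S s z'))
          \<le> K * norm (z n - z') * (t - 0)" .
      qed
      have "(\<lambda>n. K * norm (z n - z') * (t - 0)) \<longlonglongrightarrow> K * norm (z' - z') * (t - 0)"
        by (intro tendsto_intros z)
      then show "(\<lambda>n. K * norm (z n - z') * (t - 0)) \<longlonglongrightarrow> 0" by simp
    qed
    moreover have "(\<lambda>n. S t (x n) - x n) \<longlonglongrightarrow> S t x' - x'" by (intro tendsto_intros x)
    ultimately show ?thesis
      using C0_semigroup_integral[OF S xz t] LIMSEQ_unique by simp
  qed
  have "((\<lambda>h. (1 / h) *\<^sub>R integral {0..h} (\<lambda>s. S s z')) \<longlongrightarrow> S 0 z') (at_right 0)"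
    by (intro integral_0_right_derivative C0_semigroup_continuous_on[OF S])
  moreover have "\<forall>\<^sub>F h in at_right 0. (1 / h) *\<^sub>R integral {0..h} (\<lambda>s. S s z') = (1 / h) *\<^sub>R (S h x' - x')"
    using eventually_at_right_less by eventually_elim (simp add: eq)
  ultimately show ?thesis
    by (simp add: generator_def tendsto_cong C0_semigroupD(1)[OF S])
qed

text \<open>\<open>S h\<close> shifts the interval of integration by \<open>h\<close>. The overlap
  cancels, and the averages over \<open>[t, t + h]\<close> and \<open>[0, h]\<close> remain.\<close>

lemma generator_integral:
  fixes S :: "real \<Rightarrow> 'a::banach \<Rightarrow>\<^sub>L 'a"
  assumes S: "C0_semigroup S" and t: "t \<ge> 0"
  shows "(integral {0..t} (\<lambda>s. S s x), S t x - x) \<in> generator S"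
proof -
  have cont: "continuous_on A (\<lambda>s. S s x)" if "A \<subseteq> {0..}" for A
    by (rule continuous_on_subset[OF C0_semigroup_continuous_on[OF S] that])
  have int: "(\<lambda>s. S s x) integrable_on {a..b}" if "a \<ge> 0" for a b
    using that by (intro integrable_continuous_real cont) auto
  have shift: "S h (integral {0..t} (\<lambda>s. S s x)) = integral {h..t + h} (\<lambda>s. S s x)" if "h \<ge> 0" for h
  proof -
    have "S h (integral {0..t} (\<lambda>s. S s x)) = integral {0..t} (blinfun_apply (S h) \<circ> (\<lambda>s. S s x))"
      using int by (intro integral_linear[symmetric] blinfun.bounded_linear_right) auto
    also have "\<dots> = integral {0..t} ((\<lambda>s. S s x) \<circ> (\<lambda>s. s + h))"
      by (rule Henstock_Kurzweil_Integration.integral_cong)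
        (use that in \<open>simp add: C0_semigroupD(2)[OF S] add.commute[of _ h]\<close>)
    also have "\<dots> = integral {h..t + h} (\<lambda>s. S s x)"
      using integral_shift_Icc_real[of 0 t "\<lambda>s. S s x" h] by (simp add: o_def add.commute)
    finally show ?thesis .
  qed
  have "((\<lambda>h. (1 / h) *\<^sub>R integral {0..h} (\<lambda>s. S (s + t) x) - (1 / h) *\<^sub>R integral {0..h} (\<lambda>s. S s x))
      \<longlongrightarrow> S (0 + t) x - S 0 x) (at_right 0)"
    using t by (intro tendsto_diff integral_0_right_derivative cont
        continuous_on_compose2[OF C0_semigroup_continuous_on[OF S]] continuous_intros) auto
  moreover have "\<forall>\<^sub>F h in at_right 0. (1 / h) *\<^sub>R integral {0..h} (\<lambda>s. S (s + t) x) - (1 / h) *\<^sub>R integral {0..h} (\<lambda>s. S s x)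
      = (1 / h) *\<^sub>R (S h (integral {0..t} (\<lambda>s. S s x)) - integral {0..t} (\<lambda>s. S s x))"
    using eventually_at_right_less
  proof eventually_elim
    case (elim h)
    have "integral {0..h} (\<lambda>s. S (s + t) x) = integral {t..h + t} (\<lambda>s. S s x)"
      using integral_shift_Icc_real[of 0 h "\<lambda>s. S s x" t] by (simp add: o_def add.commute)
    moreover have "integral {0..h} (\<lambda>s. S s x) + integral {h..t + h} (\<lambda>s. S s x) = integral {0..t + h} (\<lambda>s. S s x)"
      using elim t by (intro Henstock_Kurzweil_Integration.integral_combine int) auto
    moreover have "integral {0..t} (\<lambda>s. S s x) + integral {t..t + h} (\<lambda>s. S s x) = integral {0..t + h} (\<lambda>s. S s x)"
      using elim t by (intro Henstock_Kurzweil_Integration.integral_combine int) auto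
    ultimately have "integral {0..h} (\<lambda>s. S (s + t) x) - integral {0..h} (\<lambda>s. S s x)
        = S h (integral {0..t} (\<lambda>s. S s x)) - integral {0..t} (\<lambda>s. S s x)"
      using shift[of h] elim by (simp add: algebra_simps)
    then show ?case by (simp flip: scaleR_diff_right)
  qed
  ultimately show ?thesis
    by (simp add: generator_def tendsto_cong C0_semigroupD(1)[OF S])
qed

text \<open>Averages of the orbit over shrinking intervals \<open>{0..h n}\<close> lie in the domain
  and converge to the starting point.\<close>

lemma generator_dense:
  fixes S :: "real \<Rightarrow> 'a::banach \<Rightarrow>\<^sub>L 'a"
  assumes S: "C0_semigroup S"
  obtains x' where "\<And>n. x' n \<in> Domain (generator S)" "x' \<longlonglongrightarrow> x"
proof
  define h where "h n = 1 / real (Suc n)" for n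
  show "(1 / h n) *\<^sub>R integral {0..h n} (\<lambda>s. S s x) \<in> Domain (generator S)" for n
    using generator_scaleR[OF generator_integral[OF S, of "h n" x]] by (auto simp: h_def)
  have "filterlim h (at_right 0) sequentially"
    unfolding filterlim_at using LIMSEQ_Suc[OF lim_1_over_n[where 'a = real]]
    by (simp add: h_def[abs_def])
  then show "(\<lambda>n. (1 / h n) *\<^sub>R integral {0..h n} (\<lambda>s. S s x)) \<longlonglongrightarrow> x"
    using filterlim_compose[OF integral_0_right_derivative[OF C0_semigroup_continuous_on[OF S]]]
    by (fastforce simp: C0_semigroupD(1)[OF S])
qed

text \<open>For \<open>x\<close> in the common domain, \<open>T (t - s) (S s x)\<close> has
  derivative 0 in \<open>s\<close>, and its values at \<open>s = 0\<close> and \<open>s = t\<close>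
  are \<open>T t x\<close> and \<open>S t x\<close>. Density of the domain extends the
  equality.\<close>

lemma C0_semigroup_eqI:
  fixes S T :: "real \<Rightarrow> 'a::banach \<Rightarrow>\<^sub>L 'a"
  assumes S: "C0_semigroup S" and T: "C0_semigroup T" and gen: "generator S = generator T" and t: "t \<ge> 0"
  shows "S t = T t"
proof -
  have dom: "S t x = T t x" if x: "x \<in> Domain (generator S)" for x
  proof -
    obtain z where xz: "(x, z) \<in> generator S" using x by auto
    obtain K where K: "K \<ge> 0" "\<And>h. h \<in> {0..t} \<Longrightarrow> norm (T h) \<le> K"
      by (rule C0_semigroup_bounded_on[OF T]) blast
    have der: "((\<lambda>s. T (t - s) (S s x)) has_vector_derivative 0) (at s within {0..t})"
      if s: "s \<in> {0..t}" for s
      unfolding has_vector_derivative_def has_derivative_iff_norm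
    proof (intro conjI)
      define y z' where "y = S s x" and "z' = S s z"
      have yz: "(y, z') \<in> generator T"
        using generator_semigroup_apply[OF S xz, of s] s gen by (auto simp: y_def z'_def)
      define e1 where "e1 r = norm (S r x - S s x - (r - s) *\<^sub>R z') / norm (r - s)" for r
      define e2 where "e2 r = norm (T (t - r) y - T (t - s) y - (r - s) *\<^sub>R (- T (t - s) z')) / norm (r - s)" for r
      define e3 where "e3 r = norm (T (t - r) z' - T (t - s) z')" for r
      have d1: "(e1 \<longlongrightarrow> 0) (at s within {0..t})"
        using has_vector_derivative_within_subset[OF C0_semigroup_has_derivative[OF S xz, of s], of "{0..t}"] s
        by (simp add: has_vector_derivative_def has_derivative_iff_norm z'_def e1_def[abs_def])
      have "((\<lambda>r. T r y) has_vector_derivative T (t - s) z') (at (t - s) within (\<lambda>r. t - r) ` {0..t})"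
        by (rule has_vector_derivative_within_subset[OF C0_semigroup_has_derivative[OF T yz]]) (use s in auto)
      then have "(((\<lambda>r. T r y) \<circ> (\<lambda>r. t - r)) has_vector_derivative (-1) *\<^sub>R T (t - s) z') (at s within {0..t})"
        by (intro vector_diff_chain_within) (auto intro!: derivative_eq_intros)
      then have d2: "(e2 \<longlongrightarrow> 0) (at s within {0..t})"
        by (simp add: has_vector_derivative_def has_derivative_iff_norm e2_def[abs_def])
      have d3: "(e3 \<longlongrightarrow> 0) (at s within {0..t})"
      proof -
        have "continuous_on {0..t} (\<lambda>r. T (t - r) z')"
          by (intro continuous_on_compose2[OF C0_semigroup_continuous_on[OF T]] continuous_intros) auto
        then have "((\<lambda>r. T (t - r) z' - T (t - s) z') \<longlongrightarrow> T (t - s) z' - T (t - s) z') (at s within {0..t})"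
          using s by (intro tendsto_diff tendsto_const) (auto simp: continuous_on_def)
        then show ?thesis unfolding e3_def[abs_def] by (auto intro: tendsto_norm_zero)
      qed
      have lim: "((\<lambda>r. K * e1 r + e2 r + e3 r) \<longlongrightarrow> 0) (at s within {0..t})"
        using tendsto_add[OF tendsto_add[OF tendsto_mult[OF tendsto_const d1] d2] d3, of K] by simp
      have le: "norm (norm (T (t - r) (S r x) - T (t - s) (S s x) - (r - s) *\<^sub>R 0) / norm (r - s))
          \<le> K * e1 r + e2 r + e3 r" if r: "r \<in> {0..t}" "r \<noteq> s" for r
      proof -
        \<comment> \<open>A product rule for operators that are differentiable only along fixed
          vectors. The terms are the error of the inner orbit, the error of the outer operator at
          \<open>y\<close>, and the outer operator's variation at \<open>z'\<close>; each is small
          compared with \<open>r - s\<close>.\<close>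
        have "T (t - r) (S r x) - T (t - s) (S s x)
            = T (t - r) (S r x - S s x - (r - s) *\<^sub>R z')
              + (T (t - r) y - T (t - s) y - (r - s) *\<^sub>R (- T (t - s) z'))
              + (r - s) *\<^sub>R (T (t - r) z' - T (t - s) z')"
          by (simp add: y_def blinfun.diff_right blinfun.add_right blinfun.scaleR_right algebra_simps)
        also have "norm \<dots> \<le> norm (T (t - r) (S r x - S s x - (r - s) *\<^sub>R z'))
              + norm (r - s) * e2 r + norm (r - s) * e3 r"
          using r by (intro norm_triangle_le add_mono) (auto simp: e2_def e3_def)
        also have "norm (T (t - r) (S r x - S s x - (r - s) *\<^sub>R z')) \<le> K * norm (S r x - S s x - (r - s) *\<^sub>R z')"
          using r by (intro order_trans[OF norm_blinfun mult_right_mono[OF K(2) norm_ge_zero]]) auto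
        also have "\<dots> = norm (r - s) * (K * e1 r)" using r by (simp add: e1_def)
        finally have "norm (T (t - r) (S r x) - T (t - s) (S s x)) \<le> norm (r - s) * (K * e1 r + e2 r + e3 r)"
          by (simp add: algebra_simps)
        then have le: "norm (T (t - r) (S r x) - T (t - s) (S s x) - (r - s) *\<^sub>R 0) \<le> norm (r - s) * (K * e1 r + e2 r + e3 r)"
          by simp
        have div: "norm (X / n) \<le> c" if "X \<le> n * c" "n > 0" "X \<ge> 0" for X c n :: real
          using that by (simp add: field_simps)
        show ?thesis by (rule div[OF le]) (use r in auto)
      qed
      show "((\<lambda>r. norm (T (t - r) (S r x) - T (t - s) (S s x) - (r - s) *\<^sub>R 0) / norm (r - s)) \<longlongrightarrow> 0) (at s within {0..t})"
        by (rule Lim_null_comparison[OF _ lim], unfold eventually_at_filter,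
          rule always_eventually, intro allI impI le)
    qed (rule bounded_linear_scaleR_left)
    obtain c where "\<And>s. s \<in> {0..t} \<Longrightarrow> T (t - s) (S s x) = c"
      using has_vector_derivative_zero_constant[of "{0..t}" "\<lambda>s. T (t - s) (S s x)"] der by auto
    from this[of 0] this[of t] t show ?thesis by (simp add: C0_semigroupD(1)[OF S] C0_semigroupD(1)[OF T])
  qed
  show ?thesis
  proof (rule blinfun_eqI)
    fix x
    obtain x' where x': "\<And>n. x' n \<in> Domain (generator S)" "x' \<longlonglongrightarrow> x"
      by (rule generator_dense[OF S]) blast
    have "(\<lambda>n. S t (x' n)) \<longlonglongrightarrow> S t x" "(\<lambda>n. T t (x' n)) \<longlonglongrightarrow> T t x"
      by (intro tendsto_intros x')+
    then show "S t x = T t x" using dom[OF x'(1)] LIMSEQ_unique by simp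
  qed
qed

section \<open>Rescaled semigroups and resolvents\<close>

lemma mem_op_scale_uminus: "(x, z) \<in> op_scale (-1) A \<longleftrightarrow> (x, - z) \<in> A"
  by (force simp: op_scale_def image_iff)

lemma exp_neg_eq:
  assumes "C0_semigroup T" "generator T = op_scale (-1) A" "t \<ge> 0"
  shows "exp_neg A t = T t"
  unfolding exp_neg_def
proof (rule the_equality)
  fix S assume "\<exists>T. C0_semigroup T \<and> generator T = op_scale (-1) A \<and> S = T t"
  then show "S = T t" using assms C0_semigroup_eqI by metis
qed (use assms in blast)

lemma C0_semigroup_time_scale:
  assumes T: "C0_semigroup T" and c: "c > 0"
  shows "C0_semigroup (\<lambda>s. T (c * s))" "generator (\<lambda>s. T (c * s)) = op_scale c (generator T)"
proof -
  have lim: "filterlim (\<lambda>s. c * s) (at_right 0) (at_right 0)" if "c > 0" for c :: real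
  proof -
    have "((\<lambda>s. c * s) \<longlongrightarrow> c * 0) (at_right 0)" by (intro tendsto_intros)
    moreover have "\<forall>\<^sub>F s in at_right 0. c * s \<in> {0<..} \<and> c * s \<noteq> 0"
      using eventually_at_right_less by eventually_elim (use that in simp)
    ultimately show ?thesis by (simp add: filterlim_at)
  qed
  show "C0_semigroup (\<lambda>s. T (c * s))"
    using T c filterlim_compose[OF C0_semigroupD(3)[OF T] lim[OF c]]
    by (simp add: C0_semigroup_def distrib_left)
  \<comment> \<open>Stated for arbitrary \<open>c\<close> and \<open>T\<close>, because the opposite
    inclusion is the same fact for the scaled semigroup with the factor
    \<open>1 / c\<close>.\<close>
  have sub: "(x, c *\<^sub>R z) \<in> generator (\<lambda>s. T (c * s))" if "(x, z) \<in> generator T" "c > 0" for x z c and T :: "real \<Rightarrow> 'a \<Rightarrow>\<^sub>L 'a"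
  proof -
    have "((\<lambda>h. c *\<^sub>R ((1 / (c * h)) *\<^sub>R (T (c * h) x - x))) \<longlongrightarrow> c *\<^sub>R z) (at_right 0)"
      using that(1) by (intro tendsto_scaleR tendsto_const filterlim_compose[OF _ lim[OF that(2)]])
        (auto simp: generator_def)
    then show ?thesis using that(2) by (simp add: generator_def)
  qed
  show "generator (\<lambda>s. T (c * s)) = op_scale c (generator T)"
  proof safe
    fix x y assume "(x, y) \<in> generator (\<lambda>s. T (c * s))"
    from sub[OF this, of "1 / c"] c show "(x, y) \<in> op_scale c (generator T)"
      by (force simp: op_scale_def image_iff)
  next
    fix x y assume "(x, y) \<in> op_scale c (generator T)"
    then show "(x, y) \<in> generator (\<lambda>s. T (c * s))"
      using sub c by (auto simp: op_scale_def)
  qed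
qed

lemma exp_neg_op_scale:
  assumes T: "C0_semigroup T" "generator T = op_scale (-1) A" and c: "c > 0" and s: "s \<ge> 0"
  shows "exp_neg (op_scale c A) s = T (c * s)"
proof (rule exp_neg_eq)
  have "op_scale c (op_scale (-1) A) = op_scale (-1) (op_scale c A)"
    by (simp add: op_scale_def image_image case_prod_unfold)
  then show "generator (\<lambda>s. T (c * s)) = op_scale (-1) (op_scale c A)"
    using C0_semigroup_time_scale(2)[OF T(1) c] T(2) by simp
qed (use C0_semigroup_time_scale(1)[OF T(1) c] s in auto)

section \<open>Resolvents as Laplace transforms of the semigroup\<close>

lemma C0_semigroup_exp_shift:
  assumes T: "C0_semigroup T"
  shows "C0_semigroup (\<lambda>s. exp (- l * s) *\<^sub>R T s)"
  unfolding C0_semigroup_def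
proof (intro conjI allI impI)
  show "exp (- l * 0) *\<^sub>R T 0 = id_blinfun" using T by (simp add: C0_semigroup_def)
  show "exp (- l * (s + t)) *\<^sub>R T (s + t) = (exp (- l * s) *\<^sub>R T s) o\<^sub>L (exp (- l * t) *\<^sub>R T t)"
    if "s \<ge> 0" "t \<ge> 0" for s t
    using that by (intro blinfun_eqI)
      (simp add: C0_semigroupD(2)[OF T] blinfun.scaleR_left blinfun.scaleR_right algebra_simps flip: exp_add)
  fix x
  have "((\<lambda>t. exp (- l * t) *\<^sub>R T t x) \<longlongrightarrow> exp (- l * 0) *\<^sub>R x) (at_right 0)"
    by (intro tendsto_scaleR C0_semigroupD(3)[OF T] tendsto_intros)
  then show "((\<lambda>t. (exp (- l * t) *\<^sub>R T t) x) \<longlongrightarrow> x) (at_right 0)"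
    by (simp add: blinfun.scaleR_left)
qed

lemma generator_exp_shift:
  assumes T: "C0_semigroup T" and xy: "(x, y) \<in> generator (\<lambda>s. exp (- l * s) *\<^sub>R T s)"
  shows "(x, y + l *\<^sub>R x) \<in> generator T"
proof -
  have "((\<lambda>h. exp (l * h)) has_vector_derivative l) (at 0 within {0..1})"
    by (auto intro!: derivative_eq_intros simp flip: has_real_derivative_iff_has_vector_derivative)
  then have "((\<lambda>h. exp (l * h) - 1) has_vector_derivative l) (at 0 within {0..1})"
    by (auto intro: derivative_eq_intros)
  then have d: "((\<lambda>h. (1 / h) *\<^sub>R (exp (l * h) - 1)) \<longlongrightarrow> l) (at_right 0)"
    by (rule right_derivative_at_0) auto
  have "((\<lambda>h. exp (l * h) *\<^sub>R ((1 / h) *\<^sub>R (exp (- l * h) *\<^sub>R T h x - x)) + ((1 / h) *\<^sub>R (exp (l * h) - 1)) *\<^sub>R x)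
      \<longlongrightarrow> exp (l * 0) *\<^sub>R y + l *\<^sub>R x) (at_right 0)"
    using xy by (intro tendsto_intros d) (auto simp: generator_def blinfun.scaleR_left)
  moreover have "exp (l * h) *\<^sub>R ((1 / h) *\<^sub>R (exp (- l * h) *\<^sub>R T h x - x)) + ((1 / h) *\<^sub>R (exp (l * h) - 1)) *\<^sub>R x
      = (1 / h) *\<^sub>R (T h x - x)" for h
    by (simp add: algebra_simps flip: exp_add)
  ultimately show ?thesis by (simp add: generator_def)
qed

text \<open>\<open>u\<close> is the integral of \<open>S s w\<close> over the half-line, summed over
  unit intervals. The integral up to time \<open>n\<close> and \<open>S n w - w\<close> form a pair
  of the generator of \<open>S\<close>; closedness carries it to \<open>(u, - w)\<close>, and
  undoing the exponential shift gives the claim.\<close>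

lemma resolvent_exists:
  fixes T :: "real \<Rightarrow> 'a::banach \<Rightarrow>\<^sub>L 'a"
  assumes T: "C0_semigroup T" "generator T = op_scale (-1) A" and K: "\<forall>s\<ge>0. norm (T s) \<le> K"
    and l: "l > 0"
  shows "\<exists>u. (u, w - l *\<^sub>R u) \<in> A"
proof -
  define S where "S s = exp (- l * s) *\<^sub>R T s" for s
  have S: "C0_semigroup S" unfolding S_def by (rule C0_semigroup_exp_shift[OF T(1)])
  have K0: "K \<ge> 0" using K norm_ge_zero[of "T 0"] by (meson order_refl order_trans)
  have bound: "norm (S s w) \<le> exp (- l * s) * (K * norm w)" if "s \<ge> 0" for s
  proof -
    have "norm (T s w) \<le> K * norm w"
      using K that by (intro order_trans[OF norm_blinfun mult_right_mono]) auto
    then show ?thesis by (simp add: S_def blinfun.scaleR_left)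
  qed
  have cont: "continuous_on A (\<lambda>s. S s w)" if "A \<subseteq> {0..}" for A
    by (rule continuous_on_subset[OF C0_semigroup_continuous_on[OF S] that])
  define f where "f k = integral {real k..real (Suc k)} (\<lambda>s. S s w)" for k
  have f_le: "norm (f k) \<le> K * norm w * exp (- l) ^ k" for k
  proof -
    have "norm (f k) \<le> (exp (- l * real k) * (K * norm w)) * (real (Suc k) - real k)"
      unfolding f_def
    proof (rule integral_bound)
      fix s assume s: "s \<in> {real k..real (Suc k)}"
      have "norm (S s w) \<le> exp (- l * s) * (K * norm w)" using s by (intro bound) auto
      also have "\<dots> \<le> exp (- l * real k) * (K * norm w)"
        using s l K0 by (intro mult_right_mono) auto
      finally show "norm (S s w) \<le> exp (- l * real k) * (K * norm w)" .
    qed (auto intro: cont)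
    then show ?thesis by (simp add: exp_of_nat_mult[symmetric] mult.commute)
  qed
  have "summable (\<lambda>k. K * norm w * exp (- l) ^ k)"
    using l by (intro summable_mult summable_geometric) auto
  then have "summable f" by (rule summable_comparison_test') (rule f_le)
  then obtain u where u: "(\<lambda>n. \<Sum>k<n. f k) \<longlonglongrightarrow> u" by (auto simp: summable_def sums_def)
  have sum_f: "(\<Sum>k<n. f k) = integral {0..real n} (\<lambda>s. S s w)" for n
  proof (induction n)
    case (Suc n)
    have "integral {0..real n} (\<lambda>s. S s w) + f n = integral {0..real (Suc n)} (\<lambda>s. S s w)"
      unfolding f_def by (intro Henstock_Kurzweil_Integration.integral_combine integrable_continuous_real cont) auto
    with Suc show ?case by simp
  qed simp
  have lim: "(\<lambda>n. S (real n) w - w) \<longlonglongrightarrow> 0 - w"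
  proof (intro tendsto_diff tendsto_const, rule Lim_null_comparison)
    show "\<forall>\<^sub>F n in sequentially. norm (S (real n) w) \<le> exp (- l) ^ n * (K * norm w)"
    proof (rule always_eventually, rule allI)
      fix n
      have "exp (- l) ^ n = exp (- l * real n)" by (simp add: exp_of_nat_mult[symmetric] mult.commute)
      then show "norm (S (real n) w) \<le> exp (- l) ^ n * (K * norm w)"
        using bound[of "real n"] by simp
    qed
    have "(\<lambda>n. exp (- l) ^ n * (K * norm w)) \<longlonglongrightarrow> 0 * (K * norm w)"
      using l by (intro tendsto_mult tendsto_const LIMSEQ_realpow_zero) auto
    then show "(\<lambda>n. exp (- l) ^ n * (K * norm w)) \<longlonglongrightarrow> 0" by simp
  qed
  have "(u, 0 - w) \<in> generator S"
    by (rule generator_closed[OF S generator_integral[OF S] u[unfolded sum_f] lim]) simp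
  then have "(u, - w) \<in> generator S" by simp
  then have "(u, - w + l *\<^sub>R u) \<in> generator T"
    unfolding S_def by (rule generator_exp_shift[OF T(1)])
  then have "(u, - (- w + l *\<^sub>R u)) \<in> A"
    unfolding T(2) mem_op_scale_uminus .
  then show ?thesis by (auto simp: algebra_simps)
qed

lemma bounded_linear_functional_orbit:
  fixes T :: "real \<Rightarrow> 'a::banach \<Rightarrow>\<^sub>L 'a" and \<psi> :: "'a \<Rightarrow> real"
  assumes T: "C0_semigroup T" and K: "\<forall>s\<ge>0. norm (T s) \<le> K"
    and \<psi>: "bounded_linear \<psi>"
  shows "continuous_on {0..} (\<lambda>s. \<psi> (T s w))"
    "(\<And>z. \<bar>\<psi> z\<bar> \<le> norm z) \<Longrightarrow> s \<ge> 0 \<Longrightarrow> \<bar>\<psi> (T s w)\<bar> \<le> K * norm w"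
    "generator T = op_scale (-1) A \<Longrightarrow> (u, v) \<in> A \<Longrightarrow> s \<ge> 0 \<Longrightarrow>
      ((\<lambda>s. \<psi> (T s u)) has_real_derivative - \<psi> (T s v)) (at s within {0..})"
proof -
  interpret \<psi>: bounded_linear \<psi> by fact
  show "continuous_on {0..} (\<lambda>s. \<psi> (T s w))"
    by (intro \<psi>.continuous_on C0_semigroup_continuous_on[OF T])
  show "\<bar>\<psi> (T s w)\<bar> \<le> K * norm w" if "\<And>z. \<bar>\<psi> z\<bar> \<le> norm z" "s \<ge> 0"
    using that(2) K by (intro order_trans[OF that(1)] order_trans[OF norm_blinfun mult_right_mono]) auto
  assume A: "generator T = op_scale (-1) A" "(u, v) \<in> A" "s \<ge> 0"
  have "((\<lambda>s. T s u) has_vector_derivative T s (- v)) (at s within {0..})"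
    using A by (intro C0_semigroup_has_derivative[OF T]) (auto simp: mem_op_scale_uminus)
  from \<psi>.has_vector_derivative[OF this] show "((\<lambda>s. \<psi> (T s u)) has_real_derivative - \<psi> (T s v)) (at s within {0..})"
    by (simp add: blinfun.minus_right \<psi>.neg has_real_derivative_iff_has_vector_derivative)
qed

text \<open>Integration by parts with the orbits of \<open>u\<close> and of
  \<open>w - l *\<^sub>R u\<close>: the terms in \<open>l\<close> cancel and the transform of the
  orbit of \<open>w\<close> is left.\<close>

lemma resolvent_functional:
  fixes T :: "real \<Rightarrow> 'a::banach \<Rightarrow>\<^sub>L 'a" and \<psi> :: "'a \<Rightarrow> real"
  assumes T: "C0_semigroup T" "generator T = op_scale (-1) A" and K: "\<forall>s\<ge>0. norm (T s) \<le> K"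
    and l: "l > 0" and u: "(u, w - l *\<^sub>R u) \<in> A"
    and \<psi>: "bounded_linear \<psi>" "\<And>z. \<bar>\<psi> z\<bar> \<le> norm z" and r: "r \<ge> 0"
  shows "\<psi> (T r u) = (LBINT s:{0<..}. exp (- l * s) * \<psi> (T (r + s) w))"
proof -
  interpret \<psi>: bounded_linear \<psi> by fact
  note orbit = bounded_linear_functional_orbit[OF T(1) K \<psi>(1)]
  have "(LBINT s:{0<..}. exp (- l * s) * (\<psi> (T (r + s) (w - l *\<^sub>R u)) + l * \<psi> (T (r + s) u))) = \<psi> (T r u)"
    by (rule laplace_integral_by_parts[OF l r orbit(3)[OF T(2) u] orbit(1) orbit(2)[OF \<psi>(2)] orbit(2)[OF \<psi>(2)]])
  then show ?thesis
    by (simp add: blinfun.diff_right blinfun.scaleR_right \<psi>.diff \<psi>.scaleR)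
qed

text \<open>The Laplace formula at \<open>r = 0\<close> determines every functional of
  \<open>u\<close> from \<open>w\<close> alone, which gives uniqueness; estimating the orbit in it
  by \<open>K * norm w\<close> gives the norm bound.\<close>

lemma resolvent_neg_eqI:
  fixes T :: "real \<Rightarrow> 'a::banach \<Rightarrow>\<^sub>L 'a"
  assumes T: "C0_semigroup T" "generator T = op_scale (-1) A" and K: "\<forall>s\<ge>0. norm (T s) \<le> K"
    and l: "l > 0" and u: "(u, w - l *\<^sub>R u) \<in> A"
  shows "resolvent_neg A l w = u" "norm u \<le> K / l * norm w"
proof -
  note fnl = resolvent_functional[OF T K l _ _ _ order_refl, unfolded C0_semigroupD(1)[OF T(1)]]
  have uniq: "u' = u" if u': "(u', w - l *\<^sub>R u') \<in> A" for u'
  proof -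
    have "norm (u' - u) \<le> 0"
    proof (rule norm_le_by_functionals)
      fix \<psi> :: "'a \<Rightarrow> real" assume \<psi>: "bounded_linear \<psi>" "\<And>z. \<bar>\<psi> z\<bar> \<le> norm z"
      show "\<psi> (u' - u) \<le> 0"
        using fnl[OF u \<psi>] fnl[OF u' \<psi>] linear_diff[OF bounded_linear.linear[OF \<psi>(1)]] by simp
    qed
    then show ?thesis by simp
  qed
  show "resolvent_neg A l w = u"
    unfolding resolvent_neg_def
  proof (rule the_equality)
    show "\<exists>v. (u, v) \<in> A \<and> l *\<^sub>R u + v = w" using u by (intro exI[of _ "w - l *\<^sub>R u"]) simp
    show "u' = u" if "\<exists>v. (u', v) \<in> A \<and> l *\<^sub>R u' + v = w" for u'
      using that by (intro uniq) (auto simp: algebra_simps)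
  qed
  show "norm u \<le> K / l * norm w"
  proof (rule norm_le_by_functionals)
    fix \<psi> :: "'a \<Rightarrow> real" assume \<psi>: "bounded_linear \<psi>" "\<And>z. \<bar>\<psi> z\<bar> \<le> norm z"
    note orbit = bounded_linear_functional_orbit[OF T(1) K \<psi>(1)]
    have "\<bar>LBINT s:{0<..}. exp (- l * s) * \<psi> (T (0 + s) w)\<bar> \<le> K * norm w / l"
      by (intro set_integrable_exp_mult(2) l)
        (auto intro: continuous_on_subset[OF orbit(1)] orbit(2)[OF \<psi>(2)])
    then show "\<psi> u \<le> K / l * norm w" using fnl[OF u \<psi>] by simp
  qed
qed

lemma resolvent_neg_properties:
  fixes T :: "real \<Rightarrow> 'a::banach \<Rightarrow>\<^sub>L 'a"
  assumes T: "C0_semigroup T" "generator T = op_scale (-1) A" and K: "\<forall>s\<ge>0. norm (T s) \<le> K"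
    and l: "l > 0"
  shows "(resolvent_neg A l w, w - l *\<^sub>R resolvent_neg A l w) \<in> A"
    "norm (resolvent_neg A l w) \<le> K / l * norm w"
  using resolvent_exists[OF T K l, of w] resolvent_neg_eqI[OF T K l, of _ w] by metis+

lemma neg_generator_diff:
  assumes "generator T = op_scale (-1) A" "(x, z) \<in> A" "(x', z') \<in> A"
  shows "(x - x', z - z') \<in> A"
  using generator_diff[of x "- z" T x' "- z'"] assms by (simp add: mem_op_scale_uminus)

text \<open>By the resolvent identity \<open>?R l - ?R m\<close> is the resolvent at
  \<open>l\<close> applied to \<open>(m - l) *\<^sub>R ?R m\<close>, and the resolvent bound makes
  this small.\<close>

lemma resolvent_neg_continuous_on:
  fixes T :: "real \<Rightarrow> 'a::banach \<Rightarrow>\<^sub>L 'a"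
  assumes T: "C0_semigroup T" "generator T = op_scale (-1) A" and K: "\<forall>s\<ge>0. norm (T s) \<le> K"
  shows "continuous_on {0<..} (\<lambda>l. resolvent_neg A l w)"
  unfolding continuous_on_def
proof
  fix m :: real assume m: "m \<in> {0<..}"
  let ?R = "\<lambda>l. resolvent_neg A l w"
  have le: "norm (?R l - ?R m) \<le> K / l * (\<bar>m - l\<bar> * norm (?R m))" if l: "l > 0" for l
  proof -
    note p = resolvent_neg_properties[OF T K]
    have "(?R l - ?R m, (w - l *\<^sub>R ?R l) - (w - m *\<^sub>R ?R m)) \<in> A"
      by (rule neg_generator_diff[OF T(2)]) (use p(1) l m in auto)
    also have "(w - l *\<^sub>R ?R l) - (w - m *\<^sub>R ?R m) = (m - l) *\<^sub>R ?R m - l *\<^sub>R (?R l - ?R m)"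
      by (simp add: algebra_simps)
    finally show ?thesis using resolvent_neg_eqI(2)[OF T K l] by fastforce
  qed
  have lim: "((\<lambda>l. K / l * (\<bar>m - l\<bar> * norm (?R m))) \<longlongrightarrow> K / m * (\<bar>m - m\<bar> * norm (?R m))) (at m within {0<..})"
    using m by (intro tendsto_intros) auto
  have "((\<lambda>l. ?R l - ?R m) \<longlongrightarrow> 0) (at m within {0<..})"
    by (rule Lim_null_comparison[of _ "\<lambda>l. K / l * (\<bar>m - l\<bar> * norm (?R m))"])
      (use le lim in \<open>auto simp: eventually_at_filter\<close>)
  then show "(?R \<longlongrightarrow> ?R m) (at m within {0<..})" by (simp add: LIM_zero_iff)
qed

section \<open>Analytic extension of Bernstein functions\<close>

definition taylor_rem :: "(nat \<Rightarrow> real \<Rightarrow> real) \<Rightarrow> nat \<Rightarrow> nat \<Rightarrow> real \<Rightarrow> real" where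
  "taylor_rem d m k u = d k u - (\<Sum>j<m. d (k + j) 0 / fact j * u ^ j)"

lemma taylor_rem_0: "taylor_rem d (Suc m) k 0 = 0"
  by (simp add: taylor_rem_def power_0_left if_distrib[of "\<lambda>x. _ * x"] cong: if_cong)

text \<open>With \<open>d k\<close> as the \<open>k\<close>-th derivative of \<open>d 0\<close>,
  differentiation lowers the number of removed terms and raises the order. Both inductions on
  \<open>m\<close> below run along this rule.\<close>

lemma taylor_rem_deriv:
  assumes d: "(d k has_real_derivative d (Suc k) u) (at u)"
  shows "(taylor_rem d (Suc m) k has_real_derivative taylor_rem d m (Suc k) u) (at u)"
proof -
  have "((\<lambda>u. \<Sum>j<Suc m. d (k + j) 0 / fact j * u ^ j) has_real_derivative
      (\<Sum>j<Suc m. d (k + j) 0 / fact j * (real j * u ^ (j - 1)))) (at u)"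
    by (auto intro!: derivative_eq_intros simp: mult_ac)
  also have "(\<Sum>j<Suc m. d (k + j) 0 / fact j * (real j * u ^ (j - 1)))
      = (\<Sum>j<m. d (k + Suc j) 0 / fact (Suc j) * (real (Suc j) * u ^ j))"
    by (subst sum.lessThan_Suc_shift) simp
  also have "\<dots> = (\<Sum>j<m. d (Suc k + j) 0 / fact j * u ^ j)"
    by (intro sum.cong) (auto simp: fact_Suc simp del: of_nat_Suc)
  finally show ?thesis
    unfolding taylor_rem_def[abs_def] by (intro derivative_intros d)
qed

lemma nonneg_of_deriv_nonneg:
  fixes f f' :: "real \<Rightarrow> real"
  assumes "\<And>x. 0 \<le> x \<Longrightarrow> x \<le> u \<Longrightarrow> (f has_real_derivative f' x) (at x)"
    and "\<And>x. 0 \<le> x \<Longrightarrow> x \<le> u \<Longrightarrow> f' x \<ge> 0" and "f 0 = 0" "u \<ge> 0"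
  shows "f u \<ge> 0"
  using DERIV_nonneg_imp_nondecreasing[of 0 u f] assms by metis

context
  fixes d :: "nat \<Rightarrow> real \<Rightarrow> real" and R :: real
  assumes deriv: "\<forall>k. \<forall>u\<in>{0..<R}. (d k has_real_derivative d (Suc k) u) (at u)"
    and nonneg: "\<forall>k. \<forall>u\<in>{0..<R}. d k u \<ge> 0"
begin

lemma taylor_rem_nonneg: "u \<in> {0..<R} \<Longrightarrow> taylor_rem d m k u \<ge> 0"
proof (induction m arbitrary: k u)
  case 0
  then show ?case using nonneg by (simp add: taylor_rem_def)
next
  case (Suc m)
  show ?case
    by (rule nonneg_of_deriv_nonneg[where f' = "taylor_rem d m (Suc k)"])
      (use Suc deriv in \<open>auto intro!: taylor_rem_deriv simp: taylor_rem_0\<close>)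
qed

text \<open>Up to a positive factor the case \<open>k = 0\<close> is the numerator in the derivative
  of the remainder divided by \<open>u ^ Suc m\<close>. Differentiating the expression reproduces it
  with \<open>m\<close> lowered and \<open>k\<close> raised, down to
  \<open>u * d (Suc (Suc k)) u\<close>.\<close>

lemma taylor_rem_growth:
  "u \<in> {0..<R} \<Longrightarrow> u * taylor_rem d m (Suc k) u - real (Suc m) * taylor_rem d (Suc m) k u \<ge> 0"
proof (induction m arbitrary: k u)
  case 0
  show ?case
  proof (rule nonneg_of_deriv_nonneg[where f' = "\<lambda>u. u * d (Suc (Suc k)) u"
        and f = "\<lambda>u. u * taylor_rem d 0 (Suc k) u - real (Suc 0) * taylor_rem d (Suc 0) k u"])
    fix x assume "0 \<le> x" "x \<le> u"
    then have x: "x \<in> {0..<R}" using 0 by auto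
    have "taylor_rem d 0 = d" by (simp add: fun_eq_iff taylor_rem_def)
    then have "(taylor_rem d (Suc 0) k has_real_derivative d (Suc k) x) (at x)"
      using taylor_rem_deriv[of d k x 0] deriv x by auto
    then show "((\<lambda>u. u * taylor_rem d 0 (Suc k) u - real (Suc 0) * taylor_rem d (Suc 0) k u)
        has_real_derivative x * d (Suc (Suc k)) x) (at x)"
      using deriv x unfolding \<open>taylor_rem d 0 = d\<close>
      by (auto intro!: derivative_eq_intros)
    show "x * d (Suc (Suc k)) x \<ge> 0" using nonneg x by auto
  qed (use 0 in \<open>auto simp: taylor_rem_0\<close>)
next
  case (Suc m)
  show ?case
  proof (rule nonneg_of_deriv_nonneg[where
        f' = "\<lambda>u. u * taylor_rem d m (Suc (Suc k)) u - real (Suc m) * taylor_rem d (Suc m) (Suc k) u"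
        and f = "\<lambda>u. u * taylor_rem d (Suc m) (Suc k) u - real (Suc (Suc m)) * taylor_rem d (Suc (Suc m)) k u"])
    fix x assume "0 \<le> x" "x \<le> u"
    then have x: "x \<in> {0..<R}" using Suc by auto
    have "(taylor_rem d (Suc (Suc m)) k has_real_derivative taylor_rem d (Suc m) (Suc k) x) (at x)"
      "(taylor_rem d (Suc m) (Suc k) has_real_derivative taylor_rem d m (Suc (Suc k)) x) (at x)"
      using deriv x by (auto intro!: taylor_rem_deriv)
    then show "((\<lambda>u. u * taylor_rem d (Suc m) (Suc k) u - real (Suc (Suc m)) * taylor_rem d (Suc (Suc m)) k u)
        has_real_derivative x * taylor_rem d m (Suc (Suc k)) x - real (Suc m) * taylor_rem d (Suc m) (Suc k) x) (at x)"
      by (auto intro!: derivative_eq_intros simp: algebra_simps)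
    show "x * taylor_rem d m (Suc (Suc k)) x - real (Suc m) * taylor_rem d (Suc m) (Suc k) x \<ge> 0"
      by (rule Suc.IH[OF x])
  qed (use Suc in \<open>auto simp: taylor_rem_0\<close>)
qed

text \<open>The remainder divided by \<open>u ^ (m + 1)\<close> is monotone, which gives geometric decay.\<close>

lemma taylor_rem_le:
  assumes u: "0 < u" "u < v" "v < R"
  shows "taylor_rem d (Suc m) 0 u \<le> (u / v) ^ Suc m * d 0 v"
proof -
  let ?f = "\<lambda>u. taylor_rem d (Suc m) 0 u / u ^ Suc m"
  have "?f u \<le> ?f v"
  proof (rule DERIV_nonneg_imp_nondecreasing[where f = ?f])
    show "u \<le> v" using u by simp
    fix x assume "u \<le> x" "x \<le> v"
    then have x: "x \<in> {0..<R}" "x > 0" using u by auto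
    have "(taylor_rem d (Suc m) 0 has_real_derivative taylor_rem d m (Suc 0) x) (at x)"
      using deriv x by (auto intro!: taylor_rem_deriv)
    moreover have "((\<lambda>x. x ^ Suc m) has_real_derivative real (Suc m) * x ^ m) (at x)"
      using DERIV_pow[of "Suc m" x] by simp
    ultimately have der: "(?f has_real_derivative (taylor_rem d m (Suc 0) x * x ^ Suc m
        - taylor_rem d (Suc m) 0 x * (real (Suc m) * x ^ m)) / (x ^ Suc m * x ^ Suc m)) (at x)"
      using x by (intro DERIV_divide) auto
    have eq: "taylor_rem d m (Suc 0) x * x ^ Suc m - taylor_rem d (Suc m) 0 x * (real (Suc m) * x ^ m)
        = x ^ m * (x * taylor_rem d m (Suc 0) x - real (Suc m) * taylor_rem d (Suc m) 0 x)"
      by (simp add: algebra_simps)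
    have nn: "taylor_rem d m (Suc 0) x * x ^ Suc m - taylor_rem d (Suc m) 0 x * (real (Suc m) * x ^ m) \<ge> 0"
      unfolding eq using taylor_rem_growth[OF x(1), of m 0] x(2) by (intro mult_nonneg_nonneg) auto
    show "\<exists>y. (?f has_real_derivative y) (at x) \<and> 0 \<le> y"
    proof (rule exI, rule conjI, rule der)
      show "0 \<le> (taylor_rem d m (Suc 0) x * x ^ Suc m
        - taylor_rem d (Suc m) 0 x * (real (Suc m) * x ^ m)) / (x ^ Suc m * x ^ Suc m)"
        by (rule divide_nonneg_nonneg[OF nn]) (use x(2) in auto)
    qed
  qed
  also have "\<dots> \<le> d 0 v / v ^ Suc m"
  proof (rule divide_right_mono)
    have "0 \<le> (\<Sum>j<Suc m. d (0 + j) 0 / fact j * v ^ j)"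
      using nonneg u by (intro sum_nonneg mult_nonneg_nonneg divide_nonneg_nonneg) auto
    then show "taylor_rem d (Suc m) 0 v \<le> d 0 v" by (simp add: taylor_rem_def)
  qed (use u in simp)
  finally have "taylor_rem d (Suc m) 0 u / u ^ Suc m \<le> d 0 v / v ^ Suc m" .
  then have "taylor_rem d (Suc m) 0 u \<le> (d 0 v / v ^ Suc m) * u ^ Suc m"
    using u by (subst (asm) pos_divide_le_eq) auto
  then show ?thesis by (simp only: power_divide mult.commute times_divide_eq_right)
qed

text \<open>S. Bernstein's theorem: for any \<open>v\<close> strictly between \<open>u\<close> and
  \<open>R\<close> the remainder is at most \<open>(u / v) ^ Suc m * d 0 v\<close>, which tends to
  0.\<close>

theorem absolutely_monotone_sums:
  assumes u: "u \<in> {0..<R}"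
  shows "(\<lambda>k. d k 0 / fact k * u ^ k) sums d 0 u"
proof (cases "u = 0")
  case True
  then show ?thesis using powser_sums_zero[of "\<lambda>k. d k 0 / fact k"] by simp
next
  case False
  define v where "v = (u + R) / 2"
  have v: "0 < u" "u < v" "v < R" using False u by (auto simp: v_def)
  have "(\<lambda>m. taylor_rem d (Suc m) 0 u) \<longlonglongrightarrow> 0"
  proof (rule tendsto_sandwich[OF _ _ tendsto_const])
    show "\<forall>\<^sub>F m in sequentially. 0 \<le> taylor_rem d (Suc m) 0 u"
      using taylor_rem_nonneg[OF u] by auto
    show "\<forall>\<^sub>F m in sequentially. taylor_rem d (Suc m) 0 u \<le> (u / v) ^ Suc m * d 0 v"
      using taylor_rem_le[OF v] by (intro always_eventually) auto
    have "(\<lambda>m. (u / v) ^ Suc m * d 0 v) \<longlonglongrightarrow> 0 * d 0 v"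
      using v by (intro tendsto_mult tendsto_const LIMSEQ_Suc LIMSEQ_realpow_zero) auto
    then show "(\<lambda>m. (u / v) ^ Suc m * d 0 v) \<longlonglongrightarrow> 0" by simp
  qed
  then have "(\<lambda>m. taylor_rem d m 0 u) \<longlonglongrightarrow> 0" by (rule LIMSEQ_imp_Suc)
  then have "(\<lambda>m. d 0 u - taylor_rem d m 0 u) \<longlonglongrightarrow> d 0 u - 0" by (intro tendsto_intros)
  then show ?thesis by (simp add: sums_def taylor_rem_def)
qed

end

section \<open>Bernstein functions on discs tangent to the imaginary axis\<close>

lemma smooth_on_pos_DERIV:
  assumes "smooth_on_pos f" "x > 0"
  shows "((deriv ^^ k) f has_real_derivative (deriv ^^ Suc k) f x) (at x)"
  using assms by (simp add: smooth_on_pos_def DERIV_deriv_iff_real_differentiable)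

lemma bernstein_functionD:
  assumes "bernstein_function \<phi>" "x > 0"
  shows "(-1) ^ k * (deriv ^^ Suc k) \<phi> x \<ge> 0"
    "((deriv ^^ k) \<phi> has_real_derivative (deriv ^^ Suc k) \<phi> x) (at x)"
  using assms smooth_on_pos_DERIV[of \<phi> x k]
  by (auto simp: bernstein_function_def completely_monotone_def funpow_Suc_right simp del: funpow.simps)

lemma bernstein_function_mono:
  assumes \<phi>: "bernstein_function \<phi>" and x: "0 < x" "x \<le> y"
  shows "\<phi> x \<le> \<phi> y"
proof (rule DERIV_nonneg_imp_nondecreasing[OF x(2)])
  fix z assume "x \<le> z" "z \<le> y"
  then have "z > 0" using x by simp
  then show "\<exists>y. (\<phi> has_real_derivative y) (at z) \<and> 0 \<le> y"
    using bernstein_functionD(2)[OF \<phi>, of z 0] bernstein_functionD(1)[OF \<phi>, of z 0] by auto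
qed

text \<open>The Taylor coefficients of \<open>u \<mapsto> \<phi> N - \<phi> (N - u)\<close> at 0.
  Reflecting the argument cancels the alternating signs of the derivatives of \<phi>.\<close>

definition bernstein_coeff :: "(real \<Rightarrow> real) \<Rightarrow> real \<Rightarrow> nat \<Rightarrow> real" where
  "bernstein_coeff \<phi> N k = (case k of 0 \<Rightarrow> 0 | Suc j \<Rightarrow> (-1) ^ j * (deriv ^^ Suc j) \<phi> N / fact (Suc j))"

lemma bernstein_coeff_nonneg:
  assumes "bernstein_function \<phi>" "N > 0"
  shows "bernstein_coeff \<phi> N k \<ge> 0"
  using bernstein_functionD(1)[OF assms]
  by (auto simp: bernstein_coeff_def simp del: funpow.simps split: nat.split intro!: divide_nonneg_nonneg)

lemma bernstein_sums:
  assumes \<phi>: "bernstein_function \<phi>" and u: "0 \<le> u" "u < N"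
  shows "(\<lambda>k. bernstein_coeff \<phi> N k * u ^ k) sums (\<phi> N - \<phi> (N - u))"
proof -
  \<comment> \<open>Subtracting from the constant \<open>\<phi> N\<close> makes the zeroth member
    nonnegative too, by monotonicity of \<phi>; the higher members are nonnegative because
    \<open>deriv \<phi>\<close> is completely monotone.\<close>
  define d where "d k u = (case k of 0 \<Rightarrow> \<phi> N - \<phi> (N - u) | Suc j \<Rightarrow> (-1) ^ j * (deriv ^^ Suc j) \<phi> (N - u))" for k u
  have d0: "d 0 u = \<phi> N - \<phi> (N - u)" and dS: "d (Suc j) u = (-1) ^ j * (deriv ^^ Suc j) \<phi> (N - u)" for j u
    by (auto simp: d_def)
  have "(d k has_real_derivative d (Suc k) u) (at u)" if u: "u \<in> {0..<N}" for k u
  proof (cases k)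
    case 0
    have "(\<phi> has_real_derivative deriv \<phi> (N - u)) (at (N - u))"
      using bernstein_functionD(2)[OF \<phi>, of "N - u" 0] u by simp
    then have "((\<lambda>u. \<phi> (N - u)) has_real_derivative deriv \<phi> (N - u) * (-1)) (at u)"
      by (rule DERIV_chain2) (auto intro!: derivative_eq_intros)
    then have "((\<lambda>u. \<phi> N - \<phi> (N - u)) has_real_derivative 0 - deriv \<phi> (N - u) * (-1)) (at u)"
      by (intro DERIV_diff DERIV_const)
    moreover have "d k = (\<lambda>u. \<phi> N - \<phi> (N - u))" by (simp add: 0 d_def fun_eq_iff)
    ultimately show ?thesis by (simp add: 0 d_def)
  next
    case (Suc j)
    have "((deriv ^^ Suc j) \<phi> has_real_derivative (deriv ^^ Suc (Suc j)) \<phi> (N - u)) (at (N - u))"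
      using bernstein_functionD(2)[OF \<phi>, of "N - u" "Suc j"] u by simp
    then have "((\<lambda>u. (deriv ^^ Suc j) \<phi> (N - u)) has_real_derivative (deriv ^^ Suc (Suc j)) \<phi> (N - u) * (-1)) (at u)"
      by (rule DERIV_chain2) (auto intro!: derivative_eq_intros)
    then have "((\<lambda>u. (-1) ^ j * (deriv ^^ Suc j) \<phi> (N - u)) has_real_derivative
        (-1) ^ j * ((deriv ^^ Suc (Suc j)) \<phi> (N - u) * (-1))) (at u)"
      by (rule DERIV_cmult)
    moreover have "d k = (\<lambda>u. (-1) ^ j * (deriv ^^ Suc j) \<phi> (N - u))" by (rule ext) (simp only: Suc dS)
    moreover have "d (Suc k) u = (-1) ^ j * ((deriv ^^ Suc (Suc j)) \<phi> (N - u) * (-1))"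
      by (simp add: d_def Suc)
    ultimately show ?thesis by simp
  qed
  moreover have "d k u \<ge> 0" if u: "u \<in> {0..<N}" for k u
  proof (cases k)
    case 0
    then show ?thesis using bernstein_function_mono[OF \<phi>, of "N - u" N] u by (simp add: d_def)
  next
    case (Suc j)
    have "d k u = (-1) ^ j * (deriv ^^ Suc j) \<phi> (N - u)" unfolding Suc dS ..
    then show ?thesis using bernstein_functionD(1)[OF \<phi>, of "N - u" j] u by simp
  qed
  ultimately have "(\<lambda>k. d k 0 / fact k * u ^ k) sums d 0 u"
    using u by (intro absolutely_monotone_sums[where R = N]) auto
  moreover have "d k 0 / fact k = bernstein_coeff \<phi> N k" for k
    by (cases k) (simp_all add: d_def bernstein_coeff_def)
  ultimately show ?thesis by (simp add: d0)
qed

lemma holomorphic_eq_on_real_segment: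
  assumes F: "F holomorphic_on S" and G: "G holomorphic_on S" and S: "open S" "connected S"
    and ab: "a < b" "complex_of_real ` {a<..<b} \<subseteq> S"
    and eq: "\<And>x. x \<in> {a<..<b} \<Longrightarrow> F (complex_of_real x) = G (complex_of_real x)" and z: "z \<in> S"
  shows "F z = G z"
proof -
  define m where "m = (a + b) / 2"
  have m: "m \<in> {a<..<b}" using ab by (simp add: m_def)
  have "complex_of_real m islimpt complex_of_real ` {a<..<b}"
    unfolding islimpt_approachable
  proof (intro allI impI)
    fix e :: real assume e: "e > 0"
    define x where "x = m + min (e / 2) ((b - a) / 4)"
    have "x \<in> {a<..<b}" "x \<noteq> m" "\<bar>x - m\<bar> < e" using e ab by (auto simp: x_def m_def min_def field_simps)
    then show "\<exists>w\<in>complex_of_real ` {a<..<b}. w \<noteq> complex_of_real m \<and> dist w (complex_of_real m) < e"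
      by (intro bexI[of _ "complex_of_real x"]) (auto simp: dist_norm simp flip: of_real_diff)
  qed
  then have "F z - G z = 0"
    by (rule analytic_continuation[OF holomorphic_on_diff[OF F G] S ab(2), rotated])
      (use eq z m ab in auto)
  then show ?thesis by simp
qed

text \<open>The series in powers of \<open>N - z\<close> lives on the disc of radius
  \<open>N\<close> about \<open>N\<close>, which touches the imaginary axis at 0. These discs
  exhaust the open half-plane as \<open>N\<close> grows.\<close>

definition bernstein_disc :: "(real \<Rightarrow> real) \<Rightarrow> real \<Rightarrow> complex \<Rightarrow> complex" where
  "bernstein_disc \<phi> N z = complex_of_real (\<phi> N) - (\<Sum>k. complex_of_real (bernstein_coeff \<phi> N k) * (complex_of_real N - z) ^ k)"

text \<open>The real series converges at a radius \<open>r\<close> strictly between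
  \<open>norm w\<close> and \<open>N\<close>, and a power series converges at every point closer to
  its centre.\<close>

lemma bernstein_disc_sums:
  assumes \<phi>: "bernstein_function \<phi>" and w: "norm w < N"
  shows "(\<lambda>k. complex_of_real (bernstein_coeff \<phi> N k) * w ^ k) sums
    (complex_of_real (\<phi> N) - bernstein_disc \<phi> N (complex_of_real N - w))"
proof -
  define r where "r = (norm w + N) / 2"
  have r1: "0 \<le> r" using order_trans[OF norm_ge_zero less_imp_le[OF w]] by (simp add: r_def)
  have r2: "r < N" "norm w < r" using w by (simp_all add: r_def)
  note r = r1 r2
  have "summable (\<lambda>k. bernstein_coeff \<phi> N k * r ^ k)"
    using bernstein_sums[OF \<phi> r(1,2)] by (rule sums_summable)
  then have "summable (\<lambda>k. complex_of_real (bernstein_coeff \<phi> N k * r ^ k))" by (rule summable_of_real)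
  then have "summable (\<lambda>k. complex_of_real (bernstein_coeff \<phi> N k) * complex_of_real r ^ k)" by simp
  then have "summable (\<lambda>k. complex_of_real (bernstein_coeff \<phi> N k) * w ^ k)"
    by (rule powser_inside) (use r in simp)
  then show ?thesis by (simp add: bernstein_disc_def summable_sums)
qed

lemma bernstein_disc_of_real:
  assumes \<phi>: "bernstein_function \<phi>" and x: "0 < x" "x \<le> N"
  shows "bernstein_disc \<phi> N (complex_of_real x) = complex_of_real (\<phi> x)"
proof -
  have "(\<lambda>k. complex_of_real (bernstein_coeff \<phi> N k * (N - x) ^ k)) sums complex_of_real (\<phi> N - \<phi> (N - (N - x)))"
    by (intro sums_of_real bernstein_sums \<phi>) (use x in auto)
  then show ?thesis by (simp add: bernstein_disc_def sums_iff)
qed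

lemma bernstein_disc_holomorphic:
  assumes \<phi>: "bernstein_function \<phi>"
  shows "bernstein_disc \<phi> N holomorphic_on ball (complex_of_real N) N"
proof -
  have "(\<lambda>w. complex_of_real (\<phi> N) - bernstein_disc \<phi> N (complex_of_real N - w)) holomorphic_on ball 0 N"
    by (rule power_series_holomorphic[where a = "\<lambda>k. complex_of_real (bernstein_coeff \<phi> N k)"])
      (use bernstein_disc_sums[OF \<phi>] in simp)
  then have "((\<lambda>w. complex_of_real (\<phi> N) - bernstein_disc \<phi> N (complex_of_real N - w)) \<circ> (\<lambda>z. complex_of_real N - z))
      holomorphic_on ball (complex_of_real N) N"
    by (rule holomorphic_on_compose_gen[rotated]) (auto intro!: holomorphic_intros simp: dist_norm norm_minus_commute)
  then have "(\<lambda>z. complex_of_real (\<phi> N) - bernstein_disc \<phi> N z) holomorphic_on ball (complex_of_real N) N"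
    by (simp add: o_def)
  then have "(\<lambda>z. complex_of_real (\<phi> N) - (complex_of_real (\<phi> N) - bernstein_disc \<phi> N z)) holomorphic_on ball (complex_of_real N) N"
    by (rule holomorphic_on_diff[OF holomorphic_on_const])
  moreover have "(\<lambda>z. complex_of_real (\<phi> N) - (complex_of_real (\<phi> N) - bernstein_disc \<phi> N z)) = bernstein_disc \<phi> N"
    by (simp add: fun_eq_iff)
  ultimately show ?thesis by (simp only:)
qed

text \<open>Both functions agree with \<phi> on the real diameter of the smaller disc, and the
  identity theorem does the rest.\<close>

lemma bernstein_disc_nested:
  assumes \<phi>: "bernstein_function \<phi>" and N: "0 < N" "N \<le> N'" and z: "z \<in> ball (complex_of_real N) N"
  shows "bernstein_disc \<phi> N z = bernstein_disc \<phi> N' z"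
proof (rule holomorphic_eq_on_real_segment[where a = 0 and b = N and F = "bernstein_disc \<phi> N" and G = "bernstein_disc \<phi> N'"])
  have "dist (complex_of_real N') (complex_of_real N) = N' - N"
    unfolding dist_norm of_real_diff[symmetric] norm_of_real using N by simp
  then have sub: "ball (complex_of_real N) N \<subseteq> ball (complex_of_real N') N'"
    unfolding ball_subset_ball_iff by (simp add: dist_commute)
  then show "bernstein_disc \<phi> N' holomorphic_on ball (complex_of_real N) N"
    using bernstein_disc_holomorphic[OF \<phi>] holomorphic_on_subset by blast
  show "complex_of_real ` {0<..<N} \<subseteq> ball (complex_of_real N) N"
    using N by (auto simp: dist_norm simp flip: of_real_diff)
qed (use N z bernstein_disc_holomorphic[OF \<phi>] bernstein_disc_of_real[OF \<phi>] in auto)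

text \<open>Expanding the square of \<open>norm (n - z)\<close> shows that membership amounts to
  \<open>(norm z)\<^sup>2 < 2 * Re z * n\<close>, which holds for large \<open>n\<close>.\<close>

lemma halfplane_ex_ball:
  assumes "Re z > 0"
  shows "\<exists>n::nat. n \<ge> 1 \<and> z \<in> ball (complex_of_real (real n)) (real n)"
proof -
  obtain n :: nat where n: "(norm z)\<^sup>2 / (2 * Re z) < real n" using reals_Archimedean2 by blast
  have "real n > 0" by (rule le_less_trans[OF _ n]) (use assms in auto)
  have "(norm z)\<^sup>2 < 2 * Re z * real n" using n assms by (simp add: field_simps)
  moreover have "(norm (complex_of_real (real n) - z))\<^sup>2 = (real n)\<^sup>2 - 2 * Re z * real n + (norm z)\<^sup>2"
    unfolding cmod_power2 by (simp add: power2_eq_square algebra_simps)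
  ultimately have "(norm (complex_of_real (real n) - z))\<^sup>2 < (real n)\<^sup>2" by simp
  then have "norm (complex_of_real (real n) - z) < real n" by (rule power2_less_imp_less) simp
  then show ?thesis using \<open>real n > 0\<close> by (intro exI[of _ n]) (auto simp: dist_norm)
qed

text \<open>\<open>H\<close> glues the discs by using the least admissible radius at each point;
  nesting shows that every admissible radius gives the same value, so \<open>H\<close> is
  holomorphic on each disc. The identity theorem then makes the definite description denote
  \<open>H\<close>.\<close>

lemma halfplane_ext_bernstein:
  assumes \<phi>: "bernstein_function \<phi>"
  shows "halfplane_ext \<phi> holomorphic_on {z. Re z > 0}"
    "x > 0 \<Longrightarrow> halfplane_ext \<phi> (complex_of_real x) = complex_of_real (\<phi> x)"
    "N > 0 \<Longrightarrow> z \<in> ball (complex_of_real N) N \<Longrightarrow> halfplane_ext \<phi> z = bernstein_disc \<phi> N z"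
proof -
  define H where "H z = bernstein_disc \<phi> (real (LEAST n. n \<ge> 1 \<and> z \<in> ball (complex_of_real (real n)) (real n))) z" for z
  have H: "H z = bernstein_disc \<phi> (real n) z" if n: "n \<ge> 1" "z \<in> ball (complex_of_real (real n)) (real n)" for z n
  proof -
    let ?P = "\<lambda>n. n \<ge> 1 \<and> z \<in> ball (complex_of_real (real n)) (real n)"
    have P: "?P (LEAST n. ?P n)" by (rule LeastI[of ?P, OF conjI[OF n]])
    have "(LEAST n. ?P n) \<le> n" by (rule Least_le[of ?P, OF conjI[OF n]])
    then show ?thesis unfolding H_def using P by (intro bernstein_disc_nested[OF \<phi>]) linarith+
  qed
  have balls: "{z. Re z > 0} = (\<Union>n\<in>{1..}. ball (complex_of_real (real n)) (real n))"
  proof (intro equalityI subsetI)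
    fix z assume "z \<in> (\<Union>n\<in>{1..}. ball (complex_of_real (real n)) (real n))"
    then obtain n :: nat where "norm (complex_of_real (real n) - z) < real n" by (auto simp: dist_norm)
    then show "z \<in> {z. Re z > 0}"
      using abs_Re_le_cmod[of "complex_of_real (real n) - z"] by simp
  qed (use halfplane_ex_ball in auto)
  have Hhol: "H holomorphic_on {z. Re z > 0}"
    unfolding balls
  proof (rule holomorphic_on_UN_open)
    fix n :: nat assume n: "n \<in> {1..}"
    show "H holomorphic_on ball (complex_of_real (real n)) (real n)"
      using bernstein_disc_holomorphic[OF \<phi>, of "real n"] H n
      by (subst holomorphic_cong[OF refl]) auto
  qed auto
  have Hreal: "H (complex_of_real x) = complex_of_real (\<phi> x)" if x: "x > 0" for x
  proof -
    obtain n :: nat where n: "x < real n" using reals_Archimedean2 by blast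
    have "dist (complex_of_real (real n)) (complex_of_real x) = real n - x"
      unfolding dist_norm of_real_diff[symmetric] norm_of_real using n by simp
    then have "n \<ge> 1" "complex_of_real x \<in> ball (complex_of_real (real n)) (real n)"
      using x n by auto
    then show ?thesis using H bernstein_disc_of_real[OF \<phi> x, of "real n"] n by simp
  qed
  have conn: "connected {z. Re z > 0}" "open {z. Re z > 0}"
    by (auto intro: convex_connected convex_halfspace_Re_gt open_halfspace_Re_gt)
  have uniq: "F z = H z" if "F holomorphic_on {z. Re z > 0}" "\<And>x. x > 0 \<Longrightarrow> F (complex_of_real x) = complex_of_real (\<phi> x)"
    "Re z > 0" for F z
    by (rule holomorphic_eq_on_real_segment[OF that(1) Hhol conn(2,1), of 0 1]) (use that Hreal in auto)
  have ext: "halfplane_ext \<phi> z = H z" if "Re z > 0" for z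
    unfolding halfplane_ext_def
    by (rule the_equality) (use Hhol Hreal uniq that in blast)+
  show "halfplane_ext \<phi> holomorphic_on {z. Re z > 0}"
    using Hhol ext by (subst holomorphic_cong[OF refl]) auto
  show "halfplane_ext \<phi> (complex_of_real x) = complex_of_real (\<phi> x)" if "x > 0"
    using that ext Hreal by simp
  show "halfplane_ext \<phi> z = bernstein_disc \<phi> N z" if "N > 0" "z \<in> ball (complex_of_real N) N"
  proof -
    obtain n :: nat where n: "N < real n" using reals_Archimedean2 by blast
    have "dist (complex_of_real (real n)) (complex_of_real N) = real n - N"
      unfolding dist_norm of_real_diff[symmetric] norm_of_real using n by simp
    then have sub: "ball (complex_of_real N) N \<subseteq> ball (complex_of_real (real n)) (real n)"
      unfolding ball_subset_ball_iff by (simp add: dist_commute)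
    have n1: "n \<ge> 1" using n that(1) by linarith
    have zn: "z \<in> ball (complex_of_real (real n)) (real n)" using that sub by blast
    then have "Re z > 0" using n1 balls by blast
    then have "halfplane_ext \<phi> z = bernstein_disc \<phi> (real n) z" using ext H[OF n1 zn] by simp
    also have "\<dots> = bernstein_disc \<phi> N z"
      using bernstein_disc_nested[OF \<phi> that(1) _ that(2), of "real n"] n by simp
    finally show ?thesis .
  qed
qed

lemma sum_nonneg_Reals:
  "(\<And>i. i \<in> I \<Longrightarrow> f i \<in> \<real>\<^sub>\<ge>\<^sub>0) \<Longrightarrow> sum f I \<in> (\<real>\<^sub>\<ge>\<^sub>0 :: complex set)"
  by (induction I rule: infinite_finite_induct) (auto intro: nonneg_Reals_add_I)

text \<open>The derivative of \<open>E = exp P\<close> is the product of \<open>deriv P\<close> and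
  \<open>E\<close>, so Leibniz's rule writes each derivative of \<open>E\<close> at 0 as a
  nonnegative combination of lower ones. The constant term \<open>p 0\<close> may have any sign, as
  it enters only through \<open>E 0 = exp (p 0)\<close>.\<close>

lemma exp_power_series_nonneg:
  fixes P :: "complex \<Rightarrow> complex" and p :: "nat \<Rightarrow> real"
  assumes P: "\<And>w. norm w < R \<Longrightarrow> (\<lambda>k. complex_of_real (p k) * w ^ k) sums P w"
    and p: "\<And>k. k \<ge> 1 \<Longrightarrow> p k \<ge> 0" and R: "R > 0"
  obtains c :: "nat \<Rightarrow> real" where "\<And>k. c k \<ge> 0"
    "\<And>w. norm w < R \<Longrightarrow> (\<lambda>k. complex_of_real (c k) * w ^ k) sums exp (P w)"
proof -
  have hol: "P holomorphic_on ball 0 R"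
    by (rule power_series_holomorphic[where a = "\<lambda>k. complex_of_real (p k)"]) (use P in simp)
  have "\<forall>\<^sub>F w in nhds 0. norm w < R"
    using R by (intro order_tendstoD(2)[of norm 0]) (auto intro!: tendsto_eq_intros filterlim_ident)
  then have ev: "\<forall>\<^sub>F w in nhds 0. (\<lambda>k. fps_nth (Abs_fps (\<lambda>k. complex_of_real (p k))) k * w ^ k) sums P w"
    by eventually_elim (use P in simp)
  have Pk: "(deriv ^^ k) P 0 = fact k * complex_of_real (p k)" for k
    using fps_nth_fps_expansion[OF has_fps_expansionI[OF ev], of k] by simp
  define E where "E w = exp (P w)" for w
  have holE: "E holomorphic_on ball 0 R" unfolding E_def by (intro holomorphic_intros hol)
  have dE: "deriv E w = deriv P w * E w" if "w \<in> ball 0 R" for w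
  proof -
    have "(P has_field_derivative deriv P w) (at w)"
      using hol that by (intro holomorphic_derivI[of _ "ball 0 R"]) auto
    then have "(E has_field_derivative exp (P w) * deriv P w) (at w)"
      unfolding E_def by (rule DERIV_fun_exp)
    then show ?thesis by (simp add: E_def DERIV_imp_deriv)
  qed
  have Ek: "(deriv ^^ k) E 0 \<in> \<real>\<^sub>\<ge>\<^sub>0" for k
  proof (induction k rule: less_induct)
    case (less k)
    show ?case
    proof (cases k)
      case 0
      have "P 0 = complex_of_real (p 0)" using Pk[of 0] by simp
      then show ?thesis by (simp add: 0 E_def exp_of_real)
    next
      case (Suc j)
      have "(deriv ^^ k) E 0 = (deriv ^^ j) (deriv E) 0" by (simp add: Suc funpow_Suc_right del: funpow.simps)
      also have "\<dots> = (deriv ^^ j) (\<lambda>w. deriv P w * E w) 0"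
        by (rule higher_deriv_transform_within_open[of _ "ball 0 R"])
          (use R dE holE hol in \<open>auto intro!: holomorphic_intros\<close>)
      also have "\<dots> = (\<Sum>i = 0..j. of_nat (j choose i) * (deriv ^^ i) (deriv P) 0 * (deriv ^^ (j - i)) E 0)"
        by (rule higher_deriv_mult[of _ "ball 0 R"]) (use R holE hol in \<open>auto intro!: holomorphic_intros\<close>)
      also have "\<dots> \<in> \<real>\<^sub>\<ge>\<^sub>0"
      proof (intro sum_nonneg_Reals nonneg_Reals_mult_I)
        fix i assume "i \<in> {0..j}"
        then show "(deriv ^^ (j - i)) E 0 \<in> \<real>\<^sub>\<ge>\<^sub>0" using less Suc by simp
        have "(deriv ^^ i) (deriv P) 0 = fact (Suc i) * complex_of_real (p (Suc i))"
          unfolding Pk[symmetric] by (simp add: funpow_Suc_right del: funpow.simps)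
        also have "\<dots> = complex_of_real (fact (Suc i) * p (Suc i))" by simp
        also have "\<dots> \<in> \<real>\<^sub>\<ge>\<^sub>0"
          using p[of "Suc i"] by (simp only: nonneg_Reals_of_real_iff) simp
        finally show "(deriv ^^ i) (deriv P) 0 \<in> \<real>\<^sub>\<ge>\<^sub>0" .
      qed simp
      finally show ?thesis .
    qed
  qed
  define c where "c k = Re ((deriv ^^ k) E 0) / fact k" for k
  show thesis
  proof
    show "c k \<ge> 0" for k using Ek[of k] by (simp add: c_def complex_nonneg_Reals_iff)
    have "complex_of_real (c k) = (deriv ^^ k) E 0 / fact k" for k
    proof -
      have "complex_of_real (Re ((deriv ^^ k) E 0)) = (deriv ^^ k) E 0"
        using Ek[of k] by (simp add: complex_nonneg_Reals_iff complex_eq_iff)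
      then show ?thesis by (simp add: c_def)
    qed
    then show "(\<lambda>k. complex_of_real (c k) * w ^ k) sums exp (P w)" if "norm w < R" for w
      using holomorphic_power_series[OF holE, of w] that by (simp add: E_def)
  qed
qed

section \<open>Existence of the subordination measure\<close>

text \<open>\<open>deriv \<phi>\<close> is nonincreasing on the positive half-line and tends to 1 at
  0.\<close>

lemma bernstein_deriv_le_1:
  assumes \<phi>: "\<phi> \<in> bernstein_Phi" and x: "x > 0"
  shows "deriv \<phi> x \<le> 1"
proof (rule tendsto_lowerbound)
  have B: "bernstein_function \<phi>" using \<phi> by (simp add: bernstein_Phi_def)
  show "(deriv \<phi> \<longlongrightarrow> 1) (at_right 0)" using \<phi> by (simp add: bernstein_Phi_def)
  have "deriv \<phi> x \<le> deriv \<phi> y" if y: "0 < y" "y < x" for y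
  proof (rule DERIV_nonpos_imp_nonincreasing[where f = "deriv \<phi>"])
    show "y \<le> x" using y by simp
    fix z assume "y \<le> z" "z \<le> x"
    then have "z > 0" using y by simp
    then show "\<exists>w. (deriv \<phi> has_real_derivative w) (at z) \<and> w \<le> 0"
      using bernstein_functionD(2)[OF B, of z 1] bernstein_functionD(1)[OF B, of z 1] by auto
  qed
  then show "\<forall>\<^sub>F y in at_right 0. deriv \<phi> x \<le> deriv \<phi> y"
    using x unfolding eventually_at_right_field by blast
qed simp

lemma bernstein_increment_le:
  assumes \<phi>: "\<phi> \<in> bernstein_Phi" and x: "0 < x" "x \<le> y"
  shows "\<phi> y - \<phi> x \<le> y - x"
proof -
  have B: "bernstein_function \<phi>" using \<phi> by (simp add: bernstein_Phi_def)
  have "x - \<phi> x \<le> y - \<phi> y"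
  proof (rule DERIV_nonneg_imp_nondecreasing[OF x(2), where f = "\<lambda>z. z - \<phi> z"])
    fix z assume "x \<le> z" "z \<le> y"
    then have z: "z > 0" using x by simp
    have "((\<lambda>z. z - \<phi> z) has_real_derivative 1 - deriv \<phi> z) (at z)"
      using bernstein_functionD(2)[OF B z, of 0] by (auto intro!: derivative_eq_intros)
    then show "\<exists>w. ((\<lambda>z. z - \<phi> z) has_real_derivative w) (at z) \<and> 0 \<le> w"
      using bernstein_deriv_le_1[OF \<phi> z] by (intro exI[of _ "1 - deriv \<phi> z"]) simp
  qed
  then show ?thesis by simp
qed

lemma integral_pmf_nat_sums:
  fixes f :: "nat \<Rightarrow> complex"
  assumes "(\<lambda>k. complex_of_real (pmf p k) * f k) sums S" and f: "\<And>k. norm (f k) \<le> 1"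
  shows "(LINT k|measure_pmf p. f k) = S"
proof -
  have "integrable (measure_pmf p) f"
    by (rule measure_pmf.integrable_const_bound[of _ 1]) (use f in auto)
  then have int: "integrable (count_space UNIV) (\<lambda>k. pmf p k *\<^sub>R f k)"
    by (simp add: measure_pmf_eq_density integrable_density)
  have "(LINT k|measure_pmf p. f k) = (LINT k|count_space UNIV. pmf p k *\<^sub>R f k)"
    by (simp add: measure_pmf_eq_density integral_density)
  then show ?thesis
    using sums_unique2[OF sums_integral_count_space_nat[OF int], of S] assms(1) by (simp add: scaleR_conv_of_real)
qed

text \<open>A discretisation at scale \<open>1 / N\<close>: the coefficients of \<open>u \<mapsto> exp (- t \<phi> (N - u))\<close> are
  nonnegative, so they are, suitably weighted, the point masses of a probability measure.\<close>

lemma bernstein_discretisation: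
  assumes \<phi>: "bernstein_function \<phi>" and t: "t \<ge> 0" and N: "N > 1"
  obtains \<mu> :: "real measure" where "real_distribution \<mu>" "emeasure \<mu> {..<0} = 0"
    "\<And>z. Re z \<ge> 0 \<Longrightarrow> (LINT s|\<mu>. exp (- z * complex_of_real s)) =
      exp (complex_of_real t * (complex_of_real (\<phi> (1 / N)) -
        halfplane_ext \<phi> (complex_of_real N - complex_of_real (N - 1 / N) * exp (- z / complex_of_real N))))"
proof -
  \<comment> \<open>The evaluation point lies strictly inside the disc of convergence and
    corresponds to the argument \<open>1 / N\<close> of \<phi>. The boundary point \<open>N\<close>
    would correspond to 0, where \<phi> is known only through its limit.\<close>
  define \<rho> where "\<rho> = N - 1 / N"
  have "1 / N < 1" using N by simp
  then have \<rho>: "0 < \<rho>" "\<rho> < N" using N unfolding \<rho>_def by (linarith, simp)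
  note ext = halfplane_ext_bernstein[OF \<phi>]
  define P where "P w = complex_of_real t * (complex_of_real (\<phi> N) - halfplane_ext \<phi> (complex_of_real N - w))" for w
  have P: "(\<lambda>k. complex_of_real (t * bernstein_coeff \<phi> N k) * w ^ k) sums P w" if w: "norm w < N" for w
  proof -
    have "halfplane_ext \<phi> (complex_of_real N - w) = bernstein_disc \<phi> N (complex_of_real N - w)"
      using w N by (intro ext(3)) (auto simp: dist_norm)
    then show ?thesis
      using sums_mult[OF bernstein_disc_sums[OF \<phi> w], of "complex_of_real t"] by (simp add: P_def mult.assoc)
  qed
  obtain c where c: "\<And>k. c k \<ge> 0"
    "\<And>w. norm w < N \<Longrightarrow> (\<lambda>k. complex_of_real (c k) * w ^ k) sums exp (P w)"
    using exp_power_series_nonneg[of N "\<lambda>k. t * bernstein_coeff \<phi> N k" P] P bernstein_coeff_nonneg[OF \<phi>] t N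
    by auto
  define E where "E = exp (t * (\<phi> N - \<phi> (1 / N)))"
  have E: "E > 0" by (simp add: E_def)
  have P\<rho>: "exp (P (complex_of_real \<rho>)) = complex_of_real E"
  proof -
    have "complex_of_real N - complex_of_real \<rho> = complex_of_real (1 / N)"
      unfolding of_real_diff[symmetric] by (simp add: \<rho>_def)
    then show ?thesis using ext(2)[of "1 / N"] N unfolding P_def E_def by (simp add: exp_of_real[symmetric])
  qed
  \<comment> \<open>The series at \<rho> sums to \<open>E\<close>, so these weights sum to
    1.\<close>
  define w where "w k = c k * \<rho> ^ k / E" for k
  have w0: "w k \<ge> 0" for k using c \<rho> E by (simp add: w_def)
  have "(\<lambda>k. complex_of_real (c k) * complex_of_real \<rho> ^ k / complex_of_real E) sums (complex_of_real E / complex_of_real E)"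
    using c(2)[of "complex_of_real \<rho>"] \<rho> P\<rho> by (intro sums_divide) simp
  then have "(\<lambda>k. complex_of_real (w k)) sums complex_of_real 1" using E by (simp add: w_def)
  then have w1: "w sums 1" unfolding sums_of_real_iff .
  have "(\<integral>\<^sup>+k. ennreal (w k) \<partial>count_space UNIV) = (\<Sum>k. ennreal (w k))"
    by (rule nn_integral_count_space_nat)
  also have "\<dots> = ennreal (\<Sum>k. w k)"
    using w0 w1 by (intro suminf_ennreal2) (auto simp: sums_iff)
  also have "\<dots> = 1" using w1 by (simp add: sums_iff)
  finally have pmf: "pmf (embed_pmf w) k = w k" for k by (intro pmf_embed_pmf w0)
  \<comment> \<open>Mass \<open>w k\<close> at the point \<open>k / N\<close> turns the Laplace
    transform at \<open>z\<close> into the power series at \<open>\<rho> * exp (- z / N)\<close>,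
    divided by \<open>E\<close>.\<close>
  define \<mu> where "\<mu> = distr (measure_pmf (embed_pmf w)) borel (\<lambda>k. real k / N)"
  show thesis
  proof
    show "real_distribution \<mu>"
      unfolding \<mu>_def by (rule prob_space.real_distribution_distr[OF prob_space_measure_pmf]) simp
    show "emeasure \<mu> {..<0} = 0"
      unfolding \<mu>_def using N by (subst emeasure_distr) (auto simp: vimage_def divide_less_0_iff)
    fix z :: complex assume z: "Re z \<ge> 0"
    have "(LINT s|\<mu>. exp (- z * complex_of_real s)) = (LINT k|measure_pmf (embed_pmf w). exp (- z * complex_of_real (real k / N)))"
      unfolding \<mu>_def by (subst integral_distr) auto
    also have "\<dots> = exp (P (complex_of_real \<rho> * exp (- z / complex_of_real N))) / complex_of_real E"
    proof (rule integral_pmf_nat_sums)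
      show "norm (exp (- z * complex_of_real (real k / N))) \<le> 1" for k
        using z N by (simp add: norm_exp_eq_Re)
      have "norm (complex_of_real \<rho> * exp (- z / complex_of_real N)) \<le> \<rho> * 1"
        unfolding norm_mult using z N \<rho> by (intro mult_mono) (auto simp: norm_exp_eq_Re Re_divide_of_real)
      then have "norm (complex_of_real \<rho> * exp (- z / complex_of_real N)) < N" using \<rho> by simp
      from sums_divide[OF c(2)[OF this], of "complex_of_real E"]
      show "(\<lambda>k. complex_of_real (pmf (embed_pmf w) k) * exp (- z * complex_of_real (real k / N)))
          sums (exp (P (complex_of_real \<rho> * exp (- z / complex_of_real N))) / complex_of_real E)"
      proof (rule sums_cong[THEN iffD1, rotated])
        fix k
        have "exp (- z * complex_of_real (real k / N)) = exp (- z / complex_of_real N) ^ k"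
          by (simp add: exp_of_nat_mult[symmetric] mult.commute)
        then show "complex_of_real (c k) * (complex_of_real \<rho> * exp (- z / complex_of_real N)) ^ k / complex_of_real E
            = complex_of_real (pmf (embed_pmf w) k) * exp (- z * complex_of_real (real k / N))"
          by (simp add: pmf w_def power_mult_distrib)
      qed
    qed
    also have "\<dots> = exp (complex_of_real t * (complex_of_real (\<phi> (1 / N)) -
        halfplane_ext \<phi> (complex_of_real N - complex_of_real \<rho> * exp (- z / complex_of_real N))))"
      unfolding E_def P_def exp_of_real[symmetric] exp_diff[symmetric] by (simp add: algebra_simps)
    finally show "(LINT s|\<mu>. exp (- z * complex_of_real s)) = exp (complex_of_real t * (complex_of_real (\<phi> (1 / N)) -
        halfplane_ext \<phi> (complex_of_real N - complex_of_real (N - 1 / N) * exp (- z / complex_of_real N))))"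
      by (simp add: \<rho>_def)
  qed
qed

text \<open>The point equals \<open>z * f (- z / N) + exp (- z / N) / N\<close> with
  \<open>f w = (exp w - 1) / w\<close>, and \<open>f\<close> tends to 1 at 0.\<close>

lemma discretisation_point_tendsto:
  fixes z :: complex
  shows "((\<lambda>N. complex_of_real N - complex_of_real (N - 1 / N) * exp (- z / complex_of_real N)) \<longlongrightarrow> z) at_top"
proof -
  define f where "f w = (if w = 0 then 1 else (exp w - 1) / w)" for w :: complex
  have "((\<lambda>w. (exp w - 1) / w) \<longlongrightarrow> 1) (at (0::complex))"
    using DERIV_exp[of "0::complex"] by (simp add: has_field_derivative_iff)
  then have "isCont f 0"
    unfolding isCont_def by (subst tendsto_cong[of f "\<lambda>w. (exp w - 1) / w"]) (auto simp: f_def eventually_at_filter)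
  moreover have lim0: "((\<lambda>N. - z / complex_of_real N) \<longlongrightarrow> 0) at_top"
    by (rule tendsto_divide_0[OF tendsto_const filterlim_compose[OF filterlim_of_real_at_infinity filterlim_ident]])
  ultimately have "((\<lambda>N. f (- z / complex_of_real N)) \<longlongrightarrow> f 0) at_top"
    by (rule isCont_tendsto_compose)
  moreover have "f 0 = 1" by (simp add: f_def)
  ultimately have f: "((\<lambda>N. f (- z / complex_of_real N)) \<longlongrightarrow> 1) at_top" by simp
  have inv: "((\<lambda>N. complex_of_real (1 / N)) \<longlongrightarrow> complex_of_real 0) at_top"
    by (intro tendsto_of_real) real_asymp
  have "((\<lambda>N. z * f (- z / complex_of_real N) + complex_of_real (1 / N) * exp (- z / complex_of_real N))
      \<longlongrightarrow> z * 1 + complex_of_real 0 * exp 0) at_top"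
    by (intro tendsto_add tendsto_mult tendsto_const f inv tendsto_exp lim0)
  moreover have "\<forall>\<^sub>F N in at_top. z * f (- z / complex_of_real N) + complex_of_real (1 / N) * exp (- z / complex_of_real N)
      = complex_of_real N - complex_of_real (N - 1 / N) * exp (- z / complex_of_real N)"
    using eventually_gt_at_top[of 0]
  proof eventually_elim
    case (elim N)
    have "z * f (- z / complex_of_real N) = complex_of_real N * (1 - exp (- z / complex_of_real N))"
      using elim by (simp add: f_def field_simps)
    then show ?case by (simp add: algebra_simps)
  qed
  ultimately show ?thesis by (simp add: tendsto_cong)
qed

text \<open>The bounded continuous function \<open>min 1 (max 0 (- s))\<close> vanishes exactly for
  \<open>s \<ge> 0\<close>. Its integral is 0 along the sequence, hence for the limit.\<close>

lemma weak_conv_nonneg_support: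
  assumes \<mu>: "\<And>n. real_distribution (\<mu> n)" and M: "real_distribution M" and conv: "weak_conv_m \<mu> M"
    and null: "\<And>n. emeasure (\<mu> n) {..<0} = 0"
  shows "AE s in M. s \<ge> 0"
proof -
  interpret M: real_distribution M by (rule M)
  define f where "f s = min 1 (max 0 (- s))" for s :: real
  have cont: "isCont f s" for s unfolding f_def by (intro continuous_intros)
  have f_meas: "f \<in> borel_measurable borel" unfolding f_def by measurable
  have "(\<lambda>n. LINT s|\<mu> n. f s) \<longlonglongrightarrow> (LINT s|M. f s)"
    by (rule weak_conv_imp_integral_bdd_continuous_conv[OF \<mu> M conv, of f 1]) (use cont in \<open>auto simp: f_def\<close>)
  moreover have "(LINT s|\<mu> n. f s) = 0" for n
  proof -
    interpret \<mu>: real_distribution "\<mu> n" by (rule \<mu>)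
    have "AE s in \<mu> n. f s = 0"
      using null[of n] by (intro AE_I[of _ _ "{..<0}"]) (auto simp: f_def)
    then show ?thesis by (rule integral_eq_zero_AE)
  qed
  ultimately have "(LINT s|M. f s) = 0" by (simp add: LIMSEQ_const_iff)
  moreover have "integrable M f"
    by (rule M.integrable_const_bound[of _ 1]) (use f_meas in \<open>auto simp: f_def\<close>)
  ultimately have "AE s in M. f s = 0"
    by (subst (asm) integral_nonneg_eq_0_iff_AE) (auto simp: f_def)
  then show ?thesis by eventually_elim (auto simp: f_def min_def max_def split: if_splits)
qed

text \<open>Tightness of the discretisations, which yields a weakly convergent subsequence, comes
  from a lower bound on their Laplace transforms. The transforms converge to the right limit because
  \<open>\<zeta> n z\<close> tends to \<open>z\<close> and \<open>\<phi> (1 / N n)\<close> to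
  0.\<close>

lemma bernstein_subordinator_exists:
  assumes \<phi>: "\<phi> \<in> bernstein_Phi" and t: "t \<ge> 0"
  obtains M :: "real measure" where "real_distribution M" "AE s in M. s \<ge> 0"
    "\<And>z. Re z > 0 \<Longrightarrow> (LINT s|M. exp (- z * complex_of_real s)) = exp (- complex_of_real t * halfplane_ext \<phi> z)"
proof -
  have B: "bernstein_function \<phi>" using \<phi> by (simp add: bernstein_Phi_def)
  define N where "N n = real n + 2" for n
  have N: "N n > 1" for n by (simp add: N_def)
  define \<zeta> where "\<zeta> n z = complex_of_real (N n) - complex_of_real (N n - 1 / N n) * exp (- z / complex_of_real (N n))" for n z
  have "\<forall>n. \<exists>\<mu>. real_distribution \<mu> \<and> emeasure \<mu> {..<0} = 0 \<and> (\<forall>z. Re z \<ge> 0 \<longrightarrow>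
      (LINT s|\<mu>. exp (- z * complex_of_real s)) = exp (complex_of_real t * (complex_of_real (\<phi> (1 / N n)) - halfplane_ext \<phi> (\<zeta> n z))))"
    unfolding \<zeta>_def using bernstein_discretisation[OF B t N] by metis
  then obtain \<mu> where \<mu>: "\<And>n. real_distribution (\<mu> n)" "\<And>n. emeasure (\<mu> n) {..<0} = 0"
    "\<And>n z. Re z \<ge> 0 \<Longrightarrow> (LINT s|\<mu> n. exp (- z * complex_of_real s))
      = exp (complex_of_real t * (complex_of_real (\<phi> (1 / N n)) - halfplane_ext \<phi> (\<zeta> n z)))"
    by metis
  \<comment> \<open>\<open>y\<close> is \<open>\<zeta> n\<close> at the real point \<open>x\<close>.
    It lies between \<open>1 / N n\<close> and \<open>1 / N n + x\<close>, so the slope bound 1 for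
    \<phi> keeps the transform above \<open>exp (- t * x)\<close> uniformly in
    \<open>n\<close>.\<close>
  have lower: "(LINT s|\<mu> n. exp (- x * s)) \<ge> exp (- t * x)" if x: "x > 0" for n and x :: real
  proof -
    define y where "y = N n - (N n - 1 / N n) * exp (- x / N n)"
    have Ny: "N n - 1 / N n > 0" "N n > 0" using N[of n] by (auto simp: field_simps intro: less_trans)
    have "(N n - 1 / N n) * exp (- x / N n) \<le> (N n - 1 / N n) * 1"
      using x Ny by (intro mult_left_mono) auto
    moreover have "c \<le> a - b" if "b \<le> (a - c) * 1" for a b c :: real using that by simp
    ultimately have y1: "1 / N n \<le> y" unfolding y_def by blast
    have "1 - x / N n \<le> exp (- x / N n)" using exp_ge_add_one_self[of "- x / N n"] by simp
    then have "(N n - 1 / N n) * (1 - exp (- x / N n)) \<le> N n * (x / N n)"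
      using Ny x by (intro mult_mono) auto
    then have y2: "y - 1 / N n \<le> x" using Ny by (simp add: y_def algebra_simps)
    have "\<zeta> n (complex_of_real x) = complex_of_real y" by (simp add: \<zeta>_def y_def exp_of_real[symmetric])
    moreover have "y > 0" using y1 Ny by (intro less_le_trans[OF _ y1]) auto
    ultimately have "halfplane_ext \<phi> (\<zeta> n (complex_of_real x)) = complex_of_real (\<phi> y)"
      using halfplane_ext_bernstein(2)[OF B] by simp
    then have "(LINT s|\<mu> n. exp (- complex_of_real x * complex_of_real s)) = complex_of_real (exp (t * (\<phi> (1 / N n) - \<phi> y)))"
      using \<mu>(3)[of "complex_of_real x" n] x by (simp add: exp_of_real[symmetric])
    moreover have "(LINT s|\<mu> n. exp (- complex_of_real x * complex_of_real s)) = complex_of_real (LINT s|\<mu> n. exp (- x * s))"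
      unfolding integral_complex_of_real[symmetric] by (simp add: exp_of_real[symmetric])
    ultimately have "(LINT s|\<mu> n. exp (- x * s)) = exp (t * (\<phi> (1 / N n) - \<phi> y))"
      by (simp only: of_real_eq_iff)
    moreover have "- t * x \<le> t * (\<phi> (1 / N n) - \<phi> y)"
      using mult_left_mono[of "\<phi> y - \<phi> (1 / N n)" x t] bernstein_increment_le[OF \<phi>, of "1 / N n" y] y1 y2 Ny t
      by (simp add: algebra_simps)
    ultimately show ?thesis by simp
  qed
  have tight: "tight \<mu>"
    unfolding tight_def
  proof (intro conjI allI impI \<mu>(1))
    fix \<epsilon> :: real assume \<epsilon>: "\<epsilon> > 0"
    \<comment> \<open>For \<open>s > b\<close> the function \<open>1 - exp (- s / b)\<close> is at
      least \<open>1 - exp (- 1)\<close>, so a Markov inequality bounds the mass beyond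
      \<open>b\<close> by this quotient.\<close>
    have "((\<lambda>b. (1 - exp (- t / b)) / (1 - exp (- 1))) \<longlongrightarrow> 0) at_top" by real_asymp
    then have "\<forall>\<^sub>F b in at_top. (1 - exp (- t / b)) / (1 - exp (- 1)) < \<epsilon>"
      using \<epsilon> by (rule order_tendstoD(2))
    then have "\<forall>\<^sub>F b in at_top. b > 0 \<and> (1 - exp (- t / b)) / (1 - exp (- 1)) < \<epsilon>"
      using eventually_gt_at_top[of 0] by eventually_elim auto
    then obtain b where b: "b > 0" "(1 - exp (- t / b)) / (1 - exp (- 1)) < \<epsilon>"
      by (auto simp: eventually_at_top_linorder)
    \<comment> \<open>The left endpoint lies below 0 because the half-open interval has to contain a
      possible atom at 0.\<close>
    have "measure (\<mu> n) {-1<..b} > 1 - \<epsilon>" for n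
    proof -
      interpret \<mu>: real_distribution "\<mu> n" by (rule \<mu>)
      have e1: "1 - exp (- 1) > (0::real)" by simp
      have sets: "{b<..} \<in> sets (\<mu> n)" "{-1<..b} \<in> sets (\<mu> n)" "{..-1} \<in> sets (\<mu> n)" by auto
      have int: "integrable (\<mu> n) (\<lambda>s. 1 - exp (- (1 / b) * s))"
      proof -
        have "AE s in \<mu> n. s \<ge> 0" using \<mu>(2)[of n] by (intro AE_I[of _ _ "{..<0}"]) auto
        then have "AE s in \<mu> n. norm (1 - exp (- (1 / b) * s)) \<le> 1"
          by eventually_elim (use b in auto)
        then show ?thesis by (intro \<mu>.integrable_const_bound[of _ 1]) auto
      qed
      have "(1 - exp (- 1)) * measure (\<mu> n) {b<..} = (LINT s|\<mu> n. (1 - exp (- 1)) * indicator {b<..} s)"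
        by simp
      also have "\<dots> \<le> (LINT s|\<mu> n. 1 - exp (- (1 / b) * s))"
      proof (rule integral_mono_AE[OF _ int])
        show "integrable (\<mu> n) (\<lambda>s. (1 - exp (- 1)) * indicator {b<..} s :: real)"
          by (intro integrable_mult_right integrable_real_indicator) (auto simp: \<mu>.emeasure_eq_measure)
        have "AE s in \<mu> n. s \<ge> 0" using \<mu>(2)[of n] by (intro AE_I[of _ _ "{..<0}"]) auto
        then show "AE s in \<mu> n. (1 - exp (- 1)) * indicator {b<..} s \<le> 1 - exp (- (1 / b) * s)"
          by eventually_elim (use b in \<open>auto simp: indicator_def field_simps\<close>)
      qed
      also have "\<dots> = 1 - (LINT s|\<mu> n. exp (- (1 / b) * s))"
      proof -
        have "integrable (\<mu> n) (\<lambda>s. 1 - (1 - exp (- (1 / b) * s)))"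
          by (intro Bochner_Integration.integrable_diff int) auto
        then have "integrable (\<mu> n) (\<lambda>s. exp (- (1 / b) * s))" by simp
        then show ?thesis using \<mu>.prob_space by simp
      qed
      also have "\<dots> \<le> 1 - exp (- t / b)" using lower[of "1 / b" n] b by simp
      finally have "measure (\<mu> n) {b<..} \<le> (1 - exp (- t / b)) / (1 - exp (- 1))"
        using e1 by (simp add: pos_le_divide_eq mult.commute)
      then have "measure (\<mu> n) {b<..} < \<epsilon>" using b by simp
      moreover have "measure (\<mu> n) {..-1} = 0"
      proof -
        have "emeasure (\<mu> n) {..-1} \<le> emeasure (\<mu> n) {..<0}" by (rule emeasure_mono) auto
        then show ?thesis using \<mu>(2)[of n] by (simp add: \<mu>.emeasure_eq_measure measure_le_0_iff)
      qed
      moreover have "measure (\<mu> n) ({..-1} \<union> {-1<..b} \<union> {b<..}) \<le> measure (\<mu> n) {..-1} + measure (\<mu> n) {-1<..b} + measure (\<mu> n) {b<..}"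
        using measure_Un_le[of "{..-1} \<union> {-1<..b}" "\<mu> n" "{b<..}"]
          measure_Un_le[of "{..-1}" "\<mu> n" "{-1<..b}"] sets by (simp add: sets.Un)
      moreover have "{..-1} \<union> {-1<..b} \<union> {b<..} = space (\<mu> n)" using b by auto
      ultimately show ?thesis using \<mu>.prob_space by simp
    qed
    then show "\<exists>a b. a < b \<and> (\<forall>n. 1 - \<epsilon> < measure (\<mu> n) {a<..b})"
      using b by (intro exI[of _ "-1"] exI[of _ b]) auto
  qed
  obtain r M where r: "strict_mono r" and M: "real_distribution M" and conv: "weak_conv_m (\<mu> \<circ> id \<circ> r) M"
    using tight_imp_convergent_subsubsequence[OF tight strict_mono_id] by (auto simp: id_def)
  have conv': "weak_conv_m (\<lambda>n. \<mu> (r n)) M" using conv by (simp add: o_def)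
  have M0: "AE s in M. s \<ge> 0"
    by (rule weak_conv_nonneg_support[OF \<mu>(1) M conv' \<mu>(2)])
  interpret M: real_distribution M by (rule M)
  have laplace: "(LINT s|M. exp (- z * complex_of_real s)) = exp (- complex_of_real t * halfplane_ext \<phi> z)" if z: "Re z > 0" for z
  proof -
    \<comment> \<open>Truncating at 0 makes the exponential bounded on the whole line, as weak
      convergence requires; on the half-line that carries the measures nothing changes.\<close>
    define f where "f s = exp (- z * complex_of_real (max s 0))" for s
    have cont: "isCont f s" for s unfolding f_def by (intro continuous_intros)
    have f_meas: "f \<in> borel_measurable borel"
      by (intro borel_measurable_continuous_onI continuous_at_imp_continuous_on) (use cont in auto)
    have f_eq: "f s = exp (- z * complex_of_real s)" if "s \<ge> 0" for s using that by (simp add: f_def)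
    have "(\<lambda>n. LINT s|\<mu> (r n). f s) \<longlonglongrightarrow> (LINT s|M. f s)"
      by (rule weak_conv_imp_integral_bdd_continuous_conv[OF \<mu>(1) M conv', of f 1])
        (use cont z in \<open>auto simp: f_def norm_exp_eq_Re\<close>)
    also have "(LINT s|M. f s) = (LINT s|M. exp (- z * complex_of_real s))"
      using M0 f_meas by (intro integral_cong_AE) (auto elim!: eventually_mono simp: f_eq)
    also have "(\<lambda>n. LINT s|\<mu> (r n). f s) = (\<lambda>n. exp (complex_of_real t * (complex_of_real (\<phi> (1 / N (r n))) - halfplane_ext \<phi> (\<zeta> (r n) z))))"
    proof
      fix n
      interpret \<mu>: real_distribution "\<mu> (r n)" by (rule \<mu>)
      have "AE s in \<mu> (r n). s \<ge> 0" using \<mu>(2)[of "r n"] by (intro AE_I[of _ _ "{..<0}"]) auto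
      then have "(LINT s|\<mu> (r n). f s) = (LINT s|\<mu> (r n). exp (- z * complex_of_real s))"
        using f_meas by (intro integral_cong_AE) (auto elim!: eventually_mono simp: f_eq)
      then show "(LINT s|\<mu> (r n). f s) = exp (complex_of_real t * (complex_of_real (\<phi> (1 / N (r n))) - halfplane_ext \<phi> (\<zeta> (r n) z)))"
        using \<mu>(3)[of z "r n"] z by simp
    qed
    finally have l1: "(\<lambda>n. exp (complex_of_real t * (complex_of_real (\<phi> (1 / N (r n))) - halfplane_ext \<phi> (\<zeta> (r n) z))))
        \<longlonglongrightarrow> (LINT s|M. exp (- z * complex_of_real s))" .
    have N_lim: "filterlim (\<lambda>n. N (r n)) at_top sequentially"
      by (rule filterlim_compose[OF _ filterlim_subseq[OF r]]) (unfold N_def, real_asymp)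
    have "(\<lambda>n. \<zeta> (r n) z) \<longlonglongrightarrow> z"
      unfolding \<zeta>_def by (rule filterlim_compose[OF discretisation_point_tendsto N_lim])
    moreover have "isCont (halfplane_ext \<phi>) z"
      using holomorphic_on_imp_continuous_on[OF halfplane_ext_bernstein(1)[OF B]] z
      by (auto simp: continuous_on_eq_continuous_at open_halfspace_Re_gt)
    ultimately have "(\<lambda>n. halfplane_ext \<phi> (\<zeta> (r n) z)) \<longlonglongrightarrow> halfplane_ext \<phi> z"
      by (rule isCont_tendsto_compose[rotated])
    moreover have "(\<lambda>n. \<phi> (1 / N (r n))) \<longlonglongrightarrow> 0"
    proof -
      have "filterlim (\<lambda>N. 1 / N) (at_right 0) (at_top :: real filter)" by real_asymp
      then have "filterlim (\<lambda>n. 1 / N (r n)) (at_right 0) sequentially"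
        by (rule filterlim_compose[OF _ N_lim])
      moreover have "(\<phi> \<longlongrightarrow> 0) (at_right 0)" using \<phi> by (simp add: bernstein_Phi_def)
      ultimately show ?thesis by (rule filterlim_compose[rotated])
    qed
    ultimately have "(\<lambda>n. exp (complex_of_real t * (complex_of_real (\<phi> (1 / N (r n))) - halfplane_ext \<phi> (\<zeta> (r n) z))))
        \<longlonglongrightarrow> exp (complex_of_real t * (complex_of_real 0 - halfplane_ext \<phi> z))"
      by (intro tendsto_intros)
    with l1 show ?thesis by (simp add: LIMSEQ_unique)
  qed
  show thesis by (rule that[OF M M0 laplace])
qed

section \<open>Uniqueness and moments of the subordination measure\<close>

text \<open>Along the points \<open>z t n\<close>, which approach the imaginary axis from the right,
  the integrands stay bounded by 1 and the transforms converge to the characteristic function at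
  \<open>t\<close>, which determines the measure.\<close>

lemma laplace_transform_unique:
  assumes M: "real_distribution M" "AE s in M. s \<ge> 0" and M': "real_distribution M'" "AE s in M'. s \<ge> 0"
    and eq: "\<And>z. Re z > 0 \<Longrightarrow> (LINT s|M. exp (- z * complex_of_real s)) = (LINT s|M'. exp (- z * complex_of_real s))"
  shows "M = M'"
proof (rule Levy_uniqueness[OF M(1) M'(1)])
  define z where "z t n = complex_of_real (1 / real (Suc n)) - \<i> * complex_of_real t" for t n
  have lim: "(\<lambda>n. LINT s|N. exp (- z t n * complex_of_real s)) \<longlonglongrightarrow> char N t"
    if N: "real_distribution N" "AE s in N. s \<ge> 0" for N t
  proof -
    interpret N: real_distribution N by (rule N)
    have "(\<lambda>n. - z t n) \<longlonglongrightarrow> - (complex_of_real 0 - \<i> * complex_of_real t)"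
      unfolding z_def by (intro tendsto_intros tendsto_of_real LIMSEQ_Suc[OF lim_1_over_n])
    then have z: "(\<lambda>n. exp (- z t n * complex_of_real s)) \<longlonglongrightarrow> exp ((- (complex_of_real 0 - \<i> * complex_of_real t)) * complex_of_real s)" for s
      by (intro tendsto_exp tendsto_mult tendsto_const)
    show ?thesis
      unfolding char_def
    proof (rule integral_dominated_convergence[where w = "\<lambda>_. 1"])
      show "AE s in N. (\<lambda>n. exp (- z t n * complex_of_real s)) \<longlonglongrightarrow> iexp (t * s)"
        using z by (intro AE_I2) (simp add: mult_ac)
      show "AE s in N. norm (exp (- z t n * complex_of_real s)) \<le> 1" for n
        using N(2) by eventually_elim (simp add: norm_exp_eq_Re z_def)
    qed auto
  qed
  show "char M = char M'"
  proof
    fix t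
    have "(\<lambda>n. LINT s|M. exp (- z t n * complex_of_real s)) = (\<lambda>n. LINT s|M'. exp (- z t n * complex_of_real s))"
      by (intro ext eq) (simp add: z_def)
    then show "char M t = char M' t" using lim[OF M, of t] lim[OF M', of t] LIMSEQ_unique by metis
  qed
qed

text \<open>The definite description ranges over measures on the half-line of mass at most 1.
  Letting the Laplace variable tend to 0 shows that each candidate has mass 1, since \<phi> tends to
  0; pushed forward to the real line it is then fixed by its transform.\<close>

lemma subordination_measure_eq:
  assumes \<phi>: "\<phi> \<in> bernstein_Phi" and t: "t \<ge> 0"
  obtains M :: "real measure" where "real_distribution M" "AE s in M. s \<ge> 0"
    "\<And>x. x > 0 \<Longrightarrow> (LINT s|M. exp (- x * s)) = exp (- t * \<phi> x)"
    "subordination_measure \<phi> t = restrict_space M {0..}"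
proof -
  have B: "bernstein_function \<phi>" using \<phi> by (simp add: bernstein_Phi_def)
  note ext = halfplane_ext_bernstein(2)[OF B]
  obtain M where M: "real_distribution M" "AE s in M. s \<ge> 0"
    and laplace: "\<And>z. Re z > 0 \<Longrightarrow> (LINT s|M. exp (- z * complex_of_real s)) = exp (- complex_of_real t * halfplane_ext \<phi> z)"
    by (rule bernstein_subordinator_exists[OF \<phi> t]) blast
  interpret M: real_distribution M by (rule M)
  have real: "(LINT s|M. exp (- x * s)) = exp (- t * \<phi> x)" if x: "x > 0" for x
  proof -
    have "complex_of_real (LINT s|M. exp (- x * s)) = (LINT s|M. exp (- complex_of_real x * complex_of_real s))"
      unfolding integral_complex_of_real[symmetric] by (simp add: exp_of_real[symmetric])
    also have "\<dots> = complex_of_real (exp (- t * \<phi> x))"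
      using laplace[of "complex_of_real x"] ext[OF x] x by (simp add: exp_of_real[symmetric])
    finally show ?thesis by (simp only: of_real_eq_iff)
  qed
  have sub: "subordination_measure \<phi> t = restrict_space M {0..}"
    unfolding subordination_measure_def
  proof (rule the_equality, goal_cases)
    case 1
    have "(LINT s|restrict_space M {0..}. exp (- z * complex_of_real s)) = exp (- complex_of_real t * halfplane_ext \<phi> z)"
      if z: "Re z > 0" for z
    proof -
      have "(LINT s|restrict_space M {0..}. exp (- z * complex_of_real s)) = (LINT s|M. indicator {0..} s *\<^sub>R exp (- z * complex_of_real s))"
        by (rule integral_restrict_space) simp
      also have "\<dots> = (LINT s|M. exp (- z * complex_of_real s))"
        using M(2) by (intro integral_cong_AE) (auto elim!: eventually_mono)
      finally show ?thesis using laplace[OF z] by simp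
    qed
    moreover have "emeasure (restrict_space M {0..}) {0..} \<le> 1"
      by (subst emeasure_restrict_space) (auto intro: M.emeasure_le_1)
    ultimately show ?case by (auto intro!: sets_restrict_space_cong)
  next
    case (2 \<nu>)
    then have sets: "sets \<nu> = sets (restrict_space borel {0..})" and le1: "emeasure \<nu> {0..} \<le> 1"
      and lap: "\<And>z. Re z > 0 \<Longrightarrow> (LINT s|\<nu>. exp (- z * complex_of_real s)) = exp (- complex_of_real t * halfplane_ext \<phi> z)"
      by auto
    have space: "space \<nu> = {0..}" using sets_eq_imp_space_eq[OF sets] by (simp add: space_restrict_space)
    have fin: "finite_measure \<nu>"
      by (rule finite_measureI) (use le1 space in \<open>auto simp: top_unique\<close>)
    interpret \<nu>: finite_measure \<nu> by (rule fin)
    have meas: "f \<in> borel_measurable \<nu>" if "f \<in> borel_measurable borel" for f :: "real \<Rightarrow> 'b::topological_space"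
      using measurable_restrict_space1[OF that] measurable_cong_sets[OF sets refl] by blast
    have "(\<lambda>n. LINT s|\<nu>. exp (- complex_of_real (1 / real (Suc n)) * complex_of_real s)) \<longlonglongrightarrow> (LINT s|\<nu>. 1)"
    proof (rule integral_dominated_convergence[where w = "\<lambda>_. 1"])
      show "AE s in \<nu>. (\<lambda>n. exp (- complex_of_real (1 / real (Suc n)) * complex_of_real s)) \<longlonglongrightarrow> 1"
      proof (rule AE_I2)
        fix s
        have "(\<lambda>n. exp (- complex_of_real (1 / real (Suc n)) * complex_of_real s)) \<longlonglongrightarrow> exp (- complex_of_real 0 * complex_of_real s)"
          by (intro tendsto_intros tendsto_of_real LIMSEQ_Suc[OF lim_1_over_n])
        then show "(\<lambda>n. exp (- complex_of_real (1 / real (Suc n)) * complex_of_real s)) \<longlonglongrightarrow> 1" by simp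
      qed
      show "AE s in \<nu>. norm (exp (- complex_of_real (1 / real (Suc n)) * complex_of_real s)) \<le> 1" for n
        using space by (intro AE_I2) (simp add: norm_exp_eq_Re)
      show "(\<lambda>s. exp (- complex_of_real (1 / real (Suc n)) * complex_of_real s)) \<in> borel_measurable \<nu>" for n
        by (rule meas) simp
    qed simp_all
    moreover have "(LINT s|\<nu>. exp (- complex_of_real (1 / real (Suc n)) * complex_of_real s)) = complex_of_real (exp (- t * \<phi> (1 / real (Suc n))))" for n
      using lap[of "complex_of_real (1 / real (Suc n))"] ext[of "1 / real (Suc n)"] by (simp add: exp_of_real[symmetric])
    moreover have "(\<lambda>n. complex_of_real (exp (- t * \<phi> (1 / real (Suc n))))) \<longlonglongrightarrow> complex_of_real (exp (- t * 0))"
    proof (intro tendsto_of_real tendsto_exp tendsto_mult tendsto_const)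
      have "filterlim (\<lambda>n. 1 / real (Suc n)) (at_right 0) sequentially" by real_asymp
      moreover have "(\<phi> \<longlongrightarrow> 0) (at_right 0)" using \<phi> by (simp add: bernstein_Phi_def)
      ultimately show "(\<lambda>n. \<phi> (1 / real (Suc n))) \<longlonglongrightarrow> 0" by (rule filterlim_compose[rotated])
    qed
    ultimately have "(LINT s|\<nu>. 1) = complex_of_real 1" using LIMSEQ_unique by fastforce
    then have "measure \<nu> (space \<nu>) = 1" by (simp add: scaleR_conv_of_real)
    then have prob: "prob_space \<nu>" by (intro prob_spaceI) (simp add: \<nu>.emeasure_eq_measure)
    define M' where "M' = distr \<nu> borel (\<lambda>s. s)"
    have M': "real_distribution M'"
      unfolding M'_def by (intro prob_space.real_distribution_distr prob meas) simp
    have "AE s in M'. s \<ge> 0"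
      unfolding M'_def using space by (subst AE_distr_iff) (auto intro: meas)
    moreover have "(LINT s|M'. exp (- z * complex_of_real s)) = (LINT s|\<nu>. exp (- z * complex_of_real s))" for z
      unfolding M'_def by (rule integral_distr) (auto intro: meas)
    ultimately have "M' = M" using lap laplace by (intro laplace_transform_unique M M') auto
    show "\<nu> = restrict_space M {0..}"
    proof (rule measure_eqI)
      show "sets \<nu> = sets (restrict_space M {0..})"
        unfolding sets by (rule sets_restrict_space_cong) simp
      fix A assume "A \<in> sets \<nu>"
      then have A: "A \<in> sets borel" "A \<subseteq> {0..}" unfolding sets by (auto simp: sets_restrict_space)
      have "emeasure (restrict_space M {0..}) A = emeasure M' A"
        unfolding \<open>M' = M\<close> using A by (intro emeasure_restrict_space) auto
      also have "\<dots> = emeasure \<nu> ((\<lambda>s. s) -` A \<inter> space \<nu>)"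
        unfolding M'_def by (rule emeasure_distr) (auto intro: meas A)
      also have "(\<lambda>s. s) -` A \<inter> space \<nu> = A" using A space by auto
      finally show "emeasure \<nu> A = emeasure (restrict_space M {0..}) A" by simp
    qed
  qed
  show thesis by (rule that[OF M real sub])
qed

text \<open>The second quotient is a second forward difference of \<open>L\<close> with the value 1
  at 0, so it tends to the second derivative of \<open>L\<close> at 0+. Since derivatives are known
  only at positive arguments, l'Hopital's rule is applied, twice for this quotient.\<close>

lemma subordinator_laplace_limits:
  fixes t l :: real
  assumes \<phi>: "\<phi> \<in> bernstein_Phi" and l: "(deriv (deriv \<phi>) \<longlongrightarrow> l) (at_right 0)"
  defines "L \<equiv> \<lambda>x. exp (- t * \<phi> x)"
  shows "((\<lambda>x. (1 - L x) / x) \<longlongrightarrow> t) (at_right 0)"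
    "((\<lambda>x. (1 - 2 * L x + L (2 * x)) / x\<^sup>2) \<longlongrightarrow> t\<^sup>2 - t * l) (at_right 0)"
proof -
  have B: "bernstein_function \<phi>" and \<phi>0: "(\<phi> \<longlongrightarrow> 0) (at_right 0)" and \<phi>1: "(deriv \<phi> \<longlongrightarrow> 1) (at_right 0)"
    using \<phi> by (auto simp: bernstein_Phi_def)
  define L1 where "L1 x = - t * deriv \<phi> x * L x" for x
  define L2 where "L2 x = (t\<^sup>2 * (deriv \<phi> x)\<^sup>2 - t * deriv (deriv \<phi>) x) * L x" for x
  have d0: "(\<phi> has_real_derivative deriv \<phi> x) (at x)" and d1: "(deriv \<phi> has_real_derivative deriv (deriv \<phi>) x) (at x)"
    if "x > 0" for x
    using bernstein_functionD(2)[OF B that, of 0] bernstein_functionD(2)[OF B that, of 1] by auto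
  have dL: "(L has_real_derivative L1 x) (at x)" if "x > 0" for x
    unfolding L_def L1_def using d0[OF that] by (auto intro!: derivative_eq_intros)
  have dL1: "(L1 has_real_derivative L2 x) (at x)" if "x > 0" for x
    unfolding L1_def[abs_def] L2_def using d1[OF that] dL[OF that]
    by (auto intro!: derivative_eq_intros simp: L1_def power2_eq_square algebra_simps)
  have scaled: "((\<lambda>x. f (2 * x)) has_real_derivative 2 * f' (2 * x)) (at x)"
    if "(f has_real_derivative f' (2 * x)) (at (2 * x))" for f f' :: "real \<Rightarrow> real" and x
  proof -
    have "((\<lambda>x. 2 * x) has_real_derivative 2) (at x)" by (auto intro!: derivative_eq_intros)
    from DERIV_chain[OF that this] show ?thesis by (simp add: o_def mult.commute)
  qed
  have lim2: "filterlim (\<lambda>x::real. 2 * x) (at_right 0) (at_right 0)" by real_asymp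
  have L_lim: "(L \<longlongrightarrow> 1) (at_right 0)"
    unfolding L_def using tendsto_exp[OF tendsto_mult[OF tendsto_const \<phi>0, of "- t"]] by simp
  have L1_lim: "(L1 \<longlongrightarrow> - t) (at_right 0)"
    unfolding L1_def using tendsto_mult[OF tendsto_mult[OF tendsto_const \<phi>1, of "- t"] L_lim] by simp
  have L2_lim: "(L2 \<longlongrightarrow> t\<^sup>2 - t * l) (at_right 0)"
    unfolding L2_def using tendsto_mult[OF tendsto_diff[OF tendsto_mult[OF tendsto_const tendsto_power[OF \<phi>1]] tendsto_mult[OF tendsto_const l]] L_lim, of "t\<^sup>2" 2 t]
    by simp
  note L_lim' = filterlim_compose[OF L_lim lim2] and L1_lim' = filterlim_compose[OF L1_lim lim2]
    and L2_lim' = filterlim_compose[OF L2_lim lim2]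
  note ev = eventually_at_right_less[of "0::real"]
  show "((\<lambda>x. (1 - L x) / x) \<longlongrightarrow> t) (at_right 0)"
  proof (rule lhopital_right_0[where f' = "\<lambda>x. - L1 x" and g' = "\<lambda>_. 1"])
    show "((\<lambda>x. 1 - L x) \<longlongrightarrow> 0) (at_right 0)" using tendsto_diff[OF tendsto_const L_lim, of 1] by simp
    show "\<forall>\<^sub>F x in at_right 0. ((\<lambda>x. 1 - L x) has_real_derivative - L1 x) (at x)"
      using ev by eventually_elim (auto intro!: derivative_eq_intros dL)
    show "((\<lambda>x. - L1 x / 1) \<longlongrightarrow> t) (at_right 0)" using tendsto_minus[OF L1_lim] by simp
    show "\<forall>\<^sub>F x::real in at_right 0. x \<noteq> 0" using ev by eventually_elim simp
  qed (auto intro!: tendsto_eq_intros)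
  show "((\<lambda>x. (1 - 2 * L x + L (2 * x)) / x\<^sup>2) \<longlongrightarrow> t\<^sup>2 - t * l) (at_right 0)"
  proof (rule lhopital_right_0[where f' = "\<lambda>x. - 2 * L1 x + 2 * L1 (2 * x)" and g' = "\<lambda>x. 2 * x"])
    show "((\<lambda>x. 1 - 2 * L x + L (2 * x)) \<longlongrightarrow> 0) (at_right 0)"
      using tendsto_add[OF tendsto_diff[OF tendsto_const tendsto_mult[OF tendsto_const L_lim]] L_lim', of 1 2] by simp
    show "\<forall>\<^sub>F x in at_right 0. ((\<lambda>x. 1 - 2 * L x + L (2 * x)) has_real_derivative - 2 * L1 x + 2 * L1 (2 * x)) (at x)"
      using ev by eventually_elim (auto intro!: derivative_eq_intros dL scaled[of L L1])
    show "\<forall>\<^sub>F x::real in at_right 0. 2 * x \<noteq> 0" "\<forall>\<^sub>F x::real in at_right 0. x\<^sup>2 \<noteq> 0" using ev by (eventually_elim, simp)+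
    show "\<forall>\<^sub>F x::real in at_right 0. ((\<lambda>x. x\<^sup>2) has_real_derivative 2 * x) (at x)"
      by (auto intro!: derivative_eq_intros always_eventually)
    show "((\<lambda>x. (- 2 * L1 x + 2 * L1 (2 * x)) / (2 * x)) \<longlongrightarrow> t\<^sup>2 - t * l) (at_right 0)"
    proof (rule lhopital_right_0[where f' = "\<lambda>x. - 2 * L2 x + 4 * L2 (2 * x)" and g' = "\<lambda>_. 2"])
      show "((\<lambda>x. - 2 * L1 x + 2 * L1 (2 * x)) \<longlongrightarrow> 0) (at_right 0)"
        using tendsto_add[OF tendsto_mult[OF tendsto_const L1_lim] tendsto_mult[OF tendsto_const L1_lim'], of "-2" 2] by simp
      show "\<forall>\<^sub>F x in at_right 0. ((\<lambda>x. - 2 * L1 x + 2 * L1 (2 * x)) has_real_derivative - 2 * L2 x + 4 * L2 (2 * x)) (at x)"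
        using ev by eventually_elim (auto intro!: derivative_eq_intros dL1 scaled[of L1 L2])
      show "((\<lambda>x. (- 2 * L2 x + 4 * L2 (2 * x)) / 2) \<longlongrightarrow> t\<^sup>2 - t * l) (at_right 0)"
        using tendsto_divide[OF tendsto_add[OF tendsto_mult[OF tendsto_const L2_lim] tendsto_mult[OF tendsto_const L2_lim'], of "-2" 4] tendsto_const[of 2]] by (simp add: diff_divide_distrib mult.commute)
      show "\<forall>\<^sub>F x::real in at_right 0. 2 * x \<noteq> 0" using ev by eventually_elim simp
      show "\<forall>\<^sub>F x::real in at_right 0. ((\<lambda>x. 2 * x) has_real_derivative 2) (at x)"
        by (auto intro!: derivative_eq_intros always_eventually)
    qed (auto intro!: tendsto_eq_intros)
  qed (auto intro!: tendsto_eq_intros)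
qed

text \<open>\<open>q n s\<close> tends to \<open>s\<close>, and the integrals of \<open>q n\<close>
  and of its square are the difference quotients of the transform. Fatou's lemma bounds the second
  moment; then \<open>s\<close> is an integrable majorant of \<open>q n\<close>, and dominated
  convergence gives the mean.\<close>

lemma subordinator_moments:
  assumes \<phi>: "\<phi> \<in> bernstein_Phi" and l: "(deriv (deriv \<phi>) \<longlongrightarrow> l) (at_right 0)"
    and M: "real_distribution M" "AE s in M. s \<ge> 0"
    and laplace: "\<And>x. x > 0 \<Longrightarrow> (LINT s|M. exp (- x * s)) = exp (- t * \<phi> x)"
  shows "integrable M (\<lambda>s. s\<^sup>2)" "integrable M (\<lambda>s. s)" "(LINT s|M. s) = t" "(LINT s|M. s\<^sup>2) \<le> t\<^sup>2 - t * l"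
proof -
  interpret M: real_distribution M by (rule M)
  define L where "L x = exp (- t * \<phi> x)" for x
  note lims = subordinator_laplace_limits[OF \<phi> l, of t, folded L_def]
  have int_exp: "integrable M (\<lambda>s. exp (- x * s))" if "x > 0" for x
  proof (rule M.integrable_const_bound[of _ 1])
    show "AE s in M. norm (exp (- x * s)) \<le> 1" using M(2) by eventually_elim (use that in simp)
  qed simp
  define x where "x n = 1 / real (Suc n)" for n
  have x: "x n > 0" for n by (simp add: x_def)
  have x_lim: "filterlim x (at_right 0) sequentially" unfolding x_def[abs_def] by real_asymp
  define q where "q n s = (1 - exp (- x n * s)) / x n" for n s
  have q_lim: "(\<lambda>n. q n s) \<longlonglongrightarrow> s" for s
  proof -
    have "((\<lambda>x. (1 - exp (- x * s)) / x) \<longlongrightarrow> s) (at_right 0)" by real_asymp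
    then show ?thesis unfolding q_def by (rule filterlim_compose[OF _ x_lim])
  qed
  have q_int: "integrable M (q n)" "(LINT s|M. q n s) = (1 - L (x n)) / x n" for n
    using int_exp[OF x, of n] laplace[OF x, of n] M.prob_space by (auto simp: q_def[abs_def] L_def)
  have q2: "(q n s)\<^sup>2 = (1 - 2 * exp (- x n * s) + exp (- (2 * x n) * s)) / (x n)\<^sup>2" for n s
    by (simp add: q_def power_divide power2_eq_square algebra_simps exp_double exp_add[symmetric])
  have q2_int: "integrable M (\<lambda>s. (q n s)\<^sup>2)" "(LINT s|M. (q n s)\<^sup>2) = (1 - 2 * L (x n) + L (2 * x n)) / (x n)\<^sup>2" for n
    using int_exp[OF x, of n] laplace[OF x, of n] int_exp[of "2 * x n"] laplace[of "2 * x n"] x[of n] M.prob_space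
    unfolding q2 by (auto simp: L_def)
  have nn_le: "(\<integral>\<^sup>+s. ennreal (s\<^sup>2) \<partial>M) \<le> ennreal (t\<^sup>2 - t * l)"
  proof -
    have "(\<integral>\<^sup>+s. ennreal (s\<^sup>2) \<partial>M) = (\<integral>\<^sup>+s. liminf (\<lambda>n. ennreal ((q n s)\<^sup>2)) \<partial>M)"
    proof (rule nn_integral_cong)
      fix s
      have "(\<lambda>n. ennreal ((q n s)\<^sup>2)) \<longlonglongrightarrow> ennreal (s\<^sup>2)" by (intro tendsto_ennrealI tendsto_power q_lim)
      then show "ennreal (s\<^sup>2) = liminf (\<lambda>n. ennreal ((q n s)\<^sup>2))"
        by (rule lim_imp_Liminf[OF sequentially_bot, symmetric])
    qed
    also have "\<dots> \<le> liminf (\<lambda>n. \<integral>\<^sup>+s. ennreal ((q n s)\<^sup>2) \<partial>M)"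
      by (rule nn_integral_liminf) (use q2_int(1) in \<open>auto dest: borel_measurable_integrable\<close>)
    also have "(\<lambda>n. \<integral>\<^sup>+s. ennreal ((q n s)\<^sup>2) \<partial>M) = (\<lambda>n. ennreal ((1 - 2 * L (x n) + L (2 * x n)) / (x n)\<^sup>2))"
      using q2_int by (simp add: nn_integral_eq_integral)
    also have "liminf \<dots> = ennreal (t\<^sup>2 - t * l)"
      by (intro lim_imp_Liminf tendsto_ennrealI filterlim_compose[OF lims(2) x_lim]) simp
    finally show ?thesis .
  qed
  show int2: "integrable M (\<lambda>s. s\<^sup>2)"
    by (rule integrableI_nonneg) (use nn_le in \<open>auto intro: le_less_trans\<close>)
  show int1: "integrable M (\<lambda>s. s)"
  proof (rule Bochner_Integration.integrable_bound[OF Bochner_Integration.integrable_add[OF M.integrable_const[of 1] int2]])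
    have "\<bar>s\<bar> \<le> 1 + s\<^sup>2" for s :: real
    proof -
      have "0 \<le> (\<bar>s\<bar> - 1)\<^sup>2 + 1" "\<bar>s\<bar>\<^sup>2 = s\<^sup>2" by simp_all
      then show ?thesis using zero_le_power2[of "\<bar>s\<bar> - 1"] by (simp add: power2_diff)
    qed
    then show "AE s in M. norm s \<le> norm (1 + s\<^sup>2)" by (intro AE_I2) auto
  qed simp
  \<comment> \<open>The sign matters for passing from \<open>ennreal\<close> back to the reals,
    because \<open>ennreal\<close> sends negative numbers to 0.\<close>
  have "0 \<le> t\<^sup>2 - t * l"
  proof (rule tendsto_lowerbound[OF filterlim_compose[OF lims(2) x_lim]])
    have "(1 - 2 * L (x n) + L (2 * x n)) / (x n)\<^sup>2 \<ge> 0" for n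
      unfolding q2_int(2)[symmetric] by (rule integral_nonneg_AE) auto
    then show "\<forall>\<^sub>F n in sequentially. 0 \<le> (1 - 2 * L (x n) + L (2 * x n)) / (x n)\<^sup>2" by simp
  qed simp
  then show "(LINT s|M. s\<^sup>2) \<le> t\<^sup>2 - t * l"
    using nn_le int2 by (simp add: nn_integral_eq_integral)
  have "(\<lambda>n. LINT s|M. q n s) \<longlonglongrightarrow> (LINT s|M. s)"
  proof (rule integral_dominated_convergence[OF _ _ int1])
    show "AE s in M. norm (q n s) \<le> s" for n
      using M(2)
    proof eventually_elim
      case (elim s)
      have "1 - x n * s \<le> exp (- x n * s)" using exp_ge_add_one_self[of "- x n * s"] by simp
      moreover have "exp (- x n * s) \<le> 1" using elim x[of n] by simp
      ultimately show ?case using x[of n] by (simp add: q_def field_simps)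
    qed
  qed (use q_lim q_int in \<open>auto dest: borel_measurable_integrable\<close>)
  moreover have "(\<lambda>n. LINT s|M. q n s) \<longlonglongrightarrow> t"
    unfolding q_int(2) by (rule filterlim_compose[OF lims(1) x_lim])
  ultimately show "(LINT s|M. s) = t" by (rule LIMSEQ_unique)
qed

section \<open>Fractional powers and the error bound\<close>

text \<open>Integrating \<open>m - m\<^sup>2 / 4 \<le> m powr \<beta>\<close> against
  \<open>exp (- m)\<close> gives \<open>1 - 2 / 4\<close> on the left. The inequality holds up to 1
  because \<open>m \<le> m powr \<beta>\<close>, and beyond 1 because the left side never exceeds
  1.\<close>

lemma Gamma_plus1_ge_half:
  fixes \<beta> :: real
  assumes \<beta>: "0 < \<beta>" "\<beta> < 1"
  shows "Gamma (\<beta> + 1) \<ge> 1 / 2"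
proof -
  define k where "k b m = indicator {0<..} m * (m powr (b - 1) * exp (- (m * 1)))" for b m :: real
  have k: "has_bochner_integral lborel (k b) (Gamma b)" if "b > 0" for b
    using has_bochner_integral_Gamma_kernel[OF that, of 1] by (simp add: k_def[abs_def])
  have "has_bochner_integral lborel (\<lambda>m. k 2 m - (1 / 4) * k 3 m) (Gamma 2 - (1 / 4) * Gamma 3)"
    by (intro has_bochner_integral_diff has_bochner_integral_mult_right k) auto
  moreover have "Gamma 2 = (1 :: real)" "Gamma 3 = (2 :: real)"
    using Gamma_fact[of 1, where 'a = real] Gamma_fact[of 2, where 'a = real] by simp_all
  ultimately have 1: "has_bochner_integral lborel (\<lambda>m. k 2 m - (1 / 4) * k 3 m) (1 / 2)" by simp
  have 2: "has_bochner_integral lborel (k (\<beta> + 1)) (Gamma (\<beta> + 1))" using \<beta> by (intro k) auto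
  have le: "k 2 m - (1 / 4) * k 3 m \<le> k (\<beta> + 1) m" for m
  proof (cases "m > 0")
    case True
    have "m - (1 / 4) * m\<^sup>2 \<le> m powr \<beta>"
    proof (cases "m \<le> 1")
      case le1: True
      have "m powr 1 \<le> m powr \<beta>" using True le1 \<beta> by (intro powr_mono') auto
      then have "m \<le> m powr \<beta>" using True by simp
      moreover have "m - (1 / 4) * m\<^sup>2 \<le> m" by simp
      ultimately show ?thesis by (rule order_trans[rotated])
    next
      case False
      have "0 \<le> (m / 2 - 1)\<^sup>2" by simp
      then have "m - (1 / 4) * m\<^sup>2 \<le> 1" by (simp add: power2_eq_square field_simps)
      also have "1 \<le> m powr \<beta>" using False \<beta> by (intro ge_one_powr_ge_zero) auto
      finally show ?thesis .
    qed
    from mult_right_mono[OF this, of "exp (- m)"] True show ?thesis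
      by (simp add: k_def algebra_simps powr_numeral)
  qed (simp add: k_def)
  show ?thesis
    using integral_mono[of lborel "\<lambda>m. k 2 m - (1 / 4) * k 3 m" "k (\<beta> + 1)"] 1 2 le
    by (simp add: has_bochner_integral_iff)
qed

text \<open>Euler's reflection formula; it matches the normalisation of Balakrishnan's integral with
  the Gamma factors of the Fubini identities.\<close>

lemma sin_pi_eq_Gamma:
  fixes \<beta> :: real
  assumes \<beta>: "0 < \<beta>" "\<beta> < 1"
  shows "sin (pi * \<beta>) / pi = 1 / (Gamma \<beta> * Gamma (1 - \<beta>))"
proof -
  have "complex_of_real (Gamma \<beta> * Gamma (1 - \<beta>)) = Gamma (complex_of_real \<beta>) * Gamma (1 - complex_of_real \<beta>)"
    by (simp add: Gamma_complex_of_real[symmetric])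
  also have "\<dots> = complex_of_real pi / sin (complex_of_real pi * complex_of_real \<beta>)"
    by (rule Gamma_reflection_complex)
  also have "\<dots> = complex_of_real (pi / sin (pi * \<beta>))"
    by (simp add: sin_of_real[symmetric])
  finally have "Gamma \<beta> * Gamma (1 - \<beta>) = pi / sin (pi * \<beta>)" by (simp only: of_real_eq_iff)
  then show ?thesis by simp
qed

section \<open>Hoelder estimates and expansions of scalar orbits\<close>

context
  fixes T :: "real \<Rightarrow> 'a::banach \<Rightarrow>\<^sub>L 'a" and A :: "('a \<times> 'a) set" and K :: real
  assumes T: "C0_semigroup T" "generator T = op_scale (-1) A" and K: "\<forall>s\<ge>0. norm (T s) \<le> K"
begin

lemma orbit_bound_nonneg: "K \<ge> 0"
  using K norm_ge_zero[of "T 0"] by (meson order_refl order_trans)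

text \<open>This keeps the resolvent of \<open>w = A x\<close> bounded as \<open>l\<close> tends to
  0, since \<open>l\<close> times the resolvent of \<open>x\<close> has norm at most
  \<open>K * norm x\<close>. Convergence of Balakrishnan's integral at 0 rests on it.\<close>

lemma resolvent_neg_range:
  assumes xw: "(x, w) \<in> A" and l: "l > 0"
  shows "resolvent_neg A l w = x - l *\<^sub>R resolvent_neg A l x"
proof (rule resolvent_neg_eqI(1)[OF T K l])
  let ?v = "x - l *\<^sub>R resolvent_neg A l x"
  have "(resolvent_neg A l x, - ?v) \<in> generator T"
    unfolding T(2) mem_op_scale_uminus minus_minus by (rule resolvent_neg_properties(1)[OF T K l])
  from generator_scaleR[OF this, of l] have "(l *\<^sub>R resolvent_neg A l x, l *\<^sub>R ?v) \<in> A"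
    unfolding T(2) mem_op_scale_uminus scaleR_minus_right minus_minus .
  from neg_generator_diff[OF T(2) xw this] show "(?v, w - l *\<^sub>R ?v) \<in> A" .
qed

text \<open>Absorbing \<open>T r\<close> into the functional turns the vector integral into an
  integral of Laplace transforms of the scalar orbit started at time \<open>r\<close>, which is the
  form the scalar estimates use.\<close>

lemma balakrishnan_functional:
  assumes \<beta>: "0 < \<beta>" "\<beta> < 1" and xw: "(x, w) \<in> A" and \<psi>: "bounded_linear \<psi>" "\<And>z. \<bar>\<psi> z\<bar> \<le> norm z"
    and r: "r \<ge> 0"
  defines "v \<equiv> vector_integral (restrict_space lborel {0<..}) (\<lambda>l. (l powr (\<beta> - 1)) *\<^sub>R resolvent_neg A l w)"
  shows "set_integrable lborel {0<..} (\<lambda>l. l powr (\<beta> - 1) * (LBINT s:{0<..}. exp (- l * s) * \<psi> (T (r + s) w)))"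
    "(LBINT l:{0<..}. l powr (\<beta> - 1) * (LBINT s:{0<..}. exp (- l * s) * \<psi> (T (r + s) w))) = \<psi> (T r v)"
proof -
  let ?M = "restrict_space lborel {0<..} :: real measure"
  let ?f = "\<lambda>l. (l powr (\<beta> - 1)) *\<^sub>R resolvent_neg A l w"
  have sets: "sets ?M = sets (restrict_space borel {0<..})"
    by (rule sets_restrict_space_cong) simp
  have cont: "continuous_on {0<..} ?f"
    by (intro continuous_intros resolvent_neg_continuous_on[OF T K]) auto
  define C where "C = (norm x + K * norm x) + K * norm w"
  have C0: "C \<ge> 0" unfolding C_def using orbit_bound_nonneg by (intro add_nonneg_nonneg mult_nonneg_nonneg) auto
  \<comment> \<open>Adding the bounds for \<open>?q\<close> and for \<open>l * ?q\<close> covers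
    small and large \<open>l\<close> at once and yields the Stieltjes majorant with \<delta> =
    1.\<close>
  have f_le: "norm (?f l) \<le> C * (l powr (\<beta> - 1) * (1 / (l + 1)))" if l: "l > 0" for l
  proof -
    let ?q = "norm (resolvent_neg A l w)"
    have q1: "l * ?q \<le> K * norm w"
      using resolvent_neg_properties(2)[OF T K l, of w] l by (simp add: field_simps)
    have "?q \<le> norm x + norm (l *\<^sub>R resolvent_neg A l x)"
      unfolding resolvent_neg_range[OF xw l] by (rule norm_triangle_ineq4)
    also have "norm (l *\<^sub>R resolvent_neg A l x) \<le> K * norm x"
      using resolvent_neg_properties(2)[OF T K l, of x] l by (simp add: field_simps)
    finally have "?q * (l + 1) \<le> C" using q1 by (simp add: C_def algebra_simps)
    then have "?q \<le> C * (1 / (l + 1))" using l by (simp add: field_simps)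
    from mult_left_mono[OF this, of "l powr (\<beta> - 1)"] show ?thesis by (simp add: mult_ac)
  qed
  have fin: "(\<integral>\<^sup>+l. ennreal (norm (?f l)) \<partial>?M) < \<infinity>"
  proof -
    have "(\<integral>\<^sup>+l. ennreal (norm (?f l)) \<partial>?M) = (\<integral>\<^sup>+l. ennreal (norm (?f l)) * indicator {0<..} l \<partial>lborel)"
      by (rule nn_integral_restrict_space) simp
    also have "\<dots> \<le> (\<integral>\<^sup>+l. ennreal (C * (indicator {0<..} l * (l powr (\<beta> - 1) * (1 / (l + 1))))) \<partial>lborel)"
      by (intro nn_integral_mono) (use f_le in \<open>auto simp: indicator_def intro!: ennreal_leI\<close>)
    also have "\<dots> < \<infinity>"
      using integrable_mult_right[OF stieltjes_integral(1)[OF \<beta> zero_less_one], of C] C0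
      by (subst nn_integral_eq_integral) (auto intro!: AE_I2 simp: indicator_def)
    finally show ?thesis .
  qed
  have \<psi>r: "bounded_linear (\<lambda>z. \<psi> (T r z))"
    by (rule bounded_linear_compose[OF \<psi>(1) blinfun.bounded_linear_right])
  note fv = functional_vector_integral[OF sets cont fin \<psi>r]
  have eq: "\<psi> (T r (?f l)) = l powr (\<beta> - 1) * (LBINT s:{0<..}. exp (- l * s) * \<psi> (T (r + s) w))" if "l \<in> {0<..}" for l
  proof -
    have "\<psi> (T r (?f l)) = l powr (\<beta> - 1) * \<psi> (T r (resolvent_neg A l w))"
      by (simp add: blinfun.scaleR_right linear_scale[OF bounded_linear.linear[OF \<psi>(1)]])
    then show ?thesis
      using resolvent_functional[OF T K _ resolvent_neg_properties(1)[OF T K] \<psi> r, of l] that by simp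
  qed
  have "set_integrable lborel {0<..} (\<lambda>l. \<psi> (T r (?f l)))"
    using fv(1) by (simp add: set_integrable_def integrable_restrict_space)
  then show "set_integrable lborel {0<..} (\<lambda>l. l powr (\<beta> - 1) * (LBINT s:{0<..}. exp (- l * s) * \<psi> (T (r + s) w)))"
    by (subst set_integrable_cong[OF refl refl eq[symmetric]])
  have "\<psi> (T r v) = (LBINT l:{0<..}. \<psi> (T r (?f l)))"
    using fv(2) by (simp add: v_def set_lebesgue_integral_def integral_restrict_space)
  also have "\<dots> = (LBINT l:{0<..}. l powr (\<beta> - 1) * (LBINT s:{0<..}. exp (- l * s) * \<psi> (T (r + s) w)))"
    by (rule set_lebesgue_integral_cong) (use eq in auto)
  finally show "(LBINT l:{0<..}. l powr (\<beta> - 1) * (LBINT s:{0<..}. exp (- l * s) * \<psi> (T (r + s) w))) = \<psi> (T r v)" ..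
qed

text \<open>Balakrishnan's integral for the orbit started at \<open>r\<close> is the functional of
  \<open>T r v\<close> with \<open>v = \<Gamma> *\<^sub>R y\<close>. Hence \<open>K * norm y\<close>
  serves as \<open>B\<close> in the fractional difference bound for every starting time, and
  shifting the orbit by \<open>a\<close> reaches arbitrary pairs of times.\<close>

lemma functional_orbit_hoelder:
  assumes \<beta>: "0 < \<beta>" "\<beta> < 1" and xw: "(x, w) \<in> A" and \<psi>: "bounded_linear \<psi>" "\<And>z. \<bar>\<psi> z\<bar> \<le> norm z"
    and y: "y = (sin (pi * \<beta>) / pi) *\<^sub>R vector_integral (restrict_space lborel {0<..})
      (\<lambda>l. (l powr (\<beta> - 1)) *\<^sub>R resolvent_neg A l w)"
    and a: "a \<ge> 0" and b: "b \<ge> 0"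
  shows "\<bar>\<psi> (T b x) - \<psi> (T a x)\<bar> \<le> 4 * K * norm y * \<bar>b - a\<bar> powr \<beta>"
proof -
  define v where "v = vector_integral (restrict_space lborel {0<..}) (\<lambda>l. (l powr (\<beta> - 1)) *\<^sub>R resolvent_neg A l w)"
  define \<Gamma> where "\<Gamma> = Gamma \<beta> * Gamma (1 - \<beta>)"
  have \<Gamma>: "\<Gamma> > 0" unfolding \<Gamma>_def using \<beta> by (intro mult_pos_pos Gamma_real_pos) auto
  have v: "v = \<Gamma> *\<^sub>R y"
    unfolding y v_def[symmetric] sin_pi_eq_Gamma[OF \<beta>] using \<Gamma> by (simp add: \<Gamma>_def[symmetric])
  note orbit = bounded_linear_functional_orbit[OF T(1) K \<psi>(1)]
  note bala = balakrishnan_functional[OF \<beta> xw \<psi>, folded v_def]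
  have main: "\<bar>\<psi> (T (a + h) x) - \<psi> (T a x)\<bar> \<le> 4 * K * norm y * h powr \<beta>" if a: "a \<ge> 0" and h: "h > 0" for a h
  proof -
    have shift: "\<psi> (T (a + (r + s)) w) = \<psi> (T ((a + r) + s) w)" for r s by (simp add: add.assoc)
    have "\<bar>\<psi> (T (a + h) x) - \<psi> (T (a + 0) x)\<bar> \<le> 2 * h powr \<beta> / Gamma (\<beta> + 1) * (K * norm y)"
    proof (rule fractional_difference_bound[where u = "\<lambda>s. \<psi> (T (a + s) x)" and g = "\<lambda>s. \<psi> (T (a + s) w)"
          and U = "K * norm x" and G = "K * norm w", OF \<beta>])
      fix s :: real assume s: "s \<ge> 0"
      have "((\<lambda>s. \<psi> (T s x)) has_real_derivative - \<psi> (T (a + s) w)) (at (a + s) within (\<lambda>s. a + s) ` {0..})"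
        by (rule has_field_derivative_subset[OF orbit(3)[OF T(2) xw]]) (use a s in auto)
      then have "((\<lambda>s. \<psi> (T s x)) \<circ> (\<lambda>s. a + s) has_real_derivative - \<psi> (T (a + s) w) * 1) (at s within {0..})"
        by (rule DERIV_image_chain) (auto intro!: derivative_eq_intros)
      then show "((\<lambda>s. \<psi> (T (a + s) x)) has_real_derivative - \<psi> (T (a + s) w)) (at s within {0..})"
        by (simp add: o_def)
      show "\<bar>\<psi> (T (a + s) x)\<bar> \<le> K * norm x" "\<bar>\<psi> (T (a + s) w)\<bar> \<le> K * norm w"
        using a s by (auto intro!: orbit(2)[OF \<psi>(2)])
    next
      show "continuous_on {0..} (\<lambda>s. \<psi> (T (a + s) w))"
        using a by (intro continuous_on_compose2[OF orbit(1)] continuous_intros) auto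
    next
      fix r :: real assume r: "r \<ge> 0"
      show "set_integrable lborel {0<..} (\<lambda>m. m powr (\<beta> - 1) * (LBINT s:{0<..}. exp (- m * s) * \<psi> (T (a + (r + s)) w)))"
        unfolding shift by (rule bala(1)) (use a r in simp)
      have "\<bar>\<psi> (T (a + r) v)\<bar> \<le> K * norm v" using a r by (intro orbit(2)[OF \<psi>(2)]) auto
      also have "\<dots> = \<Gamma> * (K * norm y)" using \<Gamma> by (simp add: v)
      finally show "\<bar>LBINT m:{0<..}. m powr (\<beta> - 1) * (LBINT s:{0<..}. exp (- m * s) * \<psi> (T (a + (r + s)) w))\<bar>
          \<le> Gamma \<beta> * Gamma (1 - \<beta>) * (K * norm y)"
        unfolding shift using a r by (subst bala(2)) (auto simp: \<Gamma>_def)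
    qed (rule h)
    also have "\<dots> \<le> 4 * h powr \<beta> * (K * norm y)"
    proof (rule mult_right_mono)
      have "h powr \<beta> * 1 \<le> h powr \<beta> * (2 * Gamma (\<beta> + 1))"
        using Gamma_plus1_ge_half[OF \<beta>] by (intro mult_left_mono) auto
      then show "2 * h powr \<beta> / Gamma (\<beta> + 1) \<le> 4 * h powr \<beta>"
        using Gamma_plus1_ge_half[OF \<beta>] by (simp add: field_simps)
    qed (use orbit_bound_nonneg in auto)
    finally show ?thesis by (simp add: mult_ac)
  qed
  consider "b = a" | "b > a" | "b < a" by linarith
  then show ?thesis
  proof cases
    case 2
    then show ?thesis using main[OF a, of "b - a"] by simp
  next
    case 3
    then show ?thesis using main[OF b, of "a - b"] by (simp add: abs_minus_commute)
  qed simp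
qed

text \<open>For \<open>\<alpha> \<le> 1\<close> take \<open>\<kappa> = 0\<close>; for \<open>\<alpha> > 1\<close> the functional orbit is expanded to first order.\<close>

lemma functional_orbit_expansion:
  assumes \<alpha>: "0 < \<alpha>" "\<alpha> \<le> 2"
    and xy: "(x, y) \<in> (if \<alpha> \<in> \<int> then A ^^ nat \<lfloor>\<alpha>\<rfloor> else balakrishnan A \<alpha>)"
    and \<psi>: "bounded_linear \<psi>" "\<And>z. \<bar>\<psi> z\<bar> \<le> norm z" and t: "t \<ge> 0"
  shows "\<exists>\<kappa>. \<forall>s\<ge>0. \<bar>\<psi> (T s x) - \<psi> (T t x) + (s - t) * \<kappa>\<bar> \<le> 4 * K * norm y * \<bar>s - t\<bar> powr \<alpha>"
proof -
  note orbit = bounded_linear_functional_orbit[OF T(1) K \<psi>(1)]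
  \<comment> \<open>The mean value inequality gives the constant 1; it is weakened to 4 so that
    integer exponents share the form of the fractional ones.\<close>
  have lipschitz: "\<bar>\<psi> (T b x) - \<psi> (T a x)\<bar> \<le> 4 * K * norm w * \<bar>b - a\<bar> powr 1"
    if xw: "(x, w) \<in> A" and a: "a \<ge> 0" and b: "b \<ge> 0" for x w a b
  proof -
    have "norm (\<psi> (T b x) - \<psi> (T a x)) \<le> (K * norm w) * norm (b - a)"
    proof (rule field_differentiable_bound[of "{0..}"])
      show "((\<lambda>s. \<psi> (T s x)) has_real_derivative - \<psi> (T z w)) (at z within {0..})" if "z \<in> {0..}" for z
        using that by (intro orbit(3)[OF T(2) xw]) auto
      show "norm (- \<psi> (T z w)) \<le> K * norm w" if "z \<in> {0..}" for z
        using orbit(2)[OF \<psi>(2), of z w] that by simp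
    qed (use a b in auto)
    also have "\<dots> \<le> 4 * (K * norm w) * norm (b - a)"
      using orbit_bound_nonneg by (intro mult_right_mono) auto
    finally show ?thesis by (simp add: mult_ac)
  qed
  \<comment> \<open>Adding \<open>r * \<psi> (T t x1)\<close> makes the derivative vanish at
    \<open>r = t\<close>. Between \<open>s\<close> and \<open>t\<close> it is bounded by the Hoelder
    estimate for \<open>x1\<close>, and the mean value inequality contributes one more power of
    \<open>\<bar>s - t\<bar>\<close>.\<close>
  have integrate: "\<bar>\<psi> (T s x) - \<psi> (T t x) + (s - t) * \<psi> (T t x1)\<bar> \<le> 4 * K * norm y * \<bar>s - t\<bar> powr (1 + \<beta>)"
    if xx1: "(x, x1) \<in> A" and \<beta>: "\<beta> > 0" and s: "s \<ge> 0"
      and h: "\<And>r. r \<ge> 0 \<Longrightarrow> \<bar>\<psi> (T r x1) - \<psi> (T t x1)\<bar> \<le> 4 * K * norm y * \<bar>r - t\<bar> powr \<beta>" for x1 s \<beta>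
  proof -
    let ?I = "{min s t..max s t}"
    let ?v = "\<lambda>r. \<psi> (T r x) + r * \<psi> (T t x1)"
    have "norm (?v s - ?v t) \<le> (4 * K * norm y * \<bar>s - t\<bar> powr \<beta>) * norm (s - t)"
    proof (rule field_differentiable_bound[of ?I])
      fix r assume r: "r \<in> ?I"
      then have r0: "r \<ge> 0" using s t by auto
      have "((\<lambda>s. \<psi> (T s x)) has_real_derivative - \<psi> (T r x1)) (at r within ?I)"
        by (rule has_field_derivative_subset[OF orbit(3)[OF T(2) xx1 r0]]) (use s t in auto)
      then show "(?v has_real_derivative - \<psi> (T r x1) + \<psi> (T t x1)) (at r within ?I)"
        by (auto intro!: derivative_eq_intros)
      have "\<bar>\<psi> (T r x1) - \<psi> (T t x1)\<bar> \<le> 4 * K * norm y * \<bar>r - t\<bar> powr \<beta>" by (rule h[OF r0])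
      also have "\<dots> \<le> 4 * K * norm y * \<bar>s - t\<bar> powr \<beta>"
        using orbit_bound_nonneg r \<beta> by (intro mult_left_mono powr_mono2) auto
      finally show "norm (- \<psi> (T r x1) + \<psi> (T t x1)) \<le> 4 * K * norm y * \<bar>s - t\<bar> powr \<beta>" by simp
    qed auto
    moreover have "(4 * K * norm y * \<bar>s - t\<bar> powr \<beta>) * norm (s - t) = 4 * K * norm y * \<bar>s - t\<bar> powr (1 + \<beta>)"
      by (cases "s = t") (auto simp: powr_add)
    moreover have "?v s - ?v t = \<psi> (T s x) - \<psi> (T t x) + (s - t) * \<psi> (T t x1)" by (simp add: algebra_simps)
    ultimately show ?thesis by (simp only: real_norm_def)
  qed
  show ?thesis
  proof (cases "\<alpha> \<in> \<int>")
    case True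
    then have "\<alpha> = 1 \<or> \<alpha> = 2" using \<alpha> by (auto elim!: Ints_cases)
    then show ?thesis
    proof
      assume \<alpha>: "\<alpha> = 1"
      then have "(x, y) \<in> A" using xy by simp
      from lipschitz[OF this t] show ?thesis by (intro exI[of _ 0]) (simp add: \<alpha>)
    next
      assume \<alpha>: "\<alpha> = 2"
      then have "(x, y) \<in> A ^^ 2" using xy by simp
      then obtain x1 where x1: "(x, x1) \<in> A" "(x1, y) \<in> A" by (auto simp: numeral_2_eq_2)
      from integrate[OF x1(1), of 1] lipschitz[OF x1(2) t] show ?thesis
        by (intro exI[of _ "\<psi> (T t x1)"]) (auto simp: \<alpha>)
    qed
  next
    case False
    define \<beta> where "\<beta> = frac \<alpha>"
    have \<beta>: "0 < \<beta>" "\<beta> < 1" using False by (auto simp: \<beta>_def frac_lt_1 frac_gt_0_iff)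
    obtain w where w: "(x, w) \<in> A ^^ (nat \<lfloor>\<alpha>\<rfloor> + 1)"
      and y: "y = (sin (pi * \<beta>) / pi) *\<^sub>R vector_integral (restrict_space lborel {0<..})
         (\<lambda>l. (l powr (\<beta> - 1)) *\<^sub>R resolvent_neg A l w)"
      using xy False by (auto simp: balakrishnan_def \<beta>_def)
    have "\<alpha> \<noteq> 2" "\<alpha> \<noteq> 1" using False by auto
    then consider "\<alpha> < 1" | "1 < \<alpha>" "\<alpha> < 2" using \<alpha> by linarith
    then show ?thesis
    proof cases
      case 1
      then have fl: "\<lfloor>\<alpha>\<rfloor> = 0" using \<alpha> by linarith
      then have "\<beta> = \<alpha>" "(x, w) \<in> A" using w by (auto simp: \<beta>_def frac_def)
      then show ?thesis
        using functional_orbit_hoelder[OF \<beta> _ \<psi> y t] by (intro exI[of _ 0]) auto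
    next
      case 2
      then have fl: "\<lfloor>\<alpha>\<rfloor> = 1" using \<alpha> by linarith
      then have "1 + \<beta> = \<alpha>" "(x, w) \<in> A ^^ 2" using w by (auto simp: \<beta>_def frac_def numeral_2_eq_2)
      then obtain x1 where x1: "(x, x1) \<in> A" "(x1, w) \<in> A" by (auto simp: numeral_2_eq_2)
      show ?thesis
        using integrate[OF x1(1) \<beta>(1)] functional_orbit_hoelder[OF \<beta> x1(2) \<psi> y t] \<open>1 + \<beta> = \<alpha>\<close>
        by (intro exI[of _ "\<psi> (T t x1)"]) auto
    qed
  qed
qed

end

text \<open>Jensen's inequality for the power \<open>\<alpha> / 2\<close>, obtained by integrating
  Young's inequality with a scale \<open>W > V\<close> and letting \<open>W\<close> decrease to
  \<open>V\<close>. The strict inequality covers \<open>V = 0\<close>, where division by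
  \<open>V\<close> fails.\<close>

lemma integral_powr_le_variance:
  fixes P :: "'s measure" and X :: "'s \<Rightarrow> real" and V \<alpha> :: real
  assumes P: "prob_space P" and X: "integrable P (\<lambda>s. (X s)\<^sup>2)" "X \<in> borel_measurable P"
    and V: "(LINT s|P. (X s)\<^sup>2) \<le> V" and \<alpha>: "0 < \<alpha>" "\<alpha> \<le> 2"
  shows "integrable P (\<lambda>s. \<bar>X s\<bar> powr \<alpha>)" "(LINT s|P. \<bar>X s\<bar> powr \<alpha>) \<le> V powr (\<alpha> / 2)"
proof -
  interpret P: prob_space P by (rule P)
  have young: "\<bar>a\<bar> powr \<alpha> \<le> W powr (\<alpha> / 2) * ((\<alpha> / 2) * (a\<^sup>2 / W) + (1 - \<alpha> / 2))" if W: "W > 0" for a W :: real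
  proof (cases "a = 0")
    case True
    then show ?thesis using W \<alpha> by simp
  next
    case False
    have "(a\<^sup>2 / W) powr (\<alpha> / 2) * 1 powr (1 - \<alpha> / 2) \<le> (\<alpha> / 2) * (a\<^sup>2 / W) + (1 - \<alpha> / 2) * 1"
      using W \<alpha> False by (intro Youngs_inequality_0) auto
    then have "(a\<^sup>2 / W) powr (\<alpha> / 2) \<le> (\<alpha> / 2) * (a\<^sup>2 / W) + (1 - \<alpha> / 2)" by simp
    from mult_left_mono[OF this, of "W powr (\<alpha> / 2)"]
    have "W powr (\<alpha> / 2) * (a\<^sup>2 / W) powr (\<alpha> / 2) \<le> W powr (\<alpha> / 2) * ((\<alpha> / 2) * (a\<^sup>2 / W) + (1 - \<alpha> / 2))"
      by simp
    also have "W powr (\<alpha> / 2) * (a\<^sup>2 / W) powr (\<alpha> / 2) = (a\<^sup>2) powr (\<alpha> / 2)"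
      using W by (simp add: powr_mult[symmetric])
    also have "(a\<^sup>2) powr (\<alpha> / 2) = \<bar>a\<bar> powr \<alpha>"
    proof -
      have sq: "a\<^sup>2 = \<bar>a\<bar> powr 2" using False by (simp add: powr_numeral)
      show ?thesis unfolding sq powr_powr by simp
    qed
    finally show ?thesis .
  qed
  have int_rhs: "integrable P (\<lambda>s. W powr (\<alpha> / 2) * ((\<alpha> / 2) * ((X s)\<^sup>2 / W) + (1 - \<alpha> / 2)))" for W
    by (intro integrable_mult_right Bochner_Integration.integrable_add integrable_divide X(1)) simp
  show int: "integrable P (\<lambda>s. \<bar>X s\<bar> powr \<alpha>)"
    by (rule Bochner_Integration.integrable_bound[OF int_rhs[of 1]])
      (use young[OF zero_less_one] X(2) in \<open>auto intro!: AE_I2 order_trans[OF _ abs_ge_self]\<close>)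
  have le: "(LINT s|P. \<bar>X s\<bar> powr \<alpha>) \<le> W powr (\<alpha> / 2)" if W: "W > V" for W
  proof -
    have "0 \<le> (LINT s|P. (X s)\<^sup>2)" by simp
    then have W0: "W > 0" using V W by linarith
    have "(LINT s|P. \<bar>X s\<bar> powr \<alpha>) \<le> (LINT s|P. W powr (\<alpha> / 2) * ((\<alpha> / 2) * ((X s)\<^sup>2 / W) + (1 - \<alpha> / 2)))"
      by (rule integral_mono[OF int int_rhs]) (rule young[OF W0])
    also have "\<dots> = W powr (\<alpha> / 2) * ((\<alpha> / 2) * ((LINT s|P. (X s)\<^sup>2) / W) + (1 - \<alpha> / 2))"
      using X(1) P.prob_space by simp
    also have "\<dots> \<le> W powr (\<alpha> / 2) * ((\<alpha> / 2) * 1 + (1 - \<alpha> / 2))"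
      using V W W0 \<alpha> by (intro mult_left_mono add_right_mono) auto
    finally show ?thesis by simp
  qed
  have "0 \<le> (LINT s|P. (X s)\<^sup>2)" by simp
  then have V0: "V \<ge> 0" using V by linarith
  have "((\<lambda>W. W powr (\<alpha> / 2)) \<longlongrightarrow> V powr (\<alpha> / 2)) (at_right V)"
  proof (cases "V = 0")
    case True
    have "((\<lambda>W. W powr (\<alpha> / 2)) \<longlongrightarrow> 0) (at_right 0)" using \<alpha> by real_asymp
    then show ?thesis using True by simp
  next
    case False
    then show ?thesis by (intro tendsto_intros) auto
  qed
  then show "(LINT s|P. \<bar>X s\<bar> powr \<alpha>) \<le> V powr (\<alpha> / 2)"
    by (rule tendsto_lowerbound) (use le in \<open>auto simp: eventually_at_filter\<close>)
qed

text \<open>For each functional the expansion at \<open>t\<close> is integrated against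
  \<open>P\<close>; its linear term may depend on the functional because it has mean 0, while the
  remainder bound does not. \<open>F\<close> stands for the rescaled semigroup and is constrained
  only at nonnegative times, where \<open>P\<close> lives.\<close>

lemma subordination_error_bound:
  fixes T :: "real \<Rightarrow> 'a::banach \<Rightarrow>\<^sub>L 'a"
  assumes T: "C0_semigroup T" "generator T = op_scale (-1) A" and K: "\<forall>s\<ge>0. norm (T s) \<le> K"
    and P: "real_distribution P" "AE s in P. s \<ge> 0" and c: "c > 0" and t: "t \<ge> 0"
    and int: "integrable P (\<lambda>s. s)" "integrable P (\<lambda>s. s\<^sup>2)"
    and mean: "c * (LINT s|P. s) = t" and var: "(LINT s|P. (c * s - t)\<^sup>2) \<le> V"
    and \<alpha>: "0 < \<alpha>" "\<alpha> \<le> 2" and xy: "(x, y) \<in> frac_power A \<alpha>"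
    and F: "\<And>s x. s \<ge> 0 \<Longrightarrow> F s x = T (c * s) x"
  shows "norm (vector_integral (restrict_space P {0..}) (\<lambda>s. F s x) - T t x) \<le> 4 * K * V powr (\<alpha> / 2) * norm y"
proof -
  interpret P: real_distribution P by (rule P)
  let ?P = "restrict_space P {0..}"
  define E where "E x = vector_integral ?P (\<lambda>s. F s x)" for x
  have K0: "K \<ge> 0" by (rule orbit_bound_nonneg[OF T K])
  have bound: "norm (T s x) \<le> K * norm x" if "s \<ge> 0" for s x
    using K that by (intro order_trans[OF norm_blinfun mult_right_mono]) auto
  have cont: "continuous_on {0..} (\<lambda>s. F s x)" for x
  proof -
    have "continuous_on {0..} (\<lambda>s. T (c * s) x)"
      using c by (intro continuous_on_compose2[OF C0_semigroup_continuous_on[OF T(1)]] continuous_intros) auto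
    then show ?thesis by (rule continuous_on_cong[THEN iffD1, rotated 2]) (use F in auto)
  qed
  have fin: "(\<integral>\<^sup>+s. ennreal (norm (F s x)) \<partial>?P) < \<infinity>" for x
  proof -
    have "(\<integral>\<^sup>+s. ennreal (norm (F s x)) \<partial>?P) \<le> (\<integral>\<^sup>+s. ennreal (K * norm x) \<partial>?P)"
      using c by (intro nn_integral_mono ennreal_leI) (auto simp: F space_restrict_space intro!: bound)
    also have "\<dots> = ennreal (K * norm x) * emeasure ?P (space ?P)" by simp
    also have "\<dots> < \<infinity>"
      by (simp add: emeasure_restrict_space space_restrict_space ennreal_mult_less_top P.emeasure_eq_measure)
    finally show ?thesis .
  qed
  have sets: "sets ?P = sets (restrict_space borel {0..})" by (rule sets_restrict_space_cong) simp
  have E_fun: "integrable ?P (\<lambda>s. \<psi> (F s x))" "\<psi> (E x) = (LINT s|?P. \<psi> (F s x))"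
    if "bounded_linear \<psi>" for \<psi> :: "'a \<Rightarrow> real" and x
    unfolding E_def by (rule functional_vector_integral[OF sets cont fin that])+
  have prob: "prob_space ?P"
  proof (rule prob_spaceI)
    have "emeasure P {0..} = 1"
      using P(2) by (intro P.emeasure_eq_1_AE) auto
    then show "emeasure ?P (space ?P) = 1" by (simp add: emeasure_restrict_space space_restrict_space)
  qed
  interpret R: prob_space ?P by (rule prob)
  have restrict: "integrable ?P f \<longleftrightarrow> integrable P f" "(LINT s|?P. f s) = (LINT s|P. f s)"
    if f: "f \<in> borel_measurable borel" for f :: "real \<Rightarrow> real"
  proof -
    have ae: "AE s in P. indicator {0..} s *\<^sub>R f s = f s" using P(2) by eventually_elim simp
    show "integrable ?P f \<longleftrightarrow> integrable P f"
      unfolding integrable_restrict_space[of "{0..}" P f, simplified]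
      by (rule integrable_cong_AE) (use f ae in auto)
    show "(LINT s|?P. f s) = (LINT s|P. f s)"
      by (subst integral_restrict_space, simp, rule integral_cong_AE) (use f ae in auto)
  qed
  have intX: "integrable P (\<lambda>s. (c * s - t)\<^sup>2)"
  proof -
    have "(\<lambda>s. (c * s - t)\<^sup>2) = (\<lambda>s. c\<^sup>2 * s\<^sup>2 - 2 * c * t * s + t\<^sup>2)"
      by (auto simp: power2_eq_square algebra_simps)
    then show ?thesis using int by simp
  qed
  have intX_R: "integrable ?P (\<lambda>s. (c * s - t)\<^sup>2)" "(LINT s|?P. (c * s - t)\<^sup>2) \<le> V"
    using restrict[of "\<lambda>s. (c * s - t)\<^sup>2"] intX var by auto
  have affine: "(\<lambda>s. c * s - t) \<in> borel_measurable borel" by simp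
  have intP: "integrable P (\<lambda>s. c * s - t)"
    by (intro Bochner_Integration.integrable_diff integrable_mult_right int(1)) simp
  have meanP: "(LINT s|P. c * s - t) = 0"
    using Bochner_Integration.integral_diff[OF integrable_mult_right[OF int(1), of c] P.integrable_const[of t]] mean P.prob_space by simp
  have meanX: "integrable ?P (\<lambda>s. c * s - t)" "(LINT s|?P. c * s - t) = 0"
    by (simp_all only: restrict[OF affine] intP meanP)
  have meas: "(\<lambda>s. c * s - t) \<in> borel_measurable ?P" using meanX(1) by (rule borel_measurable_integrable)
  note pw = integral_powr_le_variance[OF prob intX_R(1) meas intX_R(2) \<alpha>]
  have core: "norm (E x - T t x) \<le> 4 * K * V powr (\<alpha> / 2) * norm y"
    if xy: "(x, y) \<in> (if \<alpha> \<in> \<int> then A ^^ nat \<lfloor>\<alpha>\<rfloor> else balakrishnan A \<alpha>)" for x y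
  proof (rule norm_le_by_functionals)
    fix \<psi> :: "'a \<Rightarrow> real" assume \<psi>: "bounded_linear \<psi>" "\<And>z. \<bar>\<psi> z\<bar> \<le> norm z"
    obtain \<kappa> where \<kappa>: "\<And>s. s \<ge> 0 \<Longrightarrow> \<bar>\<psi> (T s x) - \<psi> (T t x) + (s - t) * \<kappa>\<bar> \<le> 4 * K * norm y * \<bar>s - t\<bar> powr \<alpha>"
      using functional_orbit_expansion[OF T K \<alpha> xy \<psi> t] by blast
    have int1: "integrable ?P (\<lambda>s. \<psi> (F s x) - \<psi> (T t x) + (c * s - t) * \<kappa>)"
      by (intro Bochner_Integration.integrable_add Bochner_Integration.integrable_diff integrable_mult_left E_fun(1)[OF \<psi>(1)] meanX(1)) simp
    have "\<psi> (E x - T t x) = (LINT s|?P. \<psi> (F s x)) - \<psi> (T t x)"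
      by (simp add: linear_diff[OF bounded_linear.linear[OF \<psi>(1)]] E_fun(2)[OF \<psi>(1)])
    \<comment> \<open>The linear term can be inserted because \<open>c * s - t\<close> has mean
      0.\<close>
    also have "\<dots> = (LINT s|?P. \<psi> (F s x) - \<psi> (T t x) + (c * s - t) * \<kappa>)"
      using E_fun(1)[OF \<psi>(1), of x] meanX R.prob_space by simp
    also have "\<dots> \<le> (LINT s|?P. 4 * K * norm y * \<bar>c * s - t\<bar> powr \<alpha>)"
    proof (rule integral_mono[OF int1])
      show "integrable ?P (\<lambda>s. 4 * K * norm y * \<bar>c * s - t\<bar> powr \<alpha>)"
        by (rule integrable_mult_right[OF pw(1)])
      fix s assume "s \<in> space ?P"
      then have "s \<ge> 0" by (simp add: space_restrict_space)
      then show "\<psi> (F s x) - \<psi> (T t x) + (c * s - t) * \<kappa> \<le> 4 * K * norm y * \<bar>c * s - t\<bar> powr \<alpha>"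
        using \<kappa>[of "c * s"] c F[of s x] by simp
    qed
    also have "\<dots> = 4 * K * norm y * (LINT s|?P. \<bar>c * s - t\<bar> powr \<alpha>)" by simp
    also have "\<dots> \<le> 4 * K * norm y * V powr (\<alpha> / 2)"
      using pw(2) K0 by (intro mult_left_mono) auto
    finally show "\<psi> (E x - T t x) \<le> 4 * K * V powr (\<alpha> / 2) * norm y" by (simp add: mult_ac)
  qed
  \<comment> \<open>Lipschitz continuity of \<open>E\<close> carries the estimate from
    Balakrishnan's operator to its closure.\<close>
  have E_lip: "norm (E x - E x') \<le> K * norm (x - x')" for x x'
  proof (rule norm_le_by_functionals)
    fix \<psi> :: "'a \<Rightarrow> real" assume \<psi>: "bounded_linear \<psi>" "\<And>z. \<bar>\<psi> z\<bar> \<le> norm z"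
    note diff = linear_diff[OF bounded_linear.linear[OF \<psi>(1)]]
    have "\<psi> (E x - E x') = (LINT s|?P. \<psi> (F s x) - \<psi> (F s x'))"
      using E_fun[OF \<psi>(1), of x] E_fun[OF \<psi>(1), of x'] by (simp add: diff)
    also have "\<dots> \<le> (LINT s|?P. K * norm (x - x'))"
    proof (rule integral_mono)
      show "integrable ?P (\<lambda>s. \<psi> (F s x) - \<psi> (F s x'))"
        by (intro Bochner_Integration.integrable_diff E_fun(1)[OF \<psi>(1)])
      fix s assume "s \<in> space ?P"
      then have s: "s \<ge> 0" by (simp add: space_restrict_space)
      have "\<psi> (F s x) - \<psi> (F s x') = \<psi> (T (c * s) (x - x'))"
        using s by (simp add: F diff blinfun.diff_right)
      also have "\<dots> \<le> norm (T (c * s) (x - x'))" using \<psi>(2) by (rule order_trans[OF abs_ge_self])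
      also have "\<dots> \<le> K * norm (x - x')" using s c by (intro bound) simp
      finally show "\<psi> (F s x) - \<psi> (F s x') \<le> K * norm (x - x')" .
    qed simp
    also have "\<dots> = K * norm (x - x')" using R.prob_space by simp
    finally show "\<psi> (E x - E x') \<le> K * norm (x - x')" .
  qed
  have "norm (E x - T t x) \<le> 4 * K * V powr (\<alpha> / 2) * norm y"
  proof (cases "\<alpha> \<in> \<int>")
    case True
    then show ?thesis using core[of x y] xy by (simp add: frac_power_def)
  next
    case False
    then have "(x, y) \<in> closure (balakrishnan A \<alpha>)" using xy by (simp add: frac_power_def)
    then obtain p where p: "\<And>n. p n \<in> balakrishnan A \<alpha>" "p \<longlonglongrightarrow> (x, y)"
      unfolding closure_sequential by blast
    have px: "(\<lambda>n. fst (p n)) \<longlonglongrightarrow> x" and py: "(\<lambda>n. snd (p n)) \<longlonglongrightarrow> y"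
      using tendsto_fst[OF p(2)] tendsto_snd[OF p(2)] by auto
    have "(\<lambda>n. E (fst (p n)) - E x) \<longlonglongrightarrow> 0"
    proof (rule Lim_null_comparison)
      show "\<forall>\<^sub>F n in sequentially. norm (E (fst (p n)) - E x) \<le> K * norm (fst (p n) - x)"
        by (intro always_eventually allI E_lip)
      show "(\<lambda>n. K * norm (fst (p n) - x)) \<longlonglongrightarrow> 0"
        using tendsto_mult[OF tendsto_const tendsto_norm[OF tendsto_diff[OF px tendsto_const[of x]]], of K] by simp
    qed
    then have "(\<lambda>n. E (fst (p n))) \<longlonglongrightarrow> E x" by (rule LIM_zero_cancel)
    then have lim: "(\<lambda>n. norm (E (fst (p n)) - T t (fst (p n)))) \<longlonglongrightarrow> norm (E x - T t x)"
      by (intro tendsto_norm tendsto_diff blinfun.tendsto tendsto_const px)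
    have lim': "(\<lambda>n. 4 * K * V powr (\<alpha> / 2) * norm (snd (p n))) \<longlonglongrightarrow> 4 * K * V powr (\<alpha> / 2) * norm y"
      by (intro tendsto_mult tendsto_const tendsto_norm py)
    show ?thesis
      by (rule LIMSEQ_le[OF lim lim']) (use core[of "fst (p _)" "snd (p _)"] p(1) False in auto)
  qed
  then show ?thesis by (simp add: E_def)
qed

text \<open>The measure at time \<tau> has mean \<tau> and variance at most
  \<open>- \<tau> * l\<close>, and the factor \<open>c\<close> in time multiplies the variance by
  \<open>c\<^sup>2\<close>. The limit \<open>l\<close> is nonpositive because
  \<open>deriv (deriv \<phi>)\<close> is. The estimate holds with 4 and is relaxed to 8.\<close>

lemma exp_neg_bernstein_error_bound:
  fixes A :: "('a::banach \<times> 'a) set"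
  assumes T: "C0_semigroup T" "generator T = op_scale (-1) A" and K: "\<forall>s\<ge>0. norm (T s) \<le> K"
    and \<phi>: "\<phi> \<in> bernstein_Phi" and l: "(deriv (deriv \<phi>) \<longlongrightarrow> l) (at_right 0)"
    and \<alpha>: "0 < \<alpha>" "\<alpha> \<le> 2" and xy: "(x, y) \<in> frac_power A \<alpha>"
    and c: "c > 0" and \<tau>: "\<tau> \<ge> 0"
  shows "norm (exp_neg_bernstein \<phi> (op_scale c A) \<tau> x - exp_neg A (c * \<tau>) x)
    \<le> 8 * K * (c\<^sup>2 * \<tau> * \<bar>l\<bar>) powr (\<alpha> / 2) * norm y"
proof -
  obtain P where P: "real_distribution P" "AE s in P. s \<ge> 0"
    and laplace: "\<And>x. x > 0 \<Longrightarrow> (LINT s|P. exp (- x * s)) = exp (- \<tau> * \<phi> x)"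
    and sub: "subordination_measure \<phi> \<tau> = restrict_space P {0..}"
    by (rule subordination_measure_eq[OF \<phi> \<tau>]) blast
  interpret P: real_distribution P by (rule P)
  note mom = subordinator_moments[OF \<phi> l P laplace]
  have K0: "K \<ge> 0" by (rule orbit_bound_nonneg[OF T K])
  have "l \<le> 0"
  proof (rule tendsto_upperbound[OF l])
    have "bernstein_function \<phi>" using \<phi> by (simp add: bernstein_Phi_def)
    then have "deriv (deriv \<phi>) z \<le> 0" if "z > 0" for z
      using bernstein_functionD(1)[OF _ that, of \<phi> 1] by simp
    then show "\<forall>\<^sub>F z in at_right 0. deriv (deriv \<phi>) z \<le> 0"
      using eventually_at_right_less[of "0::real"] by (auto elim: eventually_mono)
  qed simp
  have "(LINT s|P. (c * s - c * \<tau>)\<^sup>2) = (LINT s|P. c\<^sup>2 * s\<^sup>2 - 2 * c\<^sup>2 * \<tau> * s + c\<^sup>2 * \<tau>\<^sup>2)"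
    by (intro Bochner_Integration.integral_cong) (auto simp: power2_eq_square algebra_simps)
  also have "\<dots> = c\<^sup>2 * (LINT s|P. s\<^sup>2) - c\<^sup>2 * \<tau>\<^sup>2"
    using mom(1,2,3) P.prob_space by (simp add: power2_eq_square)
  also have "\<dots> \<le> c\<^sup>2 * (\<tau>\<^sup>2 - \<tau> * l) - c\<^sup>2 * \<tau>\<^sup>2"
    using mom(4) by (intro diff_right_mono mult_left_mono) auto
  also have "\<dots> = c\<^sup>2 * \<tau> * \<bar>l\<bar>" using \<open>l \<le> 0\<close> by (simp add: algebra_simps)
  finally have var: "(LINT s|P. (c * s - c * \<tau>)\<^sup>2) \<le> c\<^sup>2 * \<tau> * \<bar>l\<bar>" .
  have c\<tau>: "c * \<tau> \<ge> 0" using c \<tau> by simp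
  have "norm (vector_integral (restrict_space P {0..}) (\<lambda>s. exp_neg (op_scale c A) s x) - T (c * \<tau>) x)
      \<le> 4 * K * (c\<^sup>2 * \<tau> * \<bar>l\<bar>) powr (\<alpha> / 2) * norm y"
    by (rule subordination_error_bound[OF T K P c c\<tau> mom(2,1) _ var \<alpha> xy])
      (use mom(3) exp_neg_op_scale[OF T c] in auto)
  also have "\<dots> \<le> 8 * K * (c\<^sup>2 * \<tau> * \<bar>l\<bar>) powr (\<alpha> / 2) * norm y"
    using K0 by (intro mult_right_mono) auto
  finally show ?thesis
    by (simp add: exp_neg_bernstein_def sub exp_neg_eq[OF T c\<tau>])
qed

theorem theorem5p1:
  fixes A :: "('a::banach \<times> 'a) set"
    and \<phi> :: "real \<Rightarrow> real"
    and M \<alpha> t :: real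
    and n :: nat
    and x y :: 'a
  assumes "neg_generates_bounded A"
    and "M = (SUP s\<in>{0..}. norm (exp_neg A s))"
    and "\<phi> \<in> bernstein_Phi"
    and "0 < \<alpha>" and "\<alpha> \<le> 2"
    and "(x, y) \<in> frac_power A \<alpha>"
    and "t > 0" and "n \<ge> 1"
  shows "norm (exp_neg_bernstein \<phi> (op_scale (1 / real n) A) (real n * t) x
            - blinfun_apply (exp_neg A t) x)
         \<le> 8 * M * (t * \<bar>Lim (at_right 0) (deriv (deriv \<phi>))\<bar> / real n) powr (\<alpha> / 2) * norm y
       \<and> norm (exp_neg_bernstein \<phi> (op_scale (t / real n) A) (real n) x
            - blinfun_apply (exp_neg A t) x)
         \<le> 8 * M * (t\<^sup>2 * \<bar>Lim (at_right 0) (deriv (deriv \<phi>))\<bar> / real n) powr (\<alpha> / 2) * norm y"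
proof -
  obtain T where T: "C0_semigroup T" "generator T = op_scale (-1) A" "bdd_above ((\<lambda>t. norm (T t)) ` {0..})"
    using assms(1) unfolding neg_generates_bounded_def bounded_C0_semigroup_def by blast
  have "M = (SUP s\<in>{0..}. norm (T s))"
    unfolding assms(2) by (intro SUP_cong) (auto simp: exp_neg_eq[OF T(1,2)])
  then have M: "\<forall>s\<ge>0. norm (T s) \<le> M"
    using T(3) by (auto intro: cSUP_upper)
  obtain l where l: "(deriv (deriv \<phi>) \<longlongrightarrow> l) (at_right 0)"
    using assms(3) by (auto simp: bernstein_Phi_def)
  then have Lim: "Lim (at_right 0) (deriv (deriv \<phi>)) = l"
    by (intro tendsto_Lim) simp
  note bound = exp_neg_bernstein_error_bound[OF T(1,2) M assms(3) l assms(4-6)]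
  have n: "real n > 0" using assms(8) by simp
  \<comment> \<open>The two choices are \<open>c = 1 / n\<close> with \<open>\<tau> = n * t\<close>,
    and \<open>c = t / n\<close> with \<open>\<tau> = n\<close>. Both have
    \<open>c * \<tau> = t\<close>; the variance bound
    \<open>c\<^sup>2 * \<tau> * \<bar>l\<bar>\<close> produces the two right-hand sides.\<close>
  have "(1 / real n)\<^sup>2 * (real n * t) * \<bar>l\<bar> = t * \<bar>l\<bar> / real n" "1 / real n * (real n * t) = t"
    "(t / real n)\<^sup>2 * real n * \<bar>l\<bar> = t\<^sup>2 * \<bar>l\<bar> / real n" "t / real n * real n = t"
    using n by (simp_all add: power2_eq_square field_simps)
  then show ?thesis
    using bound[of "1 / real n" "real n * t"] bound[of "t / real n" "real n"] n assms(7)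
    by (simp only: Lim) simp
qed

end
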